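(* Let $A$ be a self-adjoint operator on $\mathcal{H}$, let $\lambda\in\sigma_{\rm d}(A)$ be a discrete eigenvalue of $A$ with multiplicity $q$, and let $(\mathcal{T}_n)_{n\in\mathbb{N}}=(X_n,a_n,m_n)_{n\in\mathbb{N}}$ be an approximation of $A$ satisfying assumptions (A1), (A2), (A3), (A4) (all spelled out in the context). Then: 1. (Convergence of the eigenvalues) $\lambda\in\underline{\lim}_{n\to\infty}\,\sigma(A_n)$. 2. (A priori error estimates in the absence of spectral pollution) Assume that (B1) there exists $\varepsilon>0$ such that $(\lambda-\varepsilon,\lambda+\varepsilon)\cap\sigma(A)=\{\lambda\}$ and $\left(\overline{\lim}_{n\to\infty}\sigma(A_n)\right)\cap(\lambda-\varepsilon,\lambda+\varepsilon)=\{\lambda\}$. Let $\mathcal{P}:=\mathbf{1}_{\{\lambda\}}(A)$ be the orthogonal projection on $\mathrm{Ker}(A-\lambda)$ and $$\mathcal{P}_n:=i_{X_n}\,\mathcal{M}_n^{-1/2}\,\mathbf{1}_{(\lambda-\varepsilon/2,\lambda+\varepsilon/2)}(A_n)\,\mathcal{M}_n^{1/2}\,i_{X_n}^*.$$ Then, for $n$ large enough, $\mathrm{Rank}(\mathcal{P}_n)\ge q$, and there exists $C\in\mathbb{R}_+$ such that, for $n$ large enough, $$\|(\mathcal{P}-\mathcal{P}_n)\mathcal{P}\|_{\mathcal{L}(\mathcal{H},Q(A))}\le C\left(\left\|\left(1-\Pi_{X_n}^{Q(A)}\right)\mathcal{P}\right\|_{\mathcal{L}(\mathcal{H},Q(A))}+\mathcal{R}_n^a+\mathcal{R}_n^m+\mathcal{S}_n^a+\mathcal{S}_n^m\right),$$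 where $$\mathcal{R}_n^a:=\sup_{\psi\in\mathrm{Ran}(\mathcal{P}),\,\|\psi\|_{\mathcal{H}}=1}r_n^a(\psi),\quad \mathcal{R}_n^m:=\sup_{\psi\in\mathrm{Ran}(\mathcal{P}),\,\|\psi\|_{\mathcal{H}}=1}r_n^m(\psi),$$ $$\mathcal{S}_n^a:=\sup_{\psi\in\mathrm{Ran}(\mathcal{P}),\,\|\psi\|_{\mathcal{H}}=1}s_n^a(\psi),\quad \mathcal{S}_n^m:=\sup_{\psi\in\mathrm{Ran}(\mathcal{P}),\,\|\psi\|_{\mathcal{H}}=1}s_n^m(\psi).$$ If we assume in addition that (B2) for $n$ large enough, $\mathrm{Rank}(\mathcal{P}_n)=q$, then there exists $C\in\mathbb{R}_+$ such that, for $n$ large enough, $$\|(\mathcal{P}-\mathcal{P}_n)\mathcal{P}_n\|_{\mathcal{L}(\mathcal{H},Q(A))}\le C\left(\left\|\left(1-\Pi_{X_n}^{Q(A)}\right)\mathcal{P}\right\|_{\mathcal{L}(\mathcal{H},Q(A))}+\mathcal{R}_n^a+\mathcal{R}_n^m+\mathcal{S}_n^a+\mathcal{S}_n^m\right),$$ $$\max_{\lambda_n\in\sigma(A_n)\cap(\lambda-\varepsilon/2,\lambda+\varepsilon/2)}|\lambda_n-\lambda|\le C\left(\left(\left\|\left(1-\Pi_{X_n}^{Q(A)}\right)\mathcal{P}\right\|_{\mathcal{L}(\mathcal{H},Q(A))}+\mathcal{R}_n^a+\mathcal{R}_n^m\right)^2+\mathcal{S}_n^a+\mathcal{S}_n^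m\right).$$
   Context: $\mathcal{H}$ is a separable Hilbert space with scalar product $m(\cdot,\cdot)$ and norm $\|\cdot\|_{\mathcal{H}}$; $A$ is a self-adjoint operator on $\mathcal{H}$ with dense domain $D(A)$. $Q(A):=D(|A|^{1/2})$ is the form domain of $A$, and $a(\cdot,\cdot)$ is the symmetric bilinear form on $Q(A)$ associated with $A$. $Q(A)$ is a Hilbert space for $\langle\psi,\phi\rangle_{Q(A)}:=m(\psi,\phi)+m(|A|^{1/2}\psi,|A|^{1/2}\phi)$, with norm $\|\cdot\|_{Q(A)}$. (If the scalars are complex, "symmetric bilinear form" is read as Hermitian sesquilinear form.) $\sigma(A)$ is the spectrum of $A$; $\sigma_{\rm d}(A)$ is its discrete spectrum (isolated eigenvalues of finite multiplicity). $\mathbf{1}_B$ is the characteristic function of a Borel set $B\subset\mathbb{R}$, and $\mathbf{1}_B(A)$ is defined by functional calculus. For a finite dimensional subspace $X\subset Q(A)$: $i_X:X\hookrightarrow\mathcal{H}$ is the canonical embedding; $i_X^*:\mathcal{H}\to X$ is its adjoint (the $m$-orthogonal projection onto $X$); $\Pi_X^{Q(A)}:Q(A)\to Q(A)$ is the orthogonal projection onto $X$ for $\langle\cdot,\cdot\rangle_{Q(A)}$. An approximation of $A$ is a sequence $\mathcal{T}_n=(X_n,a_n,m_n)$, $n\in\mathbb{N}$, where the $X_n$ are finite dimensional subspaces of $Q(A)$, $a_n$ and $m_n$ are symmetric bilinear forms on $Q(A)$, and the restriction of $m_n$ to $X_n$ is a scalar product on $X_n$. Define linear operators $\mathcal{A}_n,\mathcal{M}_n:X_n\to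 X_n$ by $m(\mathcal{A}_n\phi_n,\psi_n)=a_n(\phi_n,\psi_n)$ and $m(\mathcal{M}_n\phi_n,\psi_n)=m_n(\phi_n,\psi_n)$ for all $\phi_n,\psi_n\in X_n$, and $A_n:=\mathcal{M}_n^{-1/2}\mathcal{A}_n\mathcal{M}_n^{-1/2}$, an $m$-symmetric operator on $X_n$. For a sequence $(E_n)$ of subsets of $\mathbb{C}$: $\overline{\lim}_{n\to\infty}E_n$ is the set of $\lambda\in\mathbb{C}$ for which there exist a subsequence $(E_{n_k})$ and $\lambda_{n_k}\in E_{n_k}$ with $\lambda_{n_k}\to\lambda$; $\underline{\lim}_{n\to\infty}E_n$ is the set of $\lambda\in\mathbb{C}$ for which there exist $\lambda_n\in E_n$ for all $n$ with $\lambda_n\to\lambda$. Assumptions (infima and suprema of quotients are over nonzero vectors): (A1) For all $\psi\in Q(A)$, $\|(1-\Pi_{X_n}^{Q(A)})\psi\|_{Q(A)}\to0$ as $n\to\infty$. (A2) There exist $0<\gamma\le\Gamma<\infty$ such that for all $n\in\mathbb{N}$ and all $\psi_n,\phi_n\in X_n$: $\gamma\|\psi_n\|_{\mathcal{H}}^2\le m_n(\psi_n,\psi_n)\le\Gamma\|\psi_n\|_{\mathcal{H}}^2$ and $|a_n(\psi_n,\phi_n)|\le\Gamma\|\psi_n\|_{Q(A)}\|\phi_n\|_{Q(A)}$. (A3) For any compact subset $K\subset\mathbb{C}$, if there exists a subsequence $(\mathcal{T}_{n_k})_{k\in\mathbb{N}}$ such that $\mathrm{dist}(K,\sigma(A_{n_k}))\ge\alpha_K$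 for some $\alpha_K>0$ independent of $k$, then there exists $c_K>0$ such that for all $\mu\in K$ and all $k\in\mathbb{N}$, $$\inf_{w_{n_k}\in X_{n_k}}\sup_{v_{n_k}\in X_{n_k}}\frac{|(a_{n_k}-\mu m_{n_k})(w_{n_k},v_{n_k})|}{\|w_{n_k}\|_{Q(A)}\|v_{n_k}\|_{Q(A)}}\ge c_K.$$ (A4) There exist $\kappa\in\mathbb{R}_+$ and, for each $n\in\mathbb{N}$, two symmetric bilinear forms $\widetilde a_n,\widetilde m_n$ on $Q(A)$ and four seminorms $r_n^a,r_n^m,s_n^a,s_n^m$ on $Q(A)$ such that: for all $\phi_n,\psi_n\in X_n$ (with $\gamma,\Gamma$ as in (A2)), $\gamma\|\psi_n\|_{\mathcal{H}}^2\le\widetilde m_n(\psi_n,\psi_n)\le\Gamma\|\psi_n\|_{\mathcal{H}}^2$ and $|\widetilde a_n(\psi_n,\phi_n)|\le\Gamma\|\psi_n\|_{Q(A)}\|\phi_n\|_{Q(A)}$; and for all $\phi,\psi\in Q(A)$, - $|(a-\widetilde a_n)(\phi,\psi)|\le r_n^a(\phi)r_n^a(\psi)$, $\ |(m-\widetilde m_n)(\phi,\psi)|\le r_n^m(\phi)r_n^m(\psi)$, - $r_n^a(\phi)\le\kappa\|\phi\|_{Q(A)}$, $\ r_n^m(\phi)\le\kappa\|\phi\|_{\mathcal{H}}$, $\ r_n^a(\phi)\to0$ and $r_n^m(\phi)\to0$ as $n\to\infty$, - $\sup_{w_n\in X_n}\frac{|(a_n-\widetilde a_n)(\Pi_{X_n}^{Q(A)}\phi,w_n)|}{\|w_n\|_{Q(A)}}\le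 s_n^a(\phi)$, $\ \sup_{w_n\in X_n}\frac{|(m_n-\widetilde m_n)(\Pi_{X_n}^{Q(A)}\phi,w_n)|}{\|w_n\|_{Q(A)}}\le s_n^m(\phi)$, - $s_n^a(\phi)\le\kappa\|\phi\|_{Q(A)}$, $\ s_n^m(\phi)\le\kappa\|\phi\|_{\mathcal{H}}$, $\ s_n^a(\phi)\to0$ and $s_n^m(\phi)\to0$ as $n\to\infty$.
   Formalization: Part 1 as written fails if some X_n = {0}, since then σ(A_n) is empty; it is stated for the full sequence when all X_n are nonzero, and in general for the sequence from some index N on. *)

theory Defs
  imports "HOL-Analysis.Analysis"
begin

section \<open>Scalars and Hilbert spaces\<close>

text \<open>The scalar field is \<open>\<real>\<close> or \<open>\<complex>\<close>: the axioms make \<open>to_complex\<close> an isometric embedding of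
  real algebras, so its range is a real subalgebra of \<open>\<complex>\<close>, that is \<open>\<real>\<close> or \<open>\<complex>\<close>.\<close>

class real_or_complex = real_normed_field +
  fixes to_complex :: "'a \<Rightarrow> complex"
    and sconj :: "'a \<Rightarrow> 'a"
  assumes to_complex_add: "to_complex (x + y) = to_complex x + to_complex y"
    and to_complex_mult: "to_complex (x * y) = to_complex x * to_complex y"
    and to_complex_scaleR: "to_complex (r *\<^sub>R x) = r *\<^sub>R to_complex x"
    and norm_to_complex: "cmod (to_complex x) = norm x"
    and to_complex_sconj: "to_complex (sconj x) = cnj (to_complex x)"

instantiation real :: real_or_complex
begin
definition "to_complex (x::real) = complex_of_real x"
definition "sconj (x::real) = x"
instance by standard (simp_all add: to_complex_real_def sconj_real_def scaleR_conv_of_real)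
end

instantiation complex :: real_or_complex
begin
definition "to_complex (z::complex) = z"
definition "sconj (z::complex) = cnj z"
instance by standard (simp_all add: to_complex_complex_def sconj_complex_def)
end

definition real_part :: "'k::real_or_complex \<Rightarrow> real"
  where "real_part c = Re (to_complex c)"

type_synonym ('k, 'h) form = "'h \<Rightarrow> 'h \<Rightarrow> 'k"

text \<open>The scalar product \<open>m\<close> is linear in its first argument. The topology, the norm and the
  real-linear structure are those of the type \<open>'h\<close>; completeness and separability come from
  \<^class>\<open>polish_space\<close>.\<close>

locale hilbert_space = vector_space smul
  for smul :: "'k::real_or_complex \<Rightarrow> 'h::{real_inner, polish_space} \<Rightarrow> 'h" +
  fixes m :: "('k, 'h) form"
  assumes smul_of_real: "smul (of_real r) x = r *\<^sub>R x"
    and m_add_left: "m (x + y) z = m x z + m y z"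
    and m_smul_left: "m (smul c x) z = c * m x z"
    and m_conj: "m y x = sconj (m x y)"
    and m_self: "m x x = of_real ((norm x)\<^sup>2)"

definition hermitian_form_on ::
    "('k::real_or_complex \<Rightarrow> 'h::ab_group_add \<Rightarrow> 'h) \<Rightarrow> 'h set \<Rightarrow> ('k, 'h) form \<Rightarrow> bool"
  where "hermitian_form_on smul V b \<longleftrightarrow>
    (\<forall>x\<in>V. \<forall>y\<in>V. \<forall>z\<in>V. b (x + y) z = b x z + b y z) \<and>
    (\<forall>c. \<forall>x\<in>V. \<forall>y\<in>V. b (smul c x) y = c * b x y) \<and>
    (\<forall>x\<in>V. \<forall>y\<in>V. b y x = sconj (b x y))"

definition seminorm_on ::
    "('k::real_or_complex \<Rightarrow> 'h::ab_group_add \<Rightarrow> 'h) \<Rightarrow> 'h set \<Rightarrow> ('h \<Rightarrow> real) \<Rightarrow> bool"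
  where "seminorm_on smul V p \<longleftrightarrow>
    (\<forall>x\<in>V. 0 \<le> p x) \<and>
    (\<forall>x\<in>V. \<forall>y\<in>V. p (x + y) \<le> p x + p y) \<and>
    (\<forall>c. \<forall>x\<in>V. p (smul c x) = norm c * p x)"

definition finite_dim_subspace ::
    "('k::real_or_complex \<Rightarrow> 'h::ab_group_add \<Rightarrow> 'h) \<Rightarrow> 'h set \<Rightarrow> bool"
  where "finite_dim_subspace smul V \<longleftrightarrow> (\<exists>B. finite B \<and> V = module.span smul B)"

text \<open>Orthogonal projection onto \<open>V\<close> for the scalar product \<open>ip\<close>.\<close>

definition orth_proj :: "('k::zero, 'h::ab_group_add) form \<Rightarrow> 'h set \<Rightarrow> 'h \<Rightarrow> 'h"
  where "orth_proj ip V x = (THE y. y \<in> V \<and> (\<forall>v\<in>V. ip (x - y) v = 0))"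


section \<open>Unbounded operators\<close>

text \<open>An unbounded operator is a partial map; \<open>dom A\<close> is its domain, \<open>A \<circ>\<^sub>m B\<close> the composition on
  its natural domain, and equality of partial maps includes equality of the domains.\<close>

definition eigenspace ::
    "('k \<Rightarrow> 'h \<Rightarrow> 'h) \<Rightarrow> 'h set \<Rightarrow> ('h \<Rightarrow> 'h) \<Rightarrow> 'k \<Rightarrow> 'h set"
  where "eigenspace smul D T c = {x \<in> D. T x = smul c x}"

text \<open>Spectrum of an operator \<open>T\<close> with domain \<open>D\<close> acting in the space \<open>E\<close>. Over \<open>\<real>\<close> this yields the
  real part of the spectrum of the complexification, which for self-adjoint operators is all
  of it.\<close>

definition spectrum ::
    "('k::real_or_complex \<Rightarrow> 'h::real_normed_vector \<Rightarrow> 'h) \<Rightarrow> 'h set \<Rightarrow> 'h set \<Rightarrow> ('h \<Rightarrow> 'h)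
      \<Rightarrow> complex set"
  where "spectrum smul E D T = {to_complex c | c.
    \<not> (bij_betw (\<lambda>x. T x - smul c x) D E \<and>
        (\<exists>C. \<forall>x\<in>D. norm x \<le> C * norm (T x - smul c x)))}"

definition op_eigenspace :: "('k \<Rightarrow> 'h \<Rightarrow> 'h) \<Rightarrow> ('h \<rightharpoonup> 'h) \<Rightarrow> 'k \<Rightarrow> 'h set"
  where "op_eigenspace smul A = eigenspace smul (dom A) (\<lambda>x. the (A x))"

definition op_spectrum ::
    "('k::real_or_complex \<Rightarrow> 'h::real_normed_vector \<Rightarrow> 'h) \<Rightarrow> ('h \<rightharpoonup> 'h) \<Rightarrow> complex set"
  where "op_spectrum smul A = spectrum smul UNIV (dom A) (\<lambda>x. the (A x))"

definition discrete_spectrum ::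
    "('k::real_or_complex \<Rightarrow> 'h::real_normed_vector \<Rightarrow> 'h) \<Rightarrow> ('h \<rightharpoonup> 'h) \<Rightarrow> complex set"
  where "discrete_spectrum smul A = {to_complex c | c.
    op_eigenspace smul A c \<noteq> {0} \<and>
    finite_dim_subspace smul (op_eigenspace smul A c) \<and>
    to_complex c isolated_in op_spectrum smul A}"

definition linear_operator ::
    "('k::real_or_complex \<Rightarrow> 'h::ab_group_add \<Rightarrow> 'h) \<Rightarrow> ('h \<rightharpoonup> 'h) \<Rightarrow> bool"
  where "linear_operator smul A \<longleftrightarrow>
    module.subspace smul (dom A) \<and>
    (\<forall>x\<in>dom A. \<forall>y\<in>dom A. the (A (x + y)) = the (A x) + the (A y)) \<and>
    (\<forall>c. \<forall>x\<in>dom A. the (A (smul c x)) = smul c (the (A x)))"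

text \<open>The last conjunct is \<open>A\<^sup>* = A\<close>, domains included.\<close>

definition self_adjoint ::
    "('k::real_or_complex \<Rightarrow> 'h::real_normed_vector \<Rightarrow> 'h) \<Rightarrow> ('k, 'h) form \<Rightarrow> ('h \<rightharpoonup> 'h) \<Rightarrow> bool"
  where "self_adjoint smul m A \<longleftrightarrow>
    linear_operator smul A \<and> closure (dom A) = UNIV \<and>
    (\<forall>y z. (\<forall>x\<in>dom A. m (the (A x)) y = m x z) \<longleftrightarrow> A y = Some z)"

definition positive_operator :: "('k::real_or_complex, 'h) form \<Rightarrow> ('h \<rightharpoonup> 'h) \<Rightarrow> bool"
  where "positive_operator m A \<longleftrightarrow> (\<forall>x\<in>dom A. 0 \<le> real_part (m (the (A x)) x))"

text \<open>The unique positive self-adjoint square root of a positive self-adjoint operator.\<close>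

definition op_sqrt ::
    "('k::real_or_complex \<Rightarrow> 'h::real_normed_vector \<Rightarrow> 'h) \<Rightarrow> ('k, 'h) form
      \<Rightarrow> ('h \<rightharpoonup> 'h) \<Rightarrow> ('h \<rightharpoonup> 'h)"
  where "op_sqrt smul m B =
    (THE S. self_adjoint smul m S \<and> positive_operator m S \<and> S \<circ>\<^sub>m S = B)"

text \<open>\<open>|A| = (A\<^sup>* A)\<^sup>1\<^sup>/\<^sup>2\<close>, here only used for \<open>A\<^sup>* = A\<close>.\<close>

definition op_abs ::
    "('k::real_or_complex \<Rightarrow> 'h::real_normed_vector \<Rightarrow> 'h) \<Rightarrow> ('k, 'h) form
      \<Rightarrow> ('h \<rightharpoonup> 'h) \<Rightarrow> ('h \<rightharpoonup> 'h)"
  where "op_abs smul m A = op_sqrt smul m (A \<circ>\<^sub>m A)"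

definition sqrt_abs ::
    "('k::real_or_complex \<Rightarrow> 'h::real_normed_vector \<Rightarrow> 'h) \<Rightarrow> ('k, 'h) form
      \<Rightarrow> ('h \<rightharpoonup> 'h) \<Rightarrow> ('h \<rightharpoonup> 'h)"
  where "sqrt_abs smul m A = op_sqrt smul m (op_abs smul m A)"

definition form_dom ::
    "('k::real_or_complex \<Rightarrow> 'h::real_normed_vector \<Rightarrow> 'h) \<Rightarrow> ('k, 'h) form
      \<Rightarrow> ('h \<rightharpoonup> 'h) \<Rightarrow> 'h set"
  where "form_dom smul m A = dom (sqrt_abs smul m A)"

definition form_ip ::
    "('k::real_or_complex \<Rightarrow> 'h::real_normed_vector \<Rightarrow> 'h) \<Rightarrow> ('k, 'h) form
      \<Rightarrow> ('h \<rightharpoonup> 'h) \<Rightarrow> ('k, 'h) form"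
  where "form_ip smul m A x y =
    m x y + m (the (sqrt_abs smul m A x)) (the (sqrt_abs smul m A y))"

definition form_norm ::
    "('k::real_or_complex \<Rightarrow> 'h::real_normed_vector \<Rightarrow> 'h) \<Rightarrow> ('k, 'h) form
      \<Rightarrow> ('h \<rightharpoonup> 'h) \<Rightarrow> 'h \<Rightarrow> real"
  where "form_norm smul m A x = sqrt (real_part (form_ip smul m A x x))"

text \<open>The form associated with \<open>A\<close> is the continuous extension of \<open>m (A x) y\<close> to the form domain.
  It is unique there since \<open>dom A\<close> is dense in the form domain for \<^const>\<open>form_norm\<close>; its
  values elsewhere are irrelevant.\<close>

definition form_of ::
    "('k::real_or_complex \<Rightarrow> 'h::real_normed_vector \<Rightarrow> 'h) \<Rightarrow> ('k, 'h) form
      \<Rightarrow> ('h \<rightharpoonup> 'h) \<Rightarrow> ('k, 'h) form"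
  where "form_of smul m A = (SOME a.
    hermitian_form_on smul (form_dom smul m A) a \<and>
    (\<exists>C. \<forall>x\<in>form_dom smul m A. \<forall>y\<in>form_dom smul m A.
        norm (a x y) \<le> C * form_norm smul m A x * form_norm smul m A y) \<and>
    (\<forall>x\<in>dom A. \<forall>y\<in>form_dom smul m A. a x y = m (the (A x)) y))"


section \<open>Operators on a finite dimensional subspace\<close>

text \<open>The operator on \<open>V\<close> representing the restriction of the form \<open>b\<close> with respect to \<open>m\<close>.\<close>

definition form_operator :: "('k, 'h) form \<Rightarrow> 'h set \<Rightarrow> ('k, 'h) form \<Rightarrow> 'h \<Rightarrow> 'h"
  where "form_operator m V b x = (THE w. w \<in> V \<and> (\<forall>v\<in>V. m w v = b x v))"

text \<open>Functional calculus \<open>f(T)\<close> of an \<open>m\<close>-symmetric operator \<open>T\<close> on a finite dimensional space \<open>V\<close>: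
  the sum of \<open>f(t)\<close> times the orthogonal projection onto the eigenspace, over the
  eigenvalues \<open>t\<close>.\<close>

definition fun_calc ::
    "('k::real_or_complex \<Rightarrow> 'h::ab_group_add \<Rightarrow> 'h) \<Rightarrow> ('k, 'h) form \<Rightarrow> 'h set
      \<Rightarrow> (real \<Rightarrow> real) \<Rightarrow> ('h \<Rightarrow> 'h) \<Rightarrow> 'h \<Rightarrow> 'h"
  where "fun_calc smul m V f T x =
    (\<Sum>t | eigenspace smul V T (of_real t) \<noteq> {0}.
      smul (of_real (f t)) (orth_proj m (eigenspace smul V T (of_real t)) x))"

text \<open>\<open>M\<^sup>1\<^sup>/\<^sup>2\<close> and \<open>M\<^sup>-\<^sup>1\<^sup>/\<^sup>2\<close> for the operator \<open>M\<close> of the form \<open>mn\<close> on \<open>V\<close>, and the operator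
  \<open>M\<^sup>-\<^sup>1\<^sup>/\<^sup>2 A M\<^sup>-\<^sup>1\<^sup>/\<^sup>2\<close> for the operator \<open>A\<close> of the form \<open>an\<close> on \<open>V\<close>.\<close>

definition mass_sqrt ::
    "('k::real_or_complex \<Rightarrow> 'h::ab_group_add \<Rightarrow> 'h) \<Rightarrow> ('k, 'h) form \<Rightarrow> 'h set
      \<Rightarrow> ('k, 'h) form \<Rightarrow> 'h \<Rightarrow> 'h"
  where "mass_sqrt smul m V mn = fun_calc smul m V sqrt (form_operator m V mn)"

definition mass_inv_sqrt ::
    "('k::real_or_complex \<Rightarrow> 'h::ab_group_add \<Rightarrow> 'h) \<Rightarrow> ('k, 'h) form \<Rightarrow> 'h set
      \<Rightarrow> ('k, 'h) form \<Rightarrow> 'h \<Rightarrow> 'h"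
  where "mass_inv_sqrt smul m V mn =
    fun_calc smul m V (\<lambda>t. 1 / sqrt t) (form_operator m V mn)"

definition approx_operator ::
    "('k::real_or_complex \<Rightarrow> 'h::ab_group_add \<Rightarrow> 'h) \<Rightarrow> ('k, 'h) form \<Rightarrow> 'h set
      \<Rightarrow> ('k, 'h) form \<Rightarrow> ('k, 'h) form \<Rightarrow> 'h \<Rightarrow> 'h"
  where "approx_operator smul m V an mn =
    mass_inv_sqrt smul m V mn \<circ> form_operator m V an \<circ> mass_inv_sqrt smul m V mn"

definition approx_spectrum ::
    "('k::real_or_complex \<Rightarrow> 'h::real_normed_vector \<Rightarrow> 'h) \<Rightarrow> ('k, 'h) form \<Rightarrow> 'h set
      \<Rightarrow> ('k, 'h) form \<Rightarrow> ('k, 'h) form \<Rightarrow> complex set"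
  where "approx_spectrum smul m V an mn =
    spectrum smul V V (approx_operator smul m V an mn)"

text \<open>The (in general not orthogonal) spectral projector for the set \<open>J\<close>, extended to the whole
  space by the orthogonal projection onto \<open>V\<close>.\<close>

definition approx_projector ::
    "('k::real_or_complex \<Rightarrow> 'h::ab_group_add \<Rightarrow> 'h) \<Rightarrow> ('k, 'h) form \<Rightarrow> 'h set
      \<Rightarrow> ('k, 'h) form \<Rightarrow> ('k, 'h) form \<Rightarrow> real set \<Rightarrow> 'h \<Rightarrow> 'h"
  where "approx_projector smul m V an mn J =
    mass_inv_sqrt smul m V mn \<circ>
    fun_calc smul m V (indicator J) (approx_operator smul m V an mn) \<circ>
    mass_sqrt smul m V mn \<circ> orth_proj m V"


section \<open>Approximations of a self-adjoint operator\<close>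

definition limsup_sets :: "(nat \<Rightarrow> complex set) \<Rightarrow> complex set"
  where "limsup_sets E =
    {z. \<exists>r x. strict_mono (r::nat \<Rightarrow> nat) \<and> (\<forall>k. x k \<in> E (r k)) \<and> x \<longlonglongrightarrow> z}"

definition liminf_sets :: "(nat \<Rightarrow> complex set) \<Rightarrow> complex set"
  where "liminf_sets E = {z. \<exists>x. (\<forall>n. x n \<in> E n) \<and> x \<longlonglongrightarrow> z}"

definition approximation ::
    "('k::real_or_complex \<Rightarrow> 'h::real_normed_vector \<Rightarrow> 'h) \<Rightarrow> ('k, 'h) form \<Rightarrow> ('h \<rightharpoonup> 'h)
      \<Rightarrow> (nat \<Rightarrow> 'h set) \<Rightarrow> (nat \<Rightarrow> ('k, 'h) form) \<Rightarrow> (nat \<Rightarrow> ('k, 'h) form) \<Rightarrow> bool"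
  where "approximation smul m A X an mn \<longleftrightarrow> (\<forall>n.
    finite_dim_subspace smul (X n) \<and> X n \<subseteq> form_dom smul m A \<and>
    hermitian_form_on smul (form_dom smul m A) (an n) \<and>
    hermitian_form_on smul (form_dom smul m A) (mn n) \<and>
    (\<forall>x\<in>X n. x \<noteq> 0 \<longrightarrow> 0 < real_part (mn n x x)))"

definition form_proj ::
    "('k::real_or_complex \<Rightarrow> 'h::real_normed_vector \<Rightarrow> 'h) \<Rightarrow> ('k, 'h) form \<Rightarrow> ('h \<rightharpoonup> 'h)
      \<Rightarrow> 'h set \<Rightarrow> 'h \<Rightarrow> 'h"
  where "form_proj smul m A V = orth_proj (form_ip smul m A) V"

definition approximability ::
    "('k::real_or_complex \<Rightarrow> 'h::real_normed_vector \<Rightarrow> 'h) \<Rightarrow> ('k, 'h) form \<Rightarrow> ('h \<rightharpoonup> 'h)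
      \<Rightarrow> (nat \<Rightarrow> 'h set) \<Rightarrow> bool"
  where "approximability smul m A X \<longleftrightarrow>
    (\<forall>x\<in>form_dom smul m A.
      (\<lambda>n. form_norm smul m A (x - form_proj smul m A (X n) x)) \<longlonglongrightarrow> 0)"

definition uniform_bounds ::
    "('k::real_or_complex \<Rightarrow> 'h::real_normed_vector \<Rightarrow> 'h) \<Rightarrow> ('k, 'h) form \<Rightarrow> ('h \<rightharpoonup> 'h)
      \<Rightarrow> (nat \<Rightarrow> 'h set) \<Rightarrow> (nat \<Rightarrow> ('k, 'h) form) \<Rightarrow> (nat \<Rightarrow> ('k, 'h) form)
      \<Rightarrow> real \<Rightarrow> real \<Rightarrow> bool"
  where "uniform_bounds smul m A X an mn \<gamma> \<Gamma> \<longleftrightarrow> (\<forall>n. \<forall>x\<in>X n. \<forall>y\<in>X n.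
    \<gamma> * (norm x)\<^sup>2 \<le> real_part (mn n x x) \<and> real_part (mn n x x) \<le> \<Gamma> * (norm x)\<^sup>2 \<and>
    norm (an n x y) \<le> \<Gamma> * form_norm smul m A x * form_norm smul m A y)"

text \<open>The infimum and the suprema are taken in \<^typ>\<open>ennreal\<close>, so that over an empty set (when
  \<open>X n = {0}\<close>) they are \<open>\<infinity>\<close> and \<open>0\<close>. The lower bound on the distance of \<open>K\<close> to the spectra is
  spelled out pointwise, so that the distance to an empty set counts as infinite.\<close>

definition inf_sup ::
    "('k::real_or_complex \<Rightarrow> 'h::real_normed_vector \<Rightarrow> 'h) \<Rightarrow> ('k, 'h) form \<Rightarrow> ('h \<rightharpoonup> 'h)
      \<Rightarrow> 'h set \<Rightarrow> ('k, 'h) form \<Rightarrow> ('k, 'h) form \<Rightarrow> complex \<Rightarrow> ennreal"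
  where "inf_sup smul m A V an mn \<mu> =
    (INF w\<in>V - {0}. SUP v\<in>V - {0}.
      ennreal (cmod (to_complex (an w v) - \<mu> * to_complex (mn w v)) /
        (form_norm smul m A w * form_norm smul m A v)))"

definition inf_sup_stability ::
    "('k::real_or_complex \<Rightarrow> 'h::real_normed_vector \<Rightarrow> 'h) \<Rightarrow> ('k, 'h) form \<Rightarrow> ('h \<rightharpoonup> 'h)
      \<Rightarrow> (nat \<Rightarrow> 'h set) \<Rightarrow> (nat \<Rightarrow> ('k, 'h) form) \<Rightarrow> (nat \<Rightarrow> ('k, 'h) form) \<Rightarrow> bool"
  where "inf_sup_stability smul m A X an mn \<longleftrightarrow>
    (\<forall>K r. compact K \<longrightarrow> strict_mono (r::nat \<Rightarrow> nat) \<longrightarrow>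
      (\<exists>\<alpha>>0. \<forall>k. \<forall>\<mu>\<in>K. \<forall>z\<in>approx_spectrum smul m (X (r k)) (an (r k)) (mn (r k)). \<alpha> \<le> dist \<mu> z) \<longrightarrow>
      (\<exists>c>0. \<forall>\<mu>\<in>K. \<forall>k.
        ennreal c \<le> inf_sup smul m A (X (r k)) (an (r k)) (mn (r k)) \<mu>))"

text \<open>\<open>an'\<close>, \<open>mn'\<close> are the auxiliary forms, \<open>r1\<close>, \<open>r2\<close> (resp. \<open>s1\<close>, \<open>s2\<close>) the seminorms controlling
  \<open>a - an'\<close>, \<open>m - mn'\<close> (resp. \<open>an - an'\<close>, \<open>mn - mn'\<close>).\<close>

definition consistency ::
    "('k::real_or_complex \<Rightarrow> 'h::real_normed_vector \<Rightarrow> 'h) \<Rightarrow> ('k, 'h) form \<Rightarrow> ('h \<rightharpoonup> 'h)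
      \<Rightarrow> (nat \<Rightarrow> 'h set) \<Rightarrow> (nat \<Rightarrow> ('k, 'h) form) \<Rightarrow> (nat \<Rightarrow> ('k, 'h) form)
      \<Rightarrow> (nat \<Rightarrow> ('k, 'h) form) \<Rightarrow> (nat \<Rightarrow> ('k, 'h) form) \<Rightarrow> real
      \<Rightarrow> (nat \<Rightarrow> 'h \<Rightarrow> real) \<Rightarrow> (nat \<Rightarrow> 'h \<Rightarrow> real) \<Rightarrow> (nat \<Rightarrow> 'h \<Rightarrow> real) \<Rightarrow> (nat \<Rightarrow> 'h \<Rightarrow> real)
      \<Rightarrow> bool"
  where "consistency smul m A X an mn an' mn' \<kappa> r1 r2 s1 s2 \<longleftrightarrow>
    (let Q = form_dom smul m A; N = form_norm smul m A; a = form_of smul m A;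
         Pr = (\<lambda>n. form_proj smul m A (X n)) in
    (\<forall>n. hermitian_form_on smul Q (an' n) \<and> hermitian_form_on smul Q (mn' n) \<and>
      seminorm_on smul Q (r1 n) \<and> seminorm_on smul Q (r2 n) \<and>
      seminorm_on smul Q (s1 n) \<and> seminorm_on smul Q (s2 n)) \<and>
    (\<forall>n. \<forall>x\<in>Q. \<forall>y\<in>Q.
      norm (a x y - an' n x y) \<le> r1 n x * r1 n y \<and>
      norm (m x y - mn' n x y) \<le> r2 n x * r2 n y) \<and>
    (\<forall>n. \<forall>x\<in>Q.
      r1 n x \<le> \<kappa> * N x \<and> r2 n x \<le> \<kappa> * norm x \<and>
      s1 n x \<le> \<kappa> * N x \<and> s2 n x \<le> \<kappa> * norm x \<and>
      (SUP w\<in>X n - {0}. ennreal (norm (an n (Pr n x) w - an' n (Pr n x) w) / N w))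
        \<le> ennreal (s1 n x) \<and>
      (SUP w\<in>X n - {0}. ennreal (norm (mn n (Pr n x) w - mn' n (Pr n x) w) / N w))
        \<le> ennreal (s2 n x)) \<and>
    (\<forall>x\<in>Q. (\<lambda>n. r1 n x) \<longlonglongrightarrow> 0 \<and> (\<lambda>n. r2 n x) \<longlonglongrightarrow> 0 \<and>
      (\<lambda>n. s1 n x) \<longlonglongrightarrow> 0 \<and> (\<lambda>n. s2 n x) \<longlonglongrightarrow> 0))"

text \<open>Operator norm of a bounded operator from the Hilbert space to the form domain of \<open>A\<close>.\<close>

definition form_op_norm ::
    "('k::real_or_complex \<Rightarrow> 'h::real_normed_vector \<Rightarrow> 'h) \<Rightarrow> ('k, 'h) form \<Rightarrow> ('h \<rightharpoonup> 'h)
      \<Rightarrow> ('h \<Rightarrow> 'h) \<Rightarrow> real"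
  where "form_op_norm smul m A T = (SUP x\<in>{x. norm x \<le> 1}. form_norm smul m A (T x))"

definition sphere_sup :: "('h::real_normed_vector \<Rightarrow> 'h) \<Rightarrow> ('h \<Rightarrow> real) \<Rightarrow> real"
  where "sphere_sup P p = (SUP x\<in>{x \<in> range P. norm x = 1}. p x)"

end

theory Submission
  imports Defs
begin

text \<open>The error analysis avoids contour integrals. Let \<open>u\<close> be an eigenvector for \<open>lam\<close> and \<open>w\<close> its
  projection onto \<open>X n\<close>. Consistency bounds the residual \<open>(an - lam mn) w v\<close> by the errors of the
  right-hand side times the form norm of \<open>v\<close>. If the discrete spectra stayed away from \<open>lam\<close> along a
  subsequence, inf-sup stability at \<open>lam\<close> would force \<open>w \<rightarrow> 0\<close>. In the absence of pollution, stability
  holds at the single real point \<open>\<mu> = lam + \<epsilon> / 2\<close>, and this suffices: it makes functions of the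
  discrete operator that decay like \<open>1 / (t - \<mu>)\<close> uniformly bounded into the form domain, so testing
  the residual of \<open>w\<close> with the reduced resolvent at \<open>lam\<close> bounds the part of \<open>w\<close> outside the spectral
  window. The remaining estimates follow by comparing dimensions and expanding the residual once more
  around \<open>u\<close>.

  The form domain is reached by real Hilbert space theory: every self-adjoint \<open>A\<close> is \<open>F D\<^sup>-\<^sup>1\<close> with
  commuting bounded symmetric \<open>F\<close> and \<open>D = (1 + A\<^sup>2)\<^sup>-\<^sup>1\<^sup>/\<^sup>2\<close>, which gives existence and uniqueness of \<open>|A|\<close> and
  \<open>|A|\<^sup>1\<^sup>/\<^sup>2\<close> as quotients of bounded operators.\<close>

section \<open>Bounded square roots in a real Hilbert space\<close>

text \<open>A contour argument would need stability on a circle of complex points, hence a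
  complexification when the scalars are real; one real point serves both scalar fields. It cannot be
  \<open>lam\<close> itself, to which the discrete spectra converge. Any other point of the interval
  in (B1) keeps a positive distance from the discrete spectra for large \<open>n\<close>, and the
  right end of the window is such a point. Stability is indispensable because spectral bounds for
  the discrete operator only control the norm given by \<open>mn\<close>; no uniform lower bound
  ties \<open>an\<close> to the form norm, and the inf-sup inequality at \<mu> is what turns
  \<open>mn\<close> bounds into bounds in \<open>Q(A)\<close>.

  All unbounded operators are first treated as real-linear, the real part of \<open>m\<close> being
  the inner product of the type. Multiplication by a scalar is a bounded operator preserving the
  graph of \<open>A\<close>. Each construction therefore records that it commutes with every bounded
  operator preserving that graph; applied to scalar multiplications, this returns linearity over the
  scalar field.\<close>

lemma quadratic_nonneg_imp_zero:
  fixes b c :: real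
  assumes "\<And>t. 0 \<le> t\<^sup>2 * b + 2 * t * c"
  shows "c = 0"
proof (rule ccontr)
  assume c: "c \<noteq> 0"
  \<comment> \<open>At \<open>t = - c / s\<close> the quadratic is negative as soon as
    \<open>b < 2 * s\<close>; the absolute value also keeps \<open>s\<close> positive when
    \<open>b\<close> is negative.\<close>
  define s where "s = \<bar>b\<bar> + 1"
  have s: "s > 0" "b < s" by (auto simp: s_def)
  have "(- c / s)\<^sup>2 * b + 2 * (- c / s) * c = (c\<^sup>2 / s\<^sup>2) * (b - 2 * s)"
    using s by (simp add: field_simps power2_eq_square)
  moreover have "(c\<^sup>2 / s\<^sup>2) * (b - 2 * s) < 0"
    using s c by (intro mult_pos_neg) auto
  ultimately show False using assms[of "- c / s"] by linarith
qed

text \<open>A minimizing sequence is Cauchy by the parallelogram law, because midpoints stay in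
  \<open>V\<close>; the first variation at the minimizer gives orthogonality. The generality in the
  space matters: it is applied to graphs in the product of the space with itself.\<close>

lemma orthogonal_projection_exists:
  fixes V :: "'h::{real_inner, complete_space} set"
  assumes V: "subspace V" "closed V"
  shows "\<exists>v\<in>V. \<forall>w\<in>V. inner (x - v) w = 0"
proof -
  define q where "q v = (norm (x - v))\<^sup>2" for v
  define d where "d = Inf (q ` V)"
  have V0: "0 \<in> V" by (rule subspace_0[OF V(1)])
  have bdd: "bdd_below (q ` V)" by (rule bdd_belowI[of _ 0]) (auto simp: q_def)
  have dle: "d \<le> q v" if "v \<in> V" for v unfolding d_def using that bdd by (intro cInf_lower) auto
  have "\<exists>v\<in>V. q v < d + 1 / real (Suc n)" for n
  proof -
    have "Inf (q ` V) < d + 1 / real (Suc n)" by (simp add: d_def)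
    then show ?thesis using cInf_lessD[of "q ` V"] V0 by blast
  qed
  then obtain s where sV: "\<And>n. s n \<in> V" and sq: "\<And>n. q (s n) < d + 1 / real (Suc n)" by metis
  have par: "(norm (v - w))\<^sup>2 \<le> 2 * q v + 2 * q w - 4 * d" if "v \<in> V" "w \<in> V" for v w
  proof -
    have m: "(1/2) *\<^sub>R (v + w) \<in> V" using that V(1) by (simp add: subspace_add subspace_scale)
    have "(norm (v - w))\<^sup>2 = 2 * q v + 2 * q w - 4 * q ((1/2) *\<^sub>R (v + w))"
      by (simp add: q_def power2_norm_eq_inner algebra_simps inner_simps inner_commute)
    then show ?thesis using dle[OF m] by simp
  qed
  have "Cauchy s"
  proof (rule metric_CauchyI)
    fix e :: real assume e: "e > 0"
    obtain N where N: "4 / e\<^sup>2 < real N" using reals_Archimedean2 by blast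
    have "dist (s m) (s n) < e" if "N \<le> m" "N \<le> n" for m n
    proof -
      have *: "1 / real (Suc k) < e\<^sup>2 / 4" if "N \<le> k" for k
      proof -
        have "4 / e\<^sup>2 < real (Suc k)" using N that by linarith
        then show ?thesis using e by (simp add: field_simps)
      qed
      have "(norm (s m - s n))\<^sup>2 < e\<^sup>2"
        using par[OF sV sV, of m n] sq[of m] sq[of n] *[OF that(1)] *[OF that(2)] by linarith
      then show ?thesis using e by (simp add: dist_norm power2_less_imp_less)
    qed
    then show "\<exists>N. \<forall>m\<ge>N. \<forall>n\<ge>N. dist (s m) (s n) < e" by blast
  qed
  then obtain v where v: "s \<longlonglongrightarrow> v" using Cauchy_convergent convergent_def by blast
  have vV: "v \<in> V" using V(2) sV v closed_sequentially by blast
  have "(\<lambda>n. q (s n)) \<longlonglongrightarrow> q v" unfolding q_def by (intro tendsto_intros v)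
  moreover have "(\<lambda>n. d + 1 / real (Suc n)) \<longlonglongrightarrow> d"
    using tendsto_add[OF tendsto_const LIMSEQ_Suc[OF lim_1_over_n]] by fastforce
  ultimately have qv: "q v \<le> d"
    using sq by (intro LIMSEQ_le[of "\<lambda>n. q (s n)" "q v" "\<lambda>n. d + 1 / real (Suc n)" d])
      (auto intro: less_imp_le)
  have "inner (x - v) w = 0" if w: "w \<in> V" for w
  proof (rule quadratic_nonneg_imp_zero)
    fix t :: real
    have "v - t *\<^sub>R w \<in> V" using vV w V(1) by (simp add: subspace_diff subspace_scale)
    from dle[OF this] qv have "0 \<le> q (v - t *\<^sub>R w) - q v" by linarith
    also have "\<dots> = t\<^sup>2 * (norm w)\<^sup>2 + 2 * t * inner (x - v) w"
      by (simp add: q_def power2_norm_eq_inner algebra_simps inner_simps inner_commute power2_eq_square[of t])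
    finally show "0 \<le> t\<^sup>2 * (norm w)\<^sup>2 + 2 * t * inner (x - v) w" .
  qed
  then show ?thesis using vV by blast
qed

text \<open>Symmetry refers to the real inner product of the type. Compatibility with the scalar
  multiplication is carried as a separate property, and \<open>bdd_symmetric_m\<close> then recovers
  symmetry for \<open>m\<close>.\<close>

definition bdd_symmetric :: "('h::real_inner \<Rightarrow> 'h) \<Rightarrow> bool"
  where "bdd_symmetric T \<longleftrightarrow> bounded_linear T \<and> (\<forall>x y. inner (T x) y = inner x (T y))"

lemma bdd_symmetricD:
  assumes "bdd_symmetric T"
  shows "bounded_linear T" "inner (T x) y = inner x (T y)"
  using assms by (auto simp: bdd_symmetric_def)

lemma closure_subspace:
  fixes V :: "'a::real_normed_vector set"
  assumes V: "subspace V"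
  shows "subspace (closure V)"
proof (rule subspaceI)
  show "0 \<in> closure V" using subspace_0[OF V] closure_subset by blast
  show "x + y \<in> closure V" if xy: "x \<in> closure V" "y \<in> closure V" for x y
  proof -
    obtain s where "\<And>n. s n \<in> V" "s \<longlonglongrightarrow> x" using xy(1) unfolding closure_sequential by blast
    moreover obtain t where "\<And>n. t n \<in> V" "t \<longlonglongrightarrow> y" using xy(2) unfolding closure_sequential by blast
    ultimately have "(\<lambda>n. s n + t n) \<longlonglongrightarrow> x + y" "\<And>n. s n + t n \<in> V"
      using subspace_add[OF V] by (auto intro: tendsto_add)
    then show ?thesis unfolding closure_sequential by (intro exI[of _ "\<lambda>n. s n + t n"]) simp
  qed
  show "c *\<^sub>R x \<in> closure V" if cx: "x \<in> closure V" for c x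
  proof -
    obtain s where "\<And>n. s n \<in> V" "s \<longlonglongrightarrow> x" using cx unfolding closure_sequential by blast
    then have "(\<lambda>n. c *\<^sub>R s n) \<longlonglongrightarrow> c *\<^sub>R x" "\<And>n. c *\<^sub>R s n \<in> V"
      using subspace_scale[OF V] by (auto intro: tendsto_scaleR)
    then show ?thesis unfolding closure_sequential by (intro exI[of _ "\<lambda>n. c *\<^sub>R s n"]) simp
  qed
qed

text \<open>The orthogonal complement of the range of a symmetric operator is its kernel: for
  \<open>y\<close> orthogonal to the range, testing with \<open>T (T y)\<close> gives
  \<open>T y = 0\<close>.\<close>

lemma bdd_symmetric_injective_dense_range:
  fixes T :: "'h::{real_inner, complete_space} \<Rightarrow> 'h"
  assumes T: "bdd_symmetric T" and inj: "\<And>x. T x = 0 \<Longrightarrow> x = 0"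
  shows "closure (range T) = UNIV"
proof -
  have "subspace (range T)"
    using linear_subspace_image[OF bounded_linear.linear[OF bdd_symmetricD(1)[OF T]] subspace_UNIV] .
  then have V: "subspace (closure (range T))" by (rule closure_subspace)
  have "x \<in> closure (range T)" for x
  proof -
    obtain v where v: "v \<in> closure (range T)" "\<And>w. w \<in> closure (range T) \<Longrightarrow> inner (x - v) w = 0"
      using orthogonal_projection_exists[OF V closed_closure, of x] by blast
    have "inner (x - v) (T (T (x - v))) = 0" using v(2) closure_subset by blast
    then have "T (x - v) = 0" using bdd_symmetricD(2)[OF T, of "x - v" "T (x - v)"] by simp
    then show ?thesis using inj v(1) by fastforce
  qed
  then show ?thesis by blast
qed

text \<open>The square root of \<open>1 - K\<close> is \<open>1 - Y\<close> where \<open>Y = (K + Y\<^sup>2) / 2\<close> is found by iteration; the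
  increments are dominated by those of the scalar iteration for \<open>K = 1\<close>.\<close>

lemma bounded_sqrt:
  fixes K :: "'h::{real_inner, complete_space} \<Rightarrow> 'h"
  assumes K: "bdd_symmetric K" and K1: "\<And>x. norm (K x) \<le> norm x"
  obtains S where "bdd_symmetric S" "\<And>x. 0 \<le> inner (S x) x" "\<And>x. norm (x - S x) \<le> norm x"
    "\<And>x. S (S x) = x - K x"
    "\<And>G x. bounded_linear G \<Longrightarrow> (\<And>y. G (K y) = K (G y)) \<Longrightarrow> G (S x) = S (G x)"
proof -
  note Kbl = bdd_symmetricD(1)[OF K] and Ksym = bdd_symmetricD(2)[OF K]
  define Y where "Y = rec_nat (\<lambda>x. 0) (\<lambda>n Z x. (1/2) *\<^sub>R (K x + Z (Z x)))"
  define y where "y = rec_nat (0::real) (\<lambda>n z. (1 + z\<^sup>2) / 2)"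
  have Y0: "Y 0 x = 0" and YS: "Y (Suc n) x = (1/2) *\<^sub>R (K x + Y n (Y n x))" for n x
    by (simp_all add: Y_def)
  have y0: "y 0 = 0" and yS: "y (Suc n) = (1 + (y n)\<^sup>2) / 2" for n by (simp_all add: y_def)
  have y01: "0 \<le> y n \<and> y n \<le> 1" for n
  proof (induction n)
    case (Suc n)
    then have "(y n)\<^sup>2 \<le> 1" by (simp add: power_le_one)
    then show ?case by (simp add: yS)
  qed (simp add: y0)
  have yinc: "y n \<le> y (Suc n)" for n
  proof -
    have "y (Suc n) - y n = (1 - y n)\<^sup>2 / 2" by (simp add: yS power2_eq_square field_simps)
    then show ?thesis by (smt (verit) zero_le_power2 divide_nonneg_pos)
  qed
  have Ylin: "linear (Y n)" for n
  proof (induction n)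
    case 0 show ?case by (simp add: Y0 linear_iff)
  next
    case (Suc n)
    show ?case
      unfolding linear_iff
      by (simp add: YS linear_add[OF Suc] linear_scale[OF Suc] linear_add[OF bounded_linear.linear[OF Kbl]]
          linear_scale[OF bounded_linear.linear[OF Kbl]] algebra_simps)
  qed
  have Ysym: "inner (Y n x) z = inner x (Y n z)" for n x z
    by (induction n arbitrary: x z) (simp_all add: Y0 YS inner_simps Ksym)
  have Ynorm: "norm (Y n x) \<le> y n * norm x" for n x
  proof (induction n arbitrary: x)
    case (Suc n)
    have "norm (Y n (Y n x)) \<le> y n * (y n * norm x)"
      using Suc[of "Y n x"] mult_left_mono[OF Suc[of x], of "y n"] y01[of n] by linarith
    then have "norm (K x + Y n (Y n x)) \<le> norm x + (y n)\<^sup>2 * norm x"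
      using norm_triangle_ineq[of "K x" "Y n (Y n x)"] K1[of x] by (simp add: power2_eq_square)
    then have "norm (Y (Suc n) x) \<le> (1/2) * (norm x + (y n)\<^sup>2 * norm x)"
      unfolding YS norm_scaleR by simp
    then show ?case unfolding yS by argo
  qed (simp add: Y0 y0)
  have Ydiff: "norm (Y (Suc n) x - Y n x) \<le> (y (Suc n) - y n) * norm x" for n x
  proof (induction n arbitrary: x)
    case 0
    show ?case using K1[of x] by (simp add: Y0 YS y0 yS linear_0[OF Ylin])
  next
    case (Suc n)
    let ?d = "Y (Suc n) x - Y n x"
    \<comment> \<open>The difference of two squares is split as
      \<open>Y' (Y' - Y) + (Y' - Y) Y\<close>, which is valid without commutation. The scalar
      increments satisfy the same identity, so the bound reproduces itself.\<close>
    have "Y (Suc (Suc n)) x - Y (Suc n) x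
        = (1/2) *\<^sub>R (Y (Suc n) ?d + (Y (Suc n) (Y n x) - Y n (Y n x)))"
      unfolding linear_diff[OF Ylin] by (simp only: YS[of "Suc n"] YS[of n x]) (simp add: algebra_simps YS[of n x])
    also have "norm \<dots> \<le> (1/2) * (norm (Y (Suc n) ?d) + norm (Y (Suc n) (Y n x) - Y n (Y n x)))"
      by (simp add: norm_triangle_ineq)
    also have "norm (Y (Suc n) ?d) \<le> y (Suc n) * ((y (Suc n) - y n) * norm x)"
      using Ynorm[of "Suc n" ?d] mult_left_mono[OF Suc[of x], of "y (Suc n)"] y01[of "Suc n"] by linarith
    also have "norm (Y (Suc n) (Y n x) - Y n (Y n x)) \<le> (y (Suc n) - y n) * (y n * norm x)"
      using Suc[of "Y n x"] mult_left_mono[OF Ynorm[of n x], of "y (Suc n) - y n"] yinc[of n] by linarith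
    finally have "norm (Y (Suc (Suc n)) x - Y (Suc n) x)
      \<le> (1/2) * (y (Suc n) * ((y (Suc n) - y n) * norm x) + (y (Suc n) - y n) * (y n * norm x))" by simp
    also have "\<dots> = (y (Suc (Suc n)) - y (Suc n)) * norm x"
      unfolding yS[of "Suc n"] by (subst (5) yS) (simp add: power2_eq_square field_simps)
    finally show ?case .
  qed
  have Ydist: "norm (Y (n + k) x - Y n x) \<le> (y (n + k) - y n) * norm x" for n k x
  proof (induction k)
    case (Suc k)
    have "norm (Y (n + Suc k) x - Y n x) \<le> norm (Y (Suc (n + k)) x - Y (n + k) x) + norm (Y (n + k) x - Y n x)"
      using norm_triangle_ineq[of "Y (Suc (n + k)) x - Y (n + k) x" "Y (n + k) x - Y n x"] by simp
    then show ?case using Suc Ydiff[of "n + k" x] by (simp add: algebra_simps)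
  qed simp
  have "incseq y" using yinc by (rule incseq_SucI)
  then have ycv: "convergent y" using y01
    by (metis incseq_convergent convergent_def)
  have cv: "convergent (\<lambda>n. Y n x)" for x
  proof -
    have "Cauchy (\<lambda>n. Y n x)"
    proof (rule metric_CauchyI)
      fix e :: real assume e: "e > 0"
      then have "e / (norm x + 1) > 0" by (simp add: add_nonneg_pos)
      moreover have "Cauchy y" using ycv by (rule convergent_Cauchy)
      ultimately obtain N where N: "\<And>m n. N \<le> m \<Longrightarrow> N \<le> n \<Longrightarrow> dist (y m) (y n) < e / (norm x + 1)"
        unfolding Cauchy_def by blast
      have *: "dist (Y (n + k) x) (Y n x) < e" if "N \<le> n" for n k
      proof -
        have "(y (n + k) - y n) * norm x \<le> e / (norm x + 1) * norm x"
          using N[of "n + k" n] that by (intro mult_right_mono) (auto simp: dist_real_def)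
        also have "\<dots> < e"
        proof -
          have "norm x + 1 > 0" by (simp add: add_nonneg_pos)
          then show ?thesis using e by (simp add: field_simps)
        qed
        finally show ?thesis using Ydist[of n k x] by (simp add: dist_norm)
      qed
      have "dist (Y m x) (Y n x) < e" if "N \<le> m" "N \<le> n" for m n
      proof (cases "n \<le> m")
        case True then show ?thesis using *[of n "m - n"] that by simp
      next
        case False then show ?thesis using *[of m "n - m"] that by (simp add: dist_commute)
      qed
      then show "\<exists>N. \<forall>m\<ge>N. \<forall>n\<ge>N. dist (Y m x) (Y n x) < e" by blast
    qed
    then show ?thesis by (rule Cauchy_convergent)
  qed
  define L where "L x = lim (\<lambda>n. Y n x)" for x
  have L: "(\<lambda>n. Y n x) \<longlonglongrightarrow> L x" for x using cv unfolding L_def by (simp add: convergent_LIMSEQ_iff)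
  have Llin: "linear L"
  proof (rule linearI)
    show "L (u + v) = L u + L v" for u v
      using LIMSEQ_unique[OF L, of "u + v" "L u + L v"] tendsto_add[OF L L, of u v] by (simp add: linear_add[OF Ylin])
    show "L (r *\<^sub>R u) = r *\<^sub>R L u" for r u
      using LIMSEQ_unique[OF L, of "r *\<^sub>R u" "r *\<^sub>R L u"] tendsto_scaleR[OF tendsto_const L, of r u] by (simp add: linear_scale[OF Ylin])
  qed
  have Ynorm1: "norm (Y n x) \<le> norm x" for n x
    using Ynorm[of n x] y01[of n] mult_right_mono[of "y n" 1 "norm x"] by simp
  have Lnorm: "norm (L x) \<le> norm x" for x
    by (rule LIMSEQ_le_const2[OF tendsto_norm[OF L]]) (simp add: Ynorm1)
  have Lbl: "bounded_linear L"
    using Llin Lnorm by (intro bounded_linear_intro[of L 1]) (auto simp: linear_add linear_scale)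
  have Lsym: "inner (L x) z = inner x (L z)" for x z
    using LIMSEQ_unique[OF tendsto_inner[OF L tendsto_const, of x z]] tendsto_inner[OF tendsto_const L, of x z]
    by (simp add: Ysym)
  have LL: "L x = (1/2) *\<^sub>R (K x + L (L x))" for x
  proof -
    have "(\<lambda>n. Y n (Y n x - L x)) \<longlonglongrightarrow> 0"
    proof (rule Lim_null_comparison)
      show "(\<lambda>n. norm (Y n x - L x)) \<longlonglongrightarrow> 0" using L[of x] by (simp add: LIM_zero tendsto_norm_zero)
    qed (simp add: Ynorm1)
    then have "(\<lambda>n. Y n (Y n x - L x) + Y n (L x)) \<longlonglongrightarrow> 0 + L (L x)" by (intro tendsto_add L)
    then have "(\<lambda>n. Y n (Y n x)) \<longlonglongrightarrow> L (L x)" by (simp add: linear_diff[OF Ylin])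
    then have "(\<lambda>n. Y (Suc n) x) \<longlonglongrightarrow> (1/2) *\<^sub>R (K x + L (L x))" unfolding YS by (intro tendsto_intros)
    then show ?thesis using LIMSEQ_Suc[OF L[of x]] LIMSEQ_unique by blast
  qed
  \<comment> \<open>The iterates are polynomials in \<open>K\<close>, so whatever commutes with
    \<open>K\<close> commutes with each of them and, by continuity, with their limit.\<close>
  have Lcomm: "G (L x) = L (G x)" if G: "bounded_linear G" "\<And>y. G (K y) = K (G y)" for G x
  proof -
    have "G (Y n x) = Y n (G x)" for n x
      by (induction n arbitrary: x) (simp_all add: Y0 YS G linear_0[OF bounded_linear.linear[OF G(1)]]
        linear_add[OF bounded_linear.linear[OF G(1)]] linear_scale[OF bounded_linear.linear[OF G(1)]])
    then have "(\<lambda>n. Y n (G x)) \<longlonglongrightarrow> G (L x)" using bounded_linear.tendsto[OF G(1) L, of x] by simp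
    then show ?thesis using LIMSEQ_unique L by blast
  qed
  show ?thesis
  proof (rule that[of "\<lambda>x. x - L x"])
    show "bdd_symmetric (\<lambda>x. x - L x)"
      unfolding bdd_symmetric_def by (auto intro!: bounded_linear_sub Lbl bounded_linear_ident simp: inner_simps Lsym)
    show "0 \<le> inner (x - L x) x" for x
    proof -
      have "inner (L x) x \<le> norm (L x) * norm x" by (rule norm_cauchy_schwarz)
      also have "\<dots> \<le> norm x * norm x" by (intro mult_right_mono Lnorm) simp
      finally show ?thesis by (simp add: inner_simps power2_norm_eq_inner[symmetric] power2_eq_square)
    qed
    show "norm (x - (x - L x)) \<le> norm x" for x by (simp add: Lnorm)
    show "x - L x - L (x - L x) = x - K x" for x
    proof -
      have "2 *\<^sub>R L x = K x + L (L x)" by (subst LL) simp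
      then show ?thesis by (simp add: linear_diff[OF Llin] scaleR_2 algebra_simps)
    qed
    show "G (x - L x) = G x - L (G x)" if "bounded_linear G" "\<And>y. G (K y) = K (G y)" for G x
      using Lcomm[OF that] by (simp add: linear_diff[OF bounded_linear.linear[OF that(1)]])
  qed
qed

section \<open>Resolvents of unbounded self-adjoint operators\<close>

lemma bounded_linear_eq_on_dense_range:
  assumes "closure (range D) = UNIV" "bounded_linear f" "bounded_linear g" "\<And>t. f (D t) = g (D t)"
  shows "f x = g x"
proof -
  have "closed {x. f x = g x}"
    by (intro closed_Collect_eq linear_continuous_on assms)
  then have "closure (range D) \<subseteq> {x. f x = g x}" using assms(4) by (intro closure_minimal) auto
  then show ?thesis using assms(1) by auto
qed

text \<open>With \<open>y = F x - G x\<close>, commutation and equality of the squares give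
  \<open>(F + G) y = 0\<close>. Both quadratic forms are nonnegative, so both vanish at
  \<open>y\<close>; then \<open>F y = G y = 0\<close>, and symmetry leaves
  \<open>inner y y = 0\<close>.\<close>

lemma commuting_positive_roots_unique:
  fixes F G :: "'h::real_inner \<Rightarrow> 'h"
  assumes F: "bdd_symmetric F" "\<And>x. 0 \<le> inner (F x) x" and G: "bdd_symmetric G" "\<And>x. 0 \<le> inner (G x) x"
    and comm: "\<And>x. F (G x) = G (F x)" and sq: "\<And>x. F (F x) = G (G x)"
  shows "F x = G x"
proof -
  \<comment> \<open>A zero of a nonnegative quadratic form is a minimum, so its first variation
    vanishes; the direction \<open>H y\<close> turns this into \<open>H y = 0\<close>.\<close>
  have null: "H y = 0" if H: "bdd_symmetric H" "\<And>x. 0 \<le> inner (H x) x" and y: "inner (H y) y = 0" for H :: "'h \<Rightarrow> 'h" and y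
  proof -
    note lin = bounded_linear.linear[OF bdd_symmetricD(1)[OF H(1)]]
    have "inner (H y) (H y) = 0"
    proof (rule quadratic_nonneg_imp_zero)
      fix t :: real
      have "0 \<le> inner (H (y + t *\<^sub>R H y)) (y + t *\<^sub>R H y)" by (rule H(2))
      also have "\<dots> = t\<^sup>2 * inner (H (H y)) (H y) + 2 * t * inner (H y) (H y)"
        using bdd_symmetricD(2)[OF H(1), of "H y" y]
        by (simp add: linear_add[OF lin] linear_scale[OF lin] inner_add_left inner_add_right y power2_eq_square algebra_simps)
      finally show "0 \<le> t\<^sup>2 * inner (H (H y)) (H y) + 2 * t * inner (H y) (H y)" .
    qed
    then show ?thesis by simp
  qed
  note linF = bounded_linear.linear[OF bdd_symmetricD(1)[OF F(1)]]
    and linG = bounded_linear.linear[OF bdd_symmetricD(1)[OF G(1)]]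
  define y where "y = F x - G x"
  have "F y + G y = 0" by (simp add: y_def linear_diff[OF linF] linear_diff[OF linG] comm sq)
  then have "inner (F y) y + inner (G y) y = 0" by (metis inner_add_left inner_zero_left)
  then have "F y = 0" "G y = 0" using null[OF F] null[OF G] F(2)[of y] G(2)[of y] by smt+
  then have "inner y y = 0"
    using bdd_symmetricD(2)[OF F(1), of y x] bdd_symmetricD(2)[OF G(1), of y x]
    by (subst (2) y_def) (simp add: inner_diff_right)
  then show ?thesis by (simp add: y_def)
qed

section \<open>Self-adjoint operators described by their graphs\<close>

definition real_self_adjoint :: "('h::real_inner \<rightharpoonup> 'h) \<Rightarrow> bool"
  where "real_self_adjoint A \<longleftrightarrow> closure (dom A) = UNIV \<and>
    (\<forall>y z. (\<forall>x w. A x = Some w \<longrightarrow> inner w y = inner x z) \<longleftrightarrow> A y = Some z)"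

definition nonneg_op :: "('h::real_inner \<rightharpoonup> 'h) \<Rightarrow> bool"
  where "nonneg_op A \<longleftrightarrow> (\<forall>x w. A x = Some w \<longrightarrow> 0 \<le> inner w x)"

text \<open>\<open>R = (1 + B)\<^sup>-\<^sup>1\<close>.\<close>

definition resolvent :: "('h::real_inner \<rightharpoonup> 'h) \<Rightarrow> ('h \<Rightarrow> 'h) \<Rightarrow> bool"
  where "resolvent B R \<longleftrightarrow> bdd_symmetric R \<and> (\<forall>x. norm (R x) \<le> norm x \<and> norm (x - R x) \<le> norm x) \<and>
    (\<forall>y z. B y = Some z \<longleftrightarrow> y = R (y + z))"

lemma resolventD:
  assumes "resolvent B R"
  shows "bdd_symmetric R" "norm (R x) \<le> norm x" "norm (x - R x) \<le> norm x" "B y = Some z \<longleftrightarrow> y = R (y + z)"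
    "B (R x) = Some (x - R x)"
  using assms by (auto simp: resolvent_def)

lemma resolvent_injective:
  assumes R: "resolvent B R" and "R x = 0" shows "x = 0"
proof -
  have "B 0 = Some x" using resolventD(4)[OF R, of 0 x] assms(2) by simp
  moreover have "B 0 = Some 0"
    using resolventD(4)[OF R, of 0 0] linear_0[OF bounded_linear.linear[OF bdd_symmetricD(1)[OF resolventD(1)[OF R]]]] by simp
  ultimately show ?thesis by simp
qed

lemma rsa_sym: "real_self_adjoint A \<Longrightarrow> A x = Some w \<Longrightarrow> A y = Some z \<Longrightarrow> inner w y = inner x z"
  unfolding real_self_adjoint_def by blast

lemma rsa_intro: "real_self_adjoint A \<Longrightarrow> (\<And>x w. A x = Some w \<Longrightarrow> inner w y = inner x z) \<Longrightarrow> A y = Some z"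
  unfolding real_self_adjoint_def by blast

lemma rsa_add: "real_self_adjoint A \<Longrightarrow> A x = Some w \<Longrightarrow> A y = Some z \<Longrightarrow> A (x + y) = Some (w + z)"
  by (rule rsa_intro) (auto simp: inner_add_right rsa_sym)

lemma rsa_scaleR: "real_self_adjoint A \<Longrightarrow> A x = Some w \<Longrightarrow> A (c *\<^sub>R x) = Some (c *\<^sub>R w)"
  by (rule rsa_intro) (auto simp: rsa_sym)

lemma rsa_zero: "real_self_adjoint A \<Longrightarrow> A 0 = Some 0"
  by (rule rsa_intro) auto

lemma rsa_diff: "real_self_adjoint A \<Longrightarrow> A x = Some w \<Longrightarrow> A y = Some z \<Longrightarrow> A (x - y) = Some (w - z)"
  using rsa_add[of A x w "- y" "- z"] rsa_scaleR[of A y z "-1"] by simp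

lemma rsa_closed:
  assumes A: "real_self_adjoint A" and s: "\<And>n. A (s n) = Some (t n)" "s \<longlonglongrightarrow> x" "t \<longlonglongrightarrow> z"
  shows "A x = Some z"
proof (rule rsa_intro[OF A])
  fix u w assume "A u = Some w"
  then have eq: "\<And>n. inner w (s n) = inner u (t n)" using rsa_sym[OF A] s(1) by blast
  have "(\<lambda>n. inner w (s n)) \<longlonglongrightarrow> inner w x" by (intro tendsto_intros s)
  moreover have "(\<lambda>n. inner w (s n)) \<longlonglongrightarrow> inner u z" unfolding eq by (intro tendsto_intros s)
  ultimately show "inner w x = inner u z" by (rule LIMSEQ_unique)
qed

text \<open>Nonnegativity gives \<open>|y|^2 + |B y|^2 <= |(1 + B) y|^2\<close>, so
  \<open>1 + B\<close> is injective and both its inverse and the complement of the inverse are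
  contractions. \<open>B\<close> is only assumed symmetric, so the lemma covers \<open>A^2\<close>
  as well as nonnegative self-adjoint operators; the two applications differ in how they establish
  surjectivity.\<close>

lemma resolvent_exists:
  fixes B :: "'h::real_inner \<rightharpoonup> 'h"
  assumes add: "\<And>x w y z. B x = Some w \<Longrightarrow> B y = Some z \<Longrightarrow> B (x + y) = Some (w + z)"
    and scale: "\<And>c x w. B x = Some w \<Longrightarrow> B (c *\<^sub>R x) = Some (c *\<^sub>R w)"
    and sym: "\<And>x w y z. B x = Some w \<Longrightarrow> B y = Some z \<Longrightarrow> inner w y = inner x z"
    and pos: "nonneg_op B"
    and surj: "\<And>h. \<exists>x. B x = Some (h - x)"
  shows "\<exists>R. resolvent B R"
proof -
  obtain R where R: "\<And>h. B (R h) = Some (h - R h)" using surj by metis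
  have est: "(norm y)\<^sup>2 + (norm z)\<^sup>2 \<le> (norm (y + z))\<^sup>2" if "B y = Some z" for y z
  proof -
    have "0 \<le> inner z y" using pos that by (auto simp: nonneg_op_def)
    then show ?thesis by (simp add: power2_norm_eq_inner inner_simps inner_commute)
  qed
  have uniq: "y = R (y + z)" if "B y = Some z" for y z
  proof -
    let ?h = "y + z"
    have "B (y + (-1) *\<^sub>R R ?h) = Some (z + (-1) *\<^sub>R (?h - R ?h))" by (intro add scale that R)
    then have "(norm (y - R ?h))\<^sup>2 + (norm (- (y - R ?h)))\<^sup>2 \<le> (norm ((y - R ?h) + - (y - R ?h)))\<^sup>2"
      by (intro est) (simp add: algebra_simps)
    then have "(norm (y - R ?h))\<^sup>2 = 0" by (simp add: sum_power2_le_zero_iff)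
    then show ?thesis by simp
  qed
  have "R (u + v) = R u + R v" for u v
    using uniq[OF add[OF R R, of u v]] by (simp add: algebra_simps)
  moreover have "R (c *\<^sub>R u) = c *\<^sub>R R u" for c u
    using uniq[OF scale[OF R, of c u]] by (simp add: algebra_simps)
  moreover have norms: "norm (R h) \<le> norm h \<and> norm (h - R h) \<le> norm h" for h
  proof -
    have "(norm (R h))\<^sup>2 + (norm (h - R h))\<^sup>2 \<le> (norm h)\<^sup>2" using est[OF R[of h]] by simp
    then have "(norm (R h))\<^sup>2 \<le> (norm h)\<^sup>2" "(norm (h - R h))\<^sup>2 \<le> (norm h)\<^sup>2"
      using zero_le_power2[of "norm (R h)"] zero_le_power2[of "norm (h - R h)"] by linarith+
    then show ?thesis by (meson norm_ge_zero power2_le_imp_le)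
  qed
  ultimately have "bounded_linear R" by (intro bounded_linear_intro[of R 1]) auto
  moreover have "inner (R u) v = inner u (R v)" for u v
    using sym[OF R R, of u v] by (simp add: inner_diff_left inner_diff_right)
  moreover have "B y = Some z \<longleftrightarrow> y = R (y + z)" for y z
    using uniq[of y z] R[of "y + z"] by auto
  ultimately show ?thesis using norms unfolding resolvent_def bdd_symmetric_def by blast
qed

lemma map_comp_Some: "(f \<circ>\<^sub>m g) x = Some z \<longleftrightarrow> (\<exists>y. g x = Some y \<and> f y = Some z)"
  by (auto simp: map_comp_def split: option.splits)

text \<open>Projecting \<open>(h, 0)\<close> onto the graph of \<open>A\<close> solves \<open>x + A\<^sup>2 x = h\<close>.\<close>

lemma resolvent_square_exists:
  fixes A :: "'h::{real_inner, complete_space} \<rightharpoonup> 'h"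
  assumes A: "real_self_adjoint A"
  shows "\<exists>R. resolvent (A \<circ>\<^sub>m A) R"
proof (rule resolvent_exists)
  show "(A \<circ>\<^sub>m A) (x + y) = Some (w + z)" if "(A \<circ>\<^sub>m A) x = Some w" "(A \<circ>\<^sub>m A) y = Some z" for x w y z
    using that rsa_add[OF A] unfolding map_comp_Some by blast
  show "(A \<circ>\<^sub>m A) (c *\<^sub>R x) = Some (c *\<^sub>R w)" if "(A \<circ>\<^sub>m A) x = Some w" for c x w
    using that rsa_scaleR[OF A] unfolding map_comp_Some by blast
  show "inner w y = inner x z" if "(A \<circ>\<^sub>m A) x = Some w" "(A \<circ>\<^sub>m A) y = Some z" for x w y z
    using that rsa_sym[OF A] unfolding map_comp_Some by metis
  show "nonneg_op (A \<circ>\<^sub>m A)"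
    unfolding nonneg_op_def map_comp_Some using rsa_sym[OF A] by (metis inner_ge_zero)
  show "\<exists>x. (A \<circ>\<^sub>m A) x = Some (h - x)" for h
  proof -
    define G where "G = {p. A (fst p) = Some (snd p)}"
    have "subspace G"
      unfolding subspace_def G_def using rsa_zero[OF A] rsa_add[OF A] rsa_scaleR[OF A] by simp
    moreover have "closed G"
      unfolding closed_sequential_limits
    proof (intro allI impI, elim conjE)
      fix p l assume p: "\<forall>n. p n \<in> G" and l: "p \<longlonglongrightarrow> l"
      have "A (fst l) = Some (snd l)"
        by (rule rsa_closed[OF A, of "\<lambda>n. fst (p n)" "\<lambda>n. snd (p n)"])
          (use p tendsto_fst[OF l] tendsto_snd[OF l] in \<open>auto simp: G_def\<close>)
      then show "l \<in> G" by (simp add: G_def)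
    qed
    ultimately obtain p where p: "p \<in> G" "\<And>r. r \<in> G \<Longrightarrow> inner ((h, 0) - p) r = 0"
      using orthogonal_projection_exists[of G "(h, 0)"] by blast
    have "A (snd p) = Some (h - fst p)"
    proof (rule rsa_intro[OF A])
      fix x w assume "A x = Some w"
      then have "inner ((h, 0) - p) (x, w) = 0" by (intro p) (simp add: G_def)
      then show "inner w (snd p) = inner x (h - fst p)"
        by (cases p) (simp add: inner_simps inner_commute)
    qed
    then show ?thesis using p(1) unfolding map_comp_Some G_def by blast
  qed
qed

text \<open>Meant for \<open>|A|\<close>, for which no factorization as a square is known yet. The
  range of \<open>1 + B\<close> is closed since monotonicity makes its inverse a contraction, and a
  vector \<open>y\<close> orthogonal to it satisfies \<open>B y = - y\<close>, which nonnegativity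
  excludes unless \<open>y = 0\<close>.\<close>

lemma resolvent_nonneg_exists:
  fixes B :: "'h::{real_inner, complete_space} \<rightharpoonup> 'h"
  assumes B: "real_self_adjoint B" and pos: "nonneg_op B"
  shows "\<exists>R. resolvent B R"
proof (rule resolvent_exists[OF rsa_add[OF B] rsa_scaleR[OF B] rsa_sym[OF B] pos])
  show "\<exists>x. B x = Some (h - x)" for h
  proof -
    define V where "V = {x + w | x w. B x = Some w}"
    have "subspace V"
    proof (rule subspaceI)
      show "0 \<in> V" using rsa_zero[OF B] by (force simp: V_def)
      show "u + v \<in> V" if uv: "u \<in> V" "v \<in> V" for u v
      proof -
        obtain x w y z where "u = x + w" "B x = Some w" "v = y + z" "B y = Some z" using uv unfolding V_def by blast
        then have "u + v = (x + y) + (w + z)" "B (x + y) = Some (w + z)" using rsa_add[OF B] by auto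
        then show ?thesis unfolding V_def by blast
      qed
      show "c *\<^sub>R u \<in> V" if u: "u \<in> V" for c u
      proof -
        obtain x w where "u = x + w" "B x = Some w" using u unfolding V_def by blast
        then have "c *\<^sub>R u = c *\<^sub>R x + c *\<^sub>R w" "B (c *\<^sub>R x) = Some (c *\<^sub>R w)"
          using rsa_scaleR[OF B] by (auto simp: scaleR_add_right)
        then show ?thesis unfolding V_def by blast
      qed
    qed
    moreover have "closed V"
      unfolding closed_sequential_limits
    proof (intro allI impI, elim conjE)
      fix s v assume s: "\<forall>n. s n \<in> V" "s \<longlonglongrightarrow> v"
      then obtain x w where xw: "\<And>n. s n = x n + w n" "\<And>n. B (x n) = Some (w n)" unfolding V_def by simp metis
      have "norm (x m - x n) \<le> norm (s m - s n)" for m n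
      proof -
        have "0 \<le> inner (w m - w n) (x m - x n)"
          using pos rsa_diff[OF B xw(2) xw(2)] unfolding nonneg_op_def by blast
        moreover have "(norm (s m - s n))\<^sup>2 = (norm ((x m - x n) + (w m - w n)))\<^sup>2"
          by (simp add: xw(1) algebra_simps)
        moreover have "\<dots> = (norm (x m - x n))\<^sup>2 + 2 * inner (w m - w n) (x m - x n) + (norm (w m - w n))\<^sup>2"
          unfolding power2_norm_eq_inner inner_add_left inner_add_right by (simp add: inner_commute)
        ultimately have "(norm (x m - x n))\<^sup>2 \<le> (norm (s m - s n))\<^sup>2"
          using zero_le_power2[of "norm (w m - w n)"] by linarith
        then show ?thesis by (meson norm_ge_zero power2_le_imp_le)
      qed
      moreover have "Cauchy s" using s(2) by (rule LIMSEQ_imp_Cauchy)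
      ultimately have "Cauchy x" unfolding Cauchy_def dist_norm by (meson le_less_trans)
      then obtain y where y: "x \<longlonglongrightarrow> y" using Cauchy_convergent convergent_def by blast
      have "(\<lambda>n. s n - x n) \<longlonglongrightarrow> v - y" by (intro tendsto_diff s y)
      then have "w \<longlonglongrightarrow> v - y" by (simp add: xw(1))
      then have "B y = Some (v - y)" using rsa_closed[OF B xw(2) y] by blast
      then show "v \<in> V" unfolding V_def by force
    qed
    ultimately obtain v where v: "v \<in> V" "\<And>u. u \<in> V \<Longrightarrow> inner (h - v) u = 0"
      using orthogonal_projection_exists[of V h] by blast
    have "B (h - v) = Some (- (h - v))"
    proof (rule rsa_intro[OF B])
      fix x w assume "B x = Some w"
      then have "inner (h - v) (x + w) = 0" by (intro v) (auto simp: V_def)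
      then show "inner w (h - v) = inner x (- (h - v))"
        by (simp add: inner_simps inner_commute)
    qed
    then have "0 \<le> inner (- (h - v)) (h - v)" using pos unfolding nonneg_op_def by blast
    then have "inner (h - v) (h - v) \<le> 0" unfolding inner_minus_left by linarith
    then have "inner (h - v) (h - v) = 0" using inner_ge_zero[of "h - v"] by linarith
    then have "h = v" unfolding inner_eq_zero_iff by simp
    then obtain x w where "B x = Some w" "h = x + w" using v(1) by (auto simp: V_def)
    then show ?thesis by (intro exI[of _ x]) simp
  qed
qed

section \<open>Square roots of unbounded operators\<close>

text \<open>With \<open>R = (1 + B)^-1\<close>, \<open>C\<close> stands for
  \<open>(B / (1 + B))^(1/2)\<close> and \<open>D\<close> for \<open>(1 + B)^(-1/2)\<close>, so that
  \<open>B^(1/2)\<close> is the quotient \<open>C D^-1\<close>. The root \<open>E\<close> of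
  \<open>D\<close> serves positivity arguments: it rewrites \<open>inner (C t) (D t)\<close> as a
  value of the quadratic form of \<open>C\<close>. The third property of each root is commutation
  with everything that commutes with \<open>R\<close>.\<close>

locale resolvent_roots =
  fixes B :: "'h::{real_inner, complete_space} \<rightharpoonup> 'h" and R C D E :: "'h \<Rightarrow> 'h"
  assumes R: "resolvent B R"
    and C: "bdd_symmetric C" "\<And>x. 0 \<le> inner (C x) x" "\<And>x. C (C x) = x - R x"
      "\<And>G x. bounded_linear G \<Longrightarrow> (\<And>y. G (R y) = R (G y)) \<Longrightarrow> G (C x) = C (G x)"
    and D: "bdd_symmetric D" "\<And>x. D (D x) = R x"
      "\<And>G x. bounded_linear G \<Longrightarrow> (\<And>y. G (R y) = R (G y)) \<Longrightarrow> G (D x) = D (G x)"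
    and E: "bdd_symmetric E" "\<And>x. E (E x) = D x"
      "\<And>G x. bounded_linear G \<Longrightarrow> (\<And>y. G (R y) = R (G y)) \<Longrightarrow> G (E x) = E (G x)"

text \<open>\<open>bounded_sqrt\<close> takes roots of \<open>1 - K\<close> for a contraction
  \<open>K\<close>. The root of \<open>R\<close> uses \<open>K = 1 - R\<close>, and the root of
  \<open>D\<close> uses \<open>K = 1 - D\<close>; the bound on \<open>x - S x\<close> in the
  conclusion of \<open>bounded_sqrt\<close> is what permits this second round.\<close>

lemma resolvent_roots_exist:
  fixes B :: "'h::{real_inner, complete_space} \<rightharpoonup> 'h"
  assumes R: "resolvent B R"
  shows "\<exists>C D E. resolvent_roots B R C D E"
proof -
  note Rsym = resolventD(1)[OF R] and Rbl = bdd_symmetricD(1)[OF resolventD(1)[OF R]]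
  have co: "bdd_symmetric (\<lambda>x. x - T x)" if "bdd_symmetric T" for T :: "'h \<Rightarrow> 'h"
    using that unfolding bdd_symmetric_def
    by (auto intro!: bounded_linear_sub bounded_linear_ident simp: inner_diff_left inner_diff_right)
  obtain C where C: "bdd_symmetric C" "\<And>x. 0 \<le> inner (C x) x" "\<And>x. C (C x) = x - R x"
      "\<And>G x. bounded_linear G \<Longrightarrow> (\<And>y. G (R y) = R (G y)) \<Longrightarrow> G (C x) = C (G x)"
    using bounded_sqrt[OF Rsym resolventD(2)[OF R]] by metis
  obtain D where D: "bdd_symmetric D" "\<And>x. norm (x - D x) \<le> norm x" "\<And>x. D (D x) = x - (x - R x)"
      "\<And>G x. bounded_linear G \<Longrightarrow> (\<And>y. G (y - R y) = G y - R (G y)) \<Longrightarrow> G (D x) = D (G x)"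
    using bounded_sqrt[OF co[OF Rsym] resolventD(3)[OF R]] by metis
  obtain E where E: "bdd_symmetric E" "\<And>x. E (E x) = x - (x - D x)"
      "\<And>G x. bounded_linear G \<Longrightarrow> (\<And>y. G (y - D y) = G y - D (G y)) \<Longrightarrow> G (E x) = E (G x)"
    using bounded_sqrt[OF co[OF D(1)] D(2)] by metis
  have Dc: "G (D x) = D (G x)" if "bounded_linear G" "\<And>y. G (R y) = R (G y)" for G x
    by (rule D(4)) (use that in \<open>simp_all add: linear_diff[OF bounded_linear.linear[OF that(1)]]\<close>)
  have Ec: "G (E x) = E (G x)" if "bounded_linear G" "\<And>y. G (R y) = R (G y)" for G x
    by (rule E(3)) (use that in \<open>simp_all add: linear_diff[OF bounded_linear.linear[OF that(1)]] Dc\<close>)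
  have "resolvent_roots B R C D E"
    by standard (use R C D(1,3) Dc E(1,2) Ec in auto)
  then show ?thesis by blast
qed

context resolvent_roots
begin

lemma bounded: "bounded_linear R" "bounded_linear C" "bounded_linear D" "bounded_linear E"
  using resolventD(1)[OF R] C(1) D(1) E(1) by (auto dest: bdd_symmetricD)

lemma symm: "inner (R x) y = inner x (R y)" "inner (C x) y = inner x (C y)"
   "inner (D x) y = inner x (D y)" "inner (E x) y = inner x (E y)"
  using resolventD(1)[OF R] C(1) D(1) E(1) by (auto dest: bdd_symmetricD)

lemma D_R: "D (R x) = R (D x)" by (simp add: D(2)[symmetric])

lemma E_R: "E (R x) = R (E x)" by (simp add: D(2)[symmetric] E(2)[symmetric])

lemma C_D: "C (D x) = D (C x)" by (rule C(4)[OF bounded(3) D_R, symmetric])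

lemma C_E: "C (E x) = E (C x)" by (rule C(4)[OF bounded(4) E_R, symmetric])

lemma sum_squares: "C (C x) + D (D x) = x"
  by (simp add: C(3) D(2))

lemma D_injective: "D x = 0 \<Longrightarrow> x = 0"
  using resolvent_injective[OF R, of x] D(2)[of x] linear_0[OF bounded_linear.linear[OF bounded(3)]] by simp

lemma E_injective: "E x = 0 \<Longrightarrow> x = 0"
  using D_injective[of x] E(2)[of x] linear_0[OF bounded_linear.linear[OF bounded(4)]] by simp

lemma dense: "closure (range D) = UNIV" "closure (range E) = UNIV" "closure (range R) = UNIV"
  using bdd_symmetric_injective_dense_range[OF D(1) D_injective]
    bdd_symmetric_injective_dense_range[OF E(1) E_injective]
    bdd_symmetric_injective_dense_range[OF resolventD(1)[OF R] resolvent_injective[OF R]] by auto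

definition root_op :: "'h \<rightharpoonup> 'h"
  where "root_op y = (if y \<in> range D then Some (C (inv D y)) else None)"

lemma inj_D: "inj D"
  using linear_injective_0[OF bounded_linear.linear[OF bounded(3)]] D_injective by blast

lemma root_op_Some: "root_op y = Some z \<longleftrightarrow> (\<exists>t. y = D t \<and> z = C t)"
  using inj_D by (auto simp: root_op_def)

end

text \<open>Because \<open>F^2 + D^2 = 1\<close>, the map \<open>t -> (D t, F t)\<close> is an
  isometry onto the graph. A pair \<open>(y, z)\<close> satisfying the adjoint condition has
  \<open>F y = D z\<close>, and its parameter is read off as \<open>t = F z + D y\<close>.\<close>

lemma real_self_adjoint_quotient:
  fixes F D :: "'h::{real_inner, complete_space} \<Rightarrow> 'h"
  assumes F: "bdd_symmetric F" and D: "bdd_symmetric D" and comm: "\<And>x. F (D x) = D (F x)"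
    and sum: "\<And>x. F (F x) + D (D x) = x" and inj: "\<And>x. D x = 0 \<Longrightarrow> x = 0"
    and S: "\<And>y z. S y = Some z \<longleftrightarrow> (\<exists>t. y = D t \<and> z = F t)"
  shows "real_self_adjoint S"
  unfolding real_self_adjoint_def
proof (intro conjI allI)
  have "dom S = range D" using S by auto
  then show "closure (dom S) = UNIV" using bdd_symmetric_injective_dense_range[OF D inj] by simp
next
  fix y z show "(\<forall>x w. S x = Some w \<longrightarrow> inner w y = inner x z) \<longleftrightarrow> S y = Some z"
  proof
  assume "S y = Some z"
  then show "\<forall>x w. S x = Some w \<longrightarrow> inner w y = inner x z"
    unfolding S using bdd_symmetricD(2)[OF F] bdd_symmetricD(2)[OF D] comm by metis
next
  assume *: "\<forall>x w. S x = Some w \<longrightarrow> inner w y = inner x z"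
  note lin = bounded_linear.linear[OF bdd_symmetricD(1)[OF F]] bounded_linear.linear[OF bdd_symmetricD(1)[OF D]]
  have "inner t (F y - D z) = 0" for t
  proof -
    have "S (D t) = Some (F t)" unfolding S by blast
    then have "inner (F t) y = inner (D t) z" using * by blast
    then show ?thesis by (simp add: inner_diff_right bdd_symmetricD(2)[OF F] bdd_symmetricD(2)[OF D])
  qed
  then have eq: "F y = D z" by (metis inner_eq_zero_iff eq_iff_diff_eq_0)
  have "y = D (F z + D y)" using sum[of y] by (simp add: eq comm linear_add[OF lin(2)])
  moreover have "z = F (F z + D y)" using sum[of z] by (simp add: comm eq linear_add[OF lin(1)])
  ultimately show "S y = Some z" unfolding S by blast
  qed
qed

context resolvent_roots
begin

lemma root_op_self_adjoint: "real_self_adjoint root_op"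
  by (rule real_self_adjoint_quotient[OF C(1) D(1) C_D sum_squares D_injective root_op_Some])

text \<open>Half of \<open>D\<close> is moved across the inner product: the value at
  \<open>D t\<close> is the quadratic form of \<open>C\<close> at \<open>E t\<close>.\<close>

lemma root_op_nonneg: "nonneg_op root_op"
proof -
  have "inner (C t) (D t) = inner (C (E t)) (E t)" for t
    by (simp add: E(2)[symmetric] symm(4)[symmetric] C_E)
  then show ?thesis unfolding nonneg_op_def root_op_Some using C(2) by auto
qed

lemma root_op_square: "root_op \<circ>\<^sub>m root_op = B"
proof -
  note lin = bounded_linear.linear[OF bounded(2)] bounded_linear.linear[OF bounded(3)]
  have "(root_op \<circ>\<^sub>m root_op) y = Some z \<longleftrightarrow> B y = Some z" for y z
  proof
    assume "(root_op \<circ>\<^sub>m root_op) y = Some z"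
    then obtain s t where st: "y = D s" "C s = D t" "z = C t" unfolding map_comp_Some root_op_Some by blast
    have "s = D (C t + D s)" using sum_squares[of s] by (simp add: st(2) C_D linear_add[OF lin(2)])
    then have "y = D (D (C t + D s))" by (simp add: st(1))
    then have "y = R (y + z)" by (simp add: D(2) st add.commute)
    then show "B y = Some z" by (simp add: resolventD(4)[OF R])
  next
    assume "B y = Some z"
    then have y: "y = R (y + z)" by (simp add: resolventD(4)[OF R])
    let ?h = "y + z"
    have "y = D (D ?h)" using y by (simp add: D(2))
    moreover have "C (D ?h) = D (C ?h)" by (rule C_D)
    moreover have "z = C (C ?h)" using y C(3)[of ?h] by simp
    ultimately show "(root_op \<circ>\<^sub>m root_op) y = Some z" unfolding map_comp_Some root_op_Some by blast
  qed
  then show ?thesis by (intro ext) (metis option.exhaust)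
qed

lemma commute_R:
  assumes "bounded_linear G" "\<And>y z. B y = Some z \<Longrightarrow> B (G y) = Some (G z)"
  shows "G (R h) = R (G h)"
proof -
  note lin = bounded_linear.linear[OF assms(1)]
  have "B (G (R h)) = Some (G (h - R h))" using assms(2) resolventD(5)[OF R] by blast
  then show ?thesis by (simp add: resolventD(4)[OF R] linear_diff[OF lin])
qed

text \<open>This is the carrier of scalar linearity: \<open>G\<close> will be multiplication by a
  scalar, first for \<open>|A|\<close> and then for its square root.\<close>

lemma root_op_commute:
  assumes "bounded_linear G" "\<And>y z. B y = Some z \<Longrightarrow> B (G y) = Some (G z)" "root_op y = Some z"
  shows "root_op (G y) = Some (G z)"
  using assms(3) C(4)[OF assms(1) commute_R[OF assms(1,2)]] D(3)[OF assms(1) commute_R[OF assms(1,2)]]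
  unfolding root_op_Some by auto

text \<open>Every self-adjoint square root of \<open>B\<close> is of the form \<open>F D\<^sup>-\<^sup>1\<close> with the same \<open>D\<close>: since
  \<open>\<parallel>A R y\<parallel> = \<parallel>C D y\<parallel>\<close>, closedness of \<open>A\<close> extends \<open>F = A D\<close> from the range of \<open>D\<close> to the whole space.\<close>

lemma square_root_quotient:
  assumes A: "real_self_adjoint A" and sq: "A \<circ>\<^sub>m A = B"
  obtains F where "bdd_symmetric F" "\<And>x. F (F x) = C (C x)" "\<And>x. F (D x) = D (F x)" "\<And>x. F (C x) = C (F x)"
    "\<And>x. norm (F x) = norm (C x)"
    "\<And>y z. A y = Some z \<longleftrightarrow> (\<exists>t. y = D t \<and> z = F t)"
proof -
  note linR = bounded_linear.linear[OF bounded(1)] and linC = bounded_linear.linear[OF bounded(2)] and linD = bounded_linear.linear[OF bounded(3)]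
  \<comment> \<open>The range of \<open>R\<close> is the domain of \<open>A^2\<close>, so
    \<open>W = A R\<close> is everywhere defined; it will turn out to equal
    \<open>F D\<close>.\<close>
  have "\<exists>w. A (R x) = Some w \<and> A w = Some (x - R x)" for x
    using resolventD(5)[OF R, of x] unfolding sq[symmetric] map_comp_Some by auto
  then obtain W where W: "\<And>x. A (R x) = Some (W x)" "\<And>x. A (W x) = Some (x - R x)" by metis
  have RA: "R z = W y" if "A y = Some z" for y z
  proof -
    have "A (y - R y) = Some (z - W y)" by (rule rsa_diff[OF A that W(1)])
    then have "B (W y) = Some (z - W y)" using W(2) unfolding sq[symmetric] map_comp_Some by blast
    then show ?thesis by (simp add: resolventD(4)[OF R])
  qed
  have Wadd: "W (x + y) = W x + W y" for x y
    using rsa_add[OF A W(1) W(1), of x y] W(1)[of "x + y"] by (simp add: linear_add[OF linR])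
  have Wscale: "W (c *\<^sub>R x) = c *\<^sub>R W x" for c x
    using rsa_scaleR[OF A W(1), of c x] W(1)[of "c *\<^sub>R x"] by (simp add: linear_scale[OF linR])
  have Wlin: "linear W" using Wadd Wscale by (rule linearI)
  have Wsym: "inner (W x) y = inner x (W y)" for x y
  proof -
    have "inner (W x) (R y) = inner (R x) (W y)" by (rule rsa_sym[OF A W(1) W(1)])
    moreover have "inner (x - R x) (W y) = inner (W x) (y - R y)" by (rule rsa_sym[OF A W(2) W(2)])
    ultimately show ?thesis by (simp add: inner_diff_left inner_diff_right)
  qed
  have Wnorm: "norm (W x) = norm (C (D x))" for x
  proof -
    have "inner (W x) (W x) = inner (R x) (x - R x)" by (rule rsa_sym[OF A W(1) W(2)])
    also have "\<dots> = inner (C (D x)) (C (D x))"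
      by (simp add: symm(2) C(3) D(2)[symmetric] D_R[symmetric] symm(3) linear_diff[OF linD])
    finally show ?thesis by (simp add: norm_eq)
  qed
  have "bounded_linear W"
  proof -
    obtain K where "\<And>x. norm (C (D x)) \<le> norm x * K"
      using bounded_linear.bounded[OF bounded_linear_compose[OF bounded(2,3)]] by blast
    then show ?thesis by (intro bounded_linear_intro[of W K]) (auto simp: Wadd Wscale Wnorm)
  qed
  note Wbl = this
  have WR: "W (R x) = R (W x)" for x by (rule RA[OF W(1), symmetric])
  have WD: "W (D x) = D (W x)" for x by (rule D(3)[OF Wbl WR])
  have WC: "W (C x) = C (W x)" for x by (rule C(4)[OF Wbl WR])
  have "\<exists>z. A (D t) = Some z \<and> norm z = norm (C t)" for t
  proof -
    have "t \<in> closure (range D)" by (simp add: dense)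
    then obtain u where u: "\<forall>n. u n \<in> range D" "u \<longlonglongrightarrow> t" unfolding closure_sequential by blast
    then have "\<forall>n. \<exists>v. u n = D v" by blast
    then obtain y where y: "\<And>n. u n = D (y n)" by metis
    have lims: "(\<lambda>n. C (D (y n))) \<longlonglongrightarrow> C t" "(\<lambda>n. D (D (y n))) \<longlonglongrightarrow> D t"
      using bounded_linear.tendsto[OF bounded(2) u(2)] bounded_linear.tendsto[OF bounded(3) u(2)] by (simp_all add: y)
    have "dist (W (y m)) (W (y n)) = dist (C (D (y m))) (C (D (y n)))" for m n
      using Wnorm[of "y m - y n"] by (simp add: dist_norm linear_diff[OF Wlin] linear_diff[OF linC] linear_diff[OF linD])
    then have "Cauchy (\<lambda>n. W (y n))" using LIMSEQ_imp_Cauchy[OF lims(1)] by (simp add: Cauchy_def)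
    then obtain z where z: "(\<lambda>n. W (y n)) \<longlonglongrightarrow> z" using Cauchy_convergent convergent_def by blast
    have "A (D t) = Some z"
      by (rule rsa_closed[OF A _ lims(2) z]) (simp add: D(2) W(1))
    moreover have "norm z = norm (C t)"
      using LIMSEQ_unique[OF tendsto_norm[OF z]] tendsto_norm[OF lims(1)] by (simp add: Wnorm)
    ultimately show ?thesis by blast
  qed
  then obtain F where F: "\<And>t. A (D t) = Some (F t)" and Fnorm: "\<And>t. norm (F t) = norm (C t)" by metis
  have Fbl: "bounded_linear F"
  proof -
    have "F (x + y) = F x + F y" for x y
      using rsa_add[OF A F F, of x y] F[of "x + y"] by (simp add: linear_add[OF linD])
    moreover have "F (c *\<^sub>R x) = c *\<^sub>R F x" for c x
      using rsa_scaleR[OF A F, of c x] F[of "c *\<^sub>R x"] by (simp add: linear_scale[OF linD])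
    moreover obtain K where "\<And>x. norm (C x) \<le> norm x * K" using bounded_linear.bounded[OF bounded(2)] by blast
    ultimately show ?thesis by (intro bounded_linear_intro[of F K]) (auto simp: Fnorm)
  qed
  have FDW: "F (D x) = W x" for x using F[of "D x"] W(1)[of x] by (simp add: D(2))
  have FD: "F (D x) = D (F x)" for x
    by (rule bounded_linear_eq_on_dense_range[OF dense(1), of "\<lambda>x. F (D x)" "\<lambda>x. D (F x)"])
      (simp_all add: bounded_linear_compose Fbl Wbl bounded FDW WD)
  have FC: "F (C x) = C (F x)" for x
    by (rule bounded_linear_eq_on_dense_range[OF dense(1), of "\<lambda>x. F (C x)" "\<lambda>x. C (F x)"])
      (simp_all add: bounded_linear_compose Fbl Wbl bounded FDW C_D WC)
  have FF: "F (F x) = C (C x)" for x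
  proof (rule bounded_linear_eq_on_dense_range[OF dense(3), of "\<lambda>x. F (F x)" "\<lambda>x. C (C x)"])
    fix t
    have "F (F (R t)) = F (D (W t))" by (simp add: D(2)[symmetric] FDW WD)
    also have "\<dots> = W (W t)" by (rule FDW)
    also have "\<dots> = R (t - R t)" using RA[OF W(2)[of t]] by simp
    finally show "F (F (R t)) = C (C (R t))" by (simp add: C(3) linear_diff[OF linR])
  qed (simp_all add: bounded_linear_compose Fbl bounded)
  \<comment> \<open>\<open>F\<close> is known explicitly only on the range of \<open>D\<close>,
    where it is \<open>W\<close>. Symmetry is therefore extended by density in one argument at a
    time.\<close>
  have Fsym: "inner (F x) y = inner x (F y)" for x y
  proof -
    have *: "inner (F (D u)) y = inner (D u) (F y)" for u
    proof -
      have "inner (F y) (D u) = inner y (F (D u))"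
        by (rule bounded_linear_eq_on_dense_range[OF dense(1) bounded_linear_compose[OF bounded_linear_inner_left Fbl]
              bounded_linear_inner_left]) (simp add: FDW symm(3) Wsym WD)
      then show ?thesis by (simp add: inner_commute)
    qed
    show ?thesis
      by (rule bounded_linear_eq_on_dense_range[OF dense(1) bounded_linear_compose[OF bounded_linear_inner_left Fbl]
            bounded_linear_inner_left]) (rule *)
  qed
  have dom: "\<exists>t. y = D t \<and> z = F t" if "A y = Some z" for y z
  proof -
    have "inner x (F y - D z) = 0" for x
      using rsa_sym[OF A F that, of x] by (simp add: inner_diff_right Fsym symm(3))
    then have eq: "F y = D z" by (metis inner_eq_zero_iff eq_iff_diff_eq_0)
    have "y = D (F z + D y)"
      using sum_squares[of y] by (simp add: FF[symmetric] eq FD linear_add[OF linD])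
    then show ?thesis using F[of "F z + D y"] that by auto
  qed
  show ?thesis
    by (rule that[of F]) (use Fbl Fsym FF FD FC Fnorm F dom in \<open>auto simp: bdd_symmetric_def\<close>)
qed

text \<open>Another nonnegative root is \<open>F D^-1\<close> with the same \<open>D\<close>. Its
  nonnegativity says \<open>0 <= inner (F t) (D t)\<close>, which is positivity of \<open>F\<close>
  on the dense range of \<open>E\<close>. Then \<open>F\<close> and \<open>C\<close> are commuting
  positive roots of the same bounded operator.\<close>

lemma root_op_unique:
  assumes A: "real_self_adjoint A" "nonneg_op A" "A \<circ>\<^sub>m A = B"
  shows "A = root_op"
proof -
  obtain F where F: "bdd_symmetric F" "\<And>x. F (F x) = C (C x)" "\<And>x. F (D x) = D (F x)" "\<And>x. F (C x) = C (F x)"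
    "\<And>x. norm (F x) = norm (C x)" "\<And>y z. A y = Some z \<longleftrightarrow> (\<exists>t. y = D t \<and> z = F t)"
    by (rule square_root_quotient[OF A(1,3)]) blast
  note Fbl = bdd_symmetricD(1)[OF F(1)]
  have FE: "F (E x) = E (F x)" for x by (rule E(3)[OF Fbl]) (simp add: D(2)[symmetric] F(3))
  have "closed {x. 0 \<le> inner (F x) x}"
    by (intro closed_Collect_le continuous_intros linear_continuous_on Fbl)
  moreover have "0 \<le> inner (F (E t)) (E t)" for t
  proof -
    have "inner (F (E t)) (E t) = inner (F t) (D t)" by (simp add: FE symm(4) E(2))
    moreover have "A (D t) = Some (F t)" using F(6) by blast
    ultimately show ?thesis using A(2) unfolding nonneg_op_def by simp
  qed
  ultimately have "closure (range E) \<subseteq> {x. 0 \<le> inner (F x) x}" by (intro closure_minimal) auto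
  then have "0 \<le> inner (F x) x" for x using dense(2) by auto
  then have "F x = C x" for x by (intro commuting_positive_roots_unique[OF F(1) _ C(1,2) F(4,2)])
  then have "A y = Some z \<longleftrightarrow> root_op y = Some z" for y z unfolding F(6) root_op_Some by simp
  then show ?thesis by (intro ext) (metis option.exhaust)
qed

end

text \<open>\<open>M = |A|\<close>, \<open>S = |A|\<^sup>1\<^sup>/\<^sup>2\<close> and \<open>T = A (1 + |A|)\<^sup>-\<^sup>1\<close>.\<close>

lemma absolute_value_and_root_exist:
  fixes A :: "'h::{real_inner, complete_space} \<rightharpoonup> 'h"
  assumes A: "real_self_adjoint A"
  obtains M S T where
    "real_self_adjoint M" "nonneg_op M" "M \<circ>\<^sub>m M = A \<circ>\<^sub>m A"
    "\<And>M'. real_self_adjoint M' \<Longrightarrow> nonneg_op M' \<Longrightarrow> M' \<circ>\<^sub>m M' = A \<circ>\<^sub>m A \<Longrightarrow> M' = M"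
    "real_self_adjoint S" "nonneg_op S" "S \<circ>\<^sub>m S = M"
    "\<And>S'. real_self_adjoint S' \<Longrightarrow> nonneg_op S' \<Longrightarrow> S' \<circ>\<^sub>m S' = M \<Longrightarrow> S' = S"
    "bdd_symmetric T" "\<And>x. norm (T x) \<le> norm x"
    "\<And>y z. S y = Some z \<Longrightarrow> S (T y) = Some (T z)"
    "\<And>x w. A x = Some w \<Longrightarrow> \<exists>v. M x = Some v \<and> w = T (x + v)"
    "\<And>G y z. bounded_linear G \<Longrightarrow> (\<And>y z. A y = Some z \<Longrightarrow> A (G y) = Some (G z)) \<Longrightarrow>
       M y = Some z \<Longrightarrow> M (G y) = Some (G z)"
    "\<And>G y z. bounded_linear G \<Longrightarrow> (\<And>y z. A y = Some z \<Longrightarrow> A (G y) = Some (G z)) \<Longrightarrow>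
       S y = Some z \<Longrightarrow> S (G y) = Some (G z)"
    "\<And>G x. bounded_linear G \<Longrightarrow> (\<And>y z. A y = Some z \<Longrightarrow> A (G y) = Some (G z)) \<Longrightarrow>
       T (G x) = G (T x)"
proof -
  obtain R C D E where "resolvent_roots (A \<circ>\<^sub>m A) R C D E"
    using resolvent_square_exists[OF A] resolvent_roots_exist by blast
  then interpret r: resolvent_roots "A \<circ>\<^sub>m A" R C D E .
  define M where "M = r.root_op"
  have M: "real_self_adjoint M" "nonneg_op M" unfolding M_def by (rule r.root_op_self_adjoint r.root_op_nonneg)+
  have MS: "M y = Some z \<longleftrightarrow> (\<exists>t. y = D t \<and> z = C t)" for y z unfolding M_def by (rule r.root_op_Some)
  obtain F where F: "bdd_symmetric F" "\<And>x. F (F x) = C (C x)" "\<And>x. F (D x) = D (F x)" "\<And>x. F (C x) = C (F x)"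
    "\<And>x. norm (F x) = norm (C x)" "\<And>y z. A y = Some z \<longleftrightarrow> (\<exists>t. y = D t \<and> z = F t)"
    by (rule r.square_root_quotient[OF A refl]) blast
  obtain R1 C1 D1 E1 where "resolvent_roots M R1 C1 D1 E1"
    using resolvent_nonneg_exists[OF M] resolvent_roots_exist by blast
  then interpret s: resolvent_roots M R1 C1 D1 E1 .
  define S where "S = s.root_op"
  \<comment> \<open>\<open>A\<close> and \<open>M\<close> have the same domain, the range of
    \<open>D\<close>, so \<open>T = A R1\<close> is everywhere defined. It is a contraction because
    \<open>F\<close> and \<open>C\<close> have equal norms and
    \<open>x - R1 x = C (t x)\<close>.\<close>
  have "\<exists>w t. A (R1 x) = Some w \<and> w = F t \<and> R1 x = D t \<and> x - R1 x = C t" for x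
    using resolventD(5)[OF s.R, of x] unfolding MS F(6) by blast
  then obtain T t where T: "\<And>x. A (R1 x) = Some (T x)" "\<And>x. T x = F (t x)" "\<And>x. R1 x = D (t x)" "\<And>x. x - R1 x = C (t x)"
    by metis
  note linR1 = bounded_linear.linear[OF s.bounded(1)]
  have Tnorm: "norm (T x) \<le> norm x" for x
    unfolding T(2) F(5) T(4)[symmetric] by (rule resolventD(3)[OF s.R])
  have Tadd: "T (x + y) = T x + T y" for x y
    using rsa_add[OF A T(1) T(1), of x y] T(1)[of "x + y"] by (simp add: linear_add[OF linR1])
  have Tscale: "T (c *\<^sub>R x) = c *\<^sub>R T x" for c x
    using rsa_scaleR[OF A T(1), of c x] T(1)[of "c *\<^sub>R x"] by (simp add: linear_scale[OF linR1])
  have Tbl: "bounded_linear T" using Tnorm by (intro bounded_linear_intro[of T 1]) (simp_all add: Tadd Tscale)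
  have FR1: "F (R1 x) = R1 (F x)" for x
    by (rule s.commute_R[OF bdd_symmetricD(1)[OF F(1)]]) (auto simp: MS F(3,4))
  have DR1: "D (R1 x) = R1 (D x)" for x
    by (rule s.commute_R[OF r.bounded(3)]) (auto simp: MS r.C_D[symmetric])
  have AR1: "A (R1 y) = Some (R1 z)" if "A y = Some z" for y z
    using that FR1 DR1 unfolding F(6) by metis
  have TR1: "T (R1 x) = R1 (T x)" for x
    using AR1[OF T(1)[of x]] T(1)[of "R1 x"] by simp
  \<comment> \<open>The second argument is decomposed as \<open>R1 y\<close> plus
    \<open>y - R1 y\<close>: symmetry of \<open>A\<close> settles the first part, commutation of
    \<open>F\<close> with \<open>C\<close> the second.\<close>
  have Tsym: "inner (T x) y = inner x (T y)" for x y
  proof -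
    have "inner (T x) (R1 y) = inner (R1 x) (T y)" by (rule rsa_sym[OF A T(1) T(1)])
    moreover have "inner (T x) (y - R1 y) = inner (x - R1 x) (T y)"
      unfolding T(4) unfolding T(2) by (metis bdd_symmetricD(2) F(1,4) r.C(1))
    ultimately show ?thesis by (simp add: inner_diff_left inner_diff_right)
  qed
  show ?thesis
  proof (rule that)
    show "real_self_adjoint M" "nonneg_op M" by fact+
    show "M \<circ>\<^sub>m M = A \<circ>\<^sub>m A" unfolding M_def by (rule r.root_op_square)
    show "M' = M" if "real_self_adjoint M'" "nonneg_op M'" "M' \<circ>\<^sub>m M' = A \<circ>\<^sub>m A" for M'
      unfolding M_def by (rule r.root_op_unique[OF that])
    show "real_self_adjoint S" "nonneg_op S" "S \<circ>\<^sub>m S = M"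
      unfolding S_def by (rule s.root_op_self_adjoint s.root_op_nonneg s.root_op_square)+
    show "S' = S" if "real_self_adjoint S'" "nonneg_op S'" "S' \<circ>\<^sub>m S' = M" for S'
      unfolding S_def by (rule s.root_op_unique[OF that])
    show "bdd_symmetric T" using Tbl Tsym by (simp add: bdd_symmetric_def)
    show "norm (T x) \<le> norm x" for x by (rule Tnorm)
    show "S (T y) = Some (T z)" if "S y = Some z" for y z
      using that s.C(4)[OF Tbl TR1] s.D(3)[OF Tbl TR1] unfolding S_def s.root_op_Some by metis
    show "\<exists>v. M x = Some v \<and> w = T (x + v)" if Ax: "A x = Some w" for x w
    proof -
      obtain u where u: "M x = Some u" using Ax unfolding F(6) MS by blast
      then have "x = R1 (x + u)" by (simp add: resolventD(4)[OF s.R])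
      then have "w = T (x + u)" using T(1)[of "x + u"] Ax by simp
      then show ?thesis using u by blast
    qed
    fix G :: "'h \<Rightarrow> 'h" assume G: "bounded_linear G" "\<And>y z. A y = Some z \<Longrightarrow> A (G y) = Some (G z)"
    show MG: "M (G y) = Some (G z)" if "M y = Some z" for y z
      using that unfolding M_def
      by (rule r.root_op_commute[OF G(1), rotated]) (use G(2) in \<open>auto simp: map_comp_Some\<close>)
    show "S (G y) = Some (G z)" if "S y = Some z" for y z
      using that unfolding S_def by (rule s.root_op_commute[OF G(1) MG, rotated])
    show "T (G x) = G (T x)" for x
      using G(2)[OF T(1)[of x]] T(1)[of "G x"] s.commute_R[OF G(1) MG] by simp
  qed
qed

section \<open>Scalars\<close>

lemma to_complex_0 [simp]: "to_complex 0 = 0"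
  using norm_to_complex[of 0] by simp

lemma to_complex_1 [simp]: "to_complex (1::'k::real_or_complex) = 1"
proof -
  have "to_complex (1::'k) * to_complex (1::'k) = to_complex (1::'k)"
    using to_complex_mult[of "1::'k" 1] by simp
  moreover have "to_complex (1::'k) \<noteq> 0" using norm_to_complex[of "1::'k"] by auto
  ultimately show ?thesis by simp
qed

lemma to_complex_of_real [simp]: "to_complex (of_real r) = of_real r"
  by (simp add: of_real_def to_complex_scaleR)

lemma to_complex_minus: "to_complex (- x) = - to_complex x"
  using to_complex_scaleR[of "-1" x] by simp

lemma to_complex_diff: "to_complex (x - y) = to_complex x - to_complex y"
  using to_complex_add[of x "- y"] by (simp add: to_complex_minus)

lemma to_complex_eq_iff: "to_complex x = to_complex y \<longleftrightarrow> x = y"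
proof
  assume "to_complex x = to_complex y"
  then have "cmod (to_complex (x - y)) = 0" by (simp add: to_complex_diff)
  then show "x = y" by (simp add: norm_to_complex)
qed simp

lemma sconj_simps [simp]:
  fixes x y :: "'k::real_or_complex"
  shows "sconj (x + y) = sconj x + sconj y" "sconj (x * y) = sconj x * sconj y"
    "sconj (of_real r :: 'k) = of_real r" "sconj (sconj x) = x" "sconj (0::'k) = 0" "sconj (1::'k) = 1"
    "norm (sconj x) = norm x" "sconj (- x) = - sconj x" "sconj (x - y) = sconj x - sconj y"
  by (simp_all add: to_complex_eq_iff[where 'a='k, symmetric] to_complex_sconj to_complex_add to_complex_mult to_complex_minus
      to_complex_diff norm_to_complex[where 'a='k, symmetric])

lemma mult_sconj: "(x::'k::real_or_complex) * sconj x = of_real ((norm x)\<^sup>2)"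
  by (simp add: to_complex_eq_iff[where 'a='k, symmetric] to_complex_sconj to_complex_mult norm_to_complex[where 'a='k, symmetric] complex_norm_square del: of_real_power)

lemma real_part_simps [simp]:
  fixes x y :: "'k::real_or_complex"
  shows "real_part (x + y) = real_part x + real_part y" "real_part (of_real r :: 'k) = r"
    "real_part (of_real r * x) = r * real_part x" "real_part (sconj x) = real_part x" "real_part (0::'k) = 0"
    "real_part (- x) = - real_part x" "real_part (x - y) = real_part x - real_part y" "real_part (1::'k) = 1"
  by (simp_all add: real_part_def to_complex_add to_complex_mult to_complex_sconj to_complex_minus to_complex_diff)

lemma abs_real_part_le: "\<bar>real_part (x::'k::real_or_complex)\<bar> \<le> norm x"
  unfolding real_part_def norm_to_complex[where 'a='k, symmetric] by (rule abs_Re_le_cmod)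

lemma sconj_eq_self:
  fixes x :: "'k::real_or_complex"
  assumes "sconj x = x" shows "x = of_real (real_part x)"
proof -
  have "cnj (to_complex x) = to_complex x" using assms by (simp add: to_complex_sconj[symmetric])
  then have "Im (to_complex x) = 0" by (simp add: complex_eq_iff)
  then have "to_complex x = of_real (real_part x)" by (simp add: real_part_def complex_eq_iff)
  then show ?thesis by (simp add: to_complex_eq_iff[where 'a='k, symmetric])
qed

text \<open>Promotes identities between real inner products, valid after every rescaling of an
  argument, to identities between scalar products. The test value is
  \<open>c = sconj d\<close>.\<close>

lemma real_part_mult_eq_zero:
  fixes d :: "'k::real_or_complex"
  assumes "\<And>c. real_part (c * d) = 0" shows "d = 0"
proof -
  have "real_part (d * sconj d) = 0" using assms[of "sconj d"] by (simp add: mult.commute)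
  then show ?thesis unfolding mult_sconj real_part_simps by simp
qed

section \<open>The form domain and the form of a self-adjoint operator\<close>

context hilbert_space
begin

lemma m_diff_left: "m (x - y) z = m x z - m y z"
proof -
  have "m (x - y) z + m y z = m x z" by (simp add: m_add_left[symmetric])
  then show ?thesis by (simp add: algebra_simps)
qed

lemma m_add_right: "m z (x + y) = m z x + m z y"
  by (subst (1 2 3) m_conj) (simp add: m_add_left)

lemma m_diff_right: "m z (x - y) = m z x - m z y"
  by (subst (1 2 3) m_conj) (simp add: m_diff_left)

lemma m_smul_right: "m z (smul c x) = sconj c * m z x"
  by (subst (1 2) m_conj) (simp add: m_smul_left)

lemma m_zero [simp]: "m 0 x = 0" "m x 0 = 0"
  using m_diff_left[of x x] m_diff_right[of x x] m_diff_left[of 0 0 x] m_diff_right[of x 0 0] by auto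

text \<open>The locale relates \<open>m\<close> to the inner product of the type only through the
  norm; polarization does the rest.\<close>

lemma real_part_m: "real_part (m x y) = inner x y"
proof -
  have "real_part (m (x + y) (x + y)) = (norm x)\<^sup>2 + 2 * real_part (m x y) + (norm y)\<^sup>2"
    using m_self[of x] m_self[of y] m_conj[of x y] by (simp add: m_add_left m_add_right del: of_real_power)
  moreover have "real_part (m (x + y) (x + y)) = (norm (x + y))\<^sup>2" by (simp add: m_self del: of_real_power)
  moreover have "(norm (x + y))\<^sup>2 = (norm x)\<^sup>2 + 2 * inner x y + (norm y)\<^sup>2"
    by (simp add: power2_norm_eq_inner inner_add_left inner_add_right inner_commute)
  ultimately show ?thesis by simp
qed

lemma norm_smul: "norm (smul c x) = norm c * norm x"
proof -
  have "of_real ((norm (smul c x))\<^sup>2) = (c * sconj c) * m x x"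
    unfolding m_self[symmetric] by (simp add: m_smul_left m_smul_right)
  then have "(of_real ((norm (smul c x))\<^sup>2) :: 'k) = of_real ((norm c * norm x)\<^sup>2)"
    by (simp add: mult_sconj m_self power_mult_distrib)
  then have "(norm (smul c x))\<^sup>2 = (norm c * norm x)\<^sup>2" by (simp only: of_real_eq_iff)
  then show ?thesis by simp
qed

lemma bounded_linear_smul: "bounded_linear (smul c)"
proof (rule bounded_linear_intro[of _ "norm c"])
  show "smul c (r *\<^sub>R x) = r *\<^sub>R smul c x" for r x
    by (simp add: smul_of_real[symmetric] scale_left_commute)
qed (simp_all add: scale_right_distrib norm_smul)

text \<open>Real Cauchy-Schwarz after multiplying \<open>x\<close> by the conjugate of
  \<open>m x y\<close>, which makes the scalar product real.\<close>

lemma norm_m_le: "norm (m x y) \<le> norm x * norm y"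
proof (cases "m x y = 0")
  case False
  let ?d = "m x y"
  have "(norm ?d)\<^sup>2 = real_part (?d * sconj ?d)" unfolding mult_sconj real_part_simps ..
  also have "\<dots> = inner (smul (sconj ?d) x) y" by (simp add: real_part_m[symmetric] m_smul_left mult.commute)
  also have "\<dots> \<le> norm ?d * norm x * norm y"
    using norm_cauchy_schwarz[of "smul (sconj ?d) x" y] by (simp add: norm_smul)
  finally show ?thesis using False by (simp add: power2_eq_square mult.assoc)
qed simp

lemma hermitian_form_m: "hermitian_form_on smul V m"
  unfolding hermitian_form_on_def using m_add_left m_smul_left m_conj by blast

text \<open>The graph is stable under scalars, so the real condition may be tested at every
  \<open>smul c x\<close>, and this determines the full scalar product.\<close>

lemma adjoint_condition_iff:
  assumes A: "\<And>c x w. A x = Some w \<Longrightarrow> A (smul c x) = Some (smul c w)"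
  shows "(\<forall>x\<in>dom A. m (the (A x)) y = m x z) \<longleftrightarrow> (\<forall>x w. A x = Some w \<longrightarrow> inner w y = inner x z)"
proof
  assume "\<forall>x\<in>dom A. m (the (A x)) y = m x z"
  then have "m w y = m x z" if "A x = Some w" for x w using that by force
  then show "\<forall>x w. A x = Some w \<longrightarrow> inner w y = inner x z" by (simp add: real_part_m[symmetric])
next
  assume *: "\<forall>x w. A x = Some w \<longrightarrow> inner w y = inner x z"
  show "\<forall>x\<in>dom A. m (the (A x)) y = m x z"
  proof
    fix x assume "x \<in> dom A"
    then obtain w where w: "A x = Some w" by blast
    have "m w y - m x z = 0"
    proof (rule real_part_mult_eq_zero)
      fix c
      have "inner (smul c w) y = inner (smul c x) z" using * A[OF w] by blast
      then show "real_part (c * (m w y - m x z)) = 0"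
        by (simp add: right_diff_distrib m_smul_left[symmetric] real_part_m)
    qed
    then show "m (the (A x)) y = m x z" using w by simp
  qed
qed

text \<open>Splits self-adjointness into the real theory and commutation with scalars. Both halves
  pass separately from \<open>A\<close> to \<open>|A|\<close> and to its square root.\<close>

lemma self_adjoint_iff:
  "self_adjoint smul m A \<longleftrightarrow>
    real_self_adjoint A \<and> (\<forall>c x w. A x = Some w \<longrightarrow> A (smul c x) = Some (smul c w))"
proof
  assume A: "self_adjoint smul m A"
  then have lin: "linear_operator smul A" by (simp add: self_adjoint_def)
  have sc: "A (smul c x) = Some (smul c w)" if "A x = Some w" for c x w
  proof -
    have x: "x \<in> dom A" using that by blast
    then have "smul c x \<in> dom A" using lin subspace_scale by (auto simp: linear_operator_def)
    then obtain v where "A (smul c x) = Some v" by blast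
    moreover have "the (A (smul c x)) = smul c (the (A x))" using lin x by (simp add: linear_operator_def)
    ultimately show ?thesis using that by simp
  qed
  then show "real_self_adjoint A \<and> (\<forall>c x w. A x = Some w \<longrightarrow> A (smul c x) = Some (smul c w))"
    using A adjoint_condition_iff[of A] unfolding self_adjoint_def real_self_adjoint_def by simp
next
  assume A: "real_self_adjoint A \<and> (\<forall>c x w. A x = Some w \<longrightarrow> A (smul c x) = Some (smul c w))"
  then have r: "real_self_adjoint A" and sc: "\<And>c x w. A x = Some w \<Longrightarrow> A (smul c x) = Some (smul c w)" by auto
  have "linear_operator smul A"
    unfolding linear_operator_def
  proof (intro conjI ballI allI)
    show "subspace (dom A)"
      by (rule subspaceI) (use rsa_zero[OF r] rsa_add[OF r] sc in \<open>auto simp: dom_def\<close>)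
    show "the (A (x + y)) = the (A x) + the (A y)" if "x \<in> dom A" "y \<in> dom A" for x y
      using that rsa_add[OF r] by force
    show "the (A (smul c x)) = smul c (the (A x))" if "x \<in> dom A" for c x
      using that sc by force
  qed
  then show "self_adjoint smul m A"
    using r adjoint_condition_iff[of A, OF sc] unfolding self_adjoint_def real_self_adjoint_def by simp
qed

lemma positive_operator_iff: "positive_operator m A \<longleftrightarrow> nonneg_op A"
  unfolding positive_operator_def nonneg_op_def real_part_m by (metis domD domI option.sel)

text \<open>The uniqueness premise ranges over all real self-adjoint roots, a larger class than the
  candidates of the definite description, which also commute with scalars.\<close>

lemma op_sqrt_eq:
  assumes S: "real_self_adjoint S" "nonneg_op S" "S \<circ>\<^sub>m S = B"
    and uniq: "\<And>S'. real_self_adjoint S' \<Longrightarrow> nonneg_op S' \<Longrightarrow> S' \<circ>\<^sub>m S' = B \<Longrightarrow> S' = S"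
    and sc: "\<And>c x w. S x = Some w \<Longrightarrow> S (smul c x) = Some (smul c w)"
  shows "op_sqrt smul m B = S"
  unfolding op_sqrt_def self_adjoint_iff positive_operator_iff
  by (rule the_equality) (use S sc uniq in blast)+

text \<open>Here the definite descriptions behind \<open>|A|^(1/2)\<close> receive their values.
  Scalar multiplications preserve the graph of \<open>A\<close>, hence commute with
  \<open>M\<close>, \<open>S\<close> and \<open>T\<close>, so the real constructions are operators
  over the scalar field.\<close>

lemma form_structure:
  assumes "self_adjoint smul m A"
  obtains S T where "sqrt_abs smul m A = S" "self_adjoint smul m S" "dom A \<subseteq> dom S"
    "bdd_symmetric T" "\<And>x. norm (T x) \<le> norm x" "\<And>c x. T (smul c x) = smul c (T x)"
    "\<And>y z. S y = Some z \<Longrightarrow> S (T y) = Some (T z)"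
    "\<And>x w. A x = Some w \<Longrightarrow> \<exists>s v. S x = Some s \<and> S s = Some v \<and> w = T (x + v)"
proof -
  have A: "real_self_adjoint A" and sc: "\<And>c x w. A x = Some w \<Longrightarrow> A (smul c x) = Some (smul c w)"
    using assms unfolding self_adjoint_iff by auto
  obtain M S T where *:
    "real_self_adjoint M" "nonneg_op M" "M \<circ>\<^sub>m M = A \<circ>\<^sub>m A"
    "\<And>M'. real_self_adjoint M' \<Longrightarrow> nonneg_op M' \<Longrightarrow> M' \<circ>\<^sub>m M' = A \<circ>\<^sub>m A \<Longrightarrow> M' = M"
    "real_self_adjoint S" "nonneg_op S" "S \<circ>\<^sub>m S = M"
    "\<And>S'. real_self_adjoint S' \<Longrightarrow> nonneg_op S' \<Longrightarrow> S' \<circ>\<^sub>m S' = M \<Longrightarrow> S' = S"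
    "bdd_symmetric T" "\<And>x. norm (T x) \<le> norm x"
    "\<And>y z. S y = Some z \<Longrightarrow> S (T y) = Some (T z)"
    "\<And>x w. A x = Some w \<Longrightarrow> \<exists>v. M x = Some v \<and> w = T (x + v)"
    "\<And>G y z. bounded_linear G \<Longrightarrow> (\<And>y z. A y = Some z \<Longrightarrow> A (G y) = Some (G z)) \<Longrightarrow>
       M y = Some z \<Longrightarrow> M (G y) = Some (G z)"
    "\<And>G y z. bounded_linear G \<Longrightarrow> (\<And>y z. A y = Some z \<Longrightarrow> A (G y) = Some (G z)) \<Longrightarrow>
       S y = Some z \<Longrightarrow> S (G y) = Some (G z)"
    "\<And>G x. bounded_linear G \<Longrightarrow> (\<And>y z. A y = Some z \<Longrightarrow> A (G y) = Some (G z)) \<Longrightarrow>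
       T (G x) = G (T x)"
    by (rule absolute_value_and_root_exist[OF A]) blast
  have M_sc: "M (smul c y) = Some (smul c z)" if "M y = Some z" for c y z
    by (rule *(13)[OF bounded_linear_smul _ that]) (rule sc)
  have S_sc: "S (smul c y) = Some (smul c z)" if "S y = Some z" for c y z
    by (rule *(14)[OF bounded_linear_smul _ that]) (rule sc)
  have T_sc: "T (smul c x) = smul c (T x)" for c x
    by (rule *(15)[OF bounded_linear_smul]) (rule sc)
  have "op_abs smul m A = M"
    unfolding op_abs_def by (rule op_sqrt_eq[OF *(1-4) M_sc])
  moreover have "op_sqrt smul m M = S" by (rule op_sqrt_eq[OF *(5-8) S_sc])
  ultimately have sq: "sqrt_abs smul m A = S" unfolding sqrt_abs_def by simp
  have SS: "\<exists>s v. S x = Some s \<and> S s = Some v \<and> w = T (x + v)" if "A x = Some w" for x w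
    using *(12)[OF that] unfolding *(7)[symmetric] map_comp_Some by blast
  show ?thesis
  proof (rule that[of S T])
    show "self_adjoint smul m S" unfolding self_adjoint_iff using *(5) S_sc by blast
    show "dom A \<subseteq> dom S" using SS by blast
  qed (use sq SS T_sc *(9-11) in auto)
qed

lemma bdd_symmetric_m:
  assumes T: "bdd_symmetric T" and sc: "\<And>c x. T (smul c x) = smul c (T x)"
  shows "m (T x) y = m x (T y)"
proof -
  have "m (T x) y - m x (T y) = 0"
  proof (rule real_part_mult_eq_zero)
    fix c show "real_part (c * (m (T x) y - m x (T y))) = 0"
      using bdd_symmetricD(2)[OF T, of "smul c x" y]
      by (simp add: right_diff_distrib m_smul_left[symmetric] real_part_m sc)
  qed
  then show ?thesis by simp
qed

lemma self_adjoint_m_sym: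
  assumes S: "self_adjoint smul m S" "S x = Some s" "S y = Some t"
  shows "m s y = m x t"
  using S unfolding self_adjoint_def by (metis domI option.sel)

lemma form_space:
  assumes A: "self_adjoint smul m A"
  defines "Q \<equiv> form_dom smul m A" and "N \<equiv> form_norm smul m A" and "ip \<equiv> form_ip smul m A"
  shows form_dom_subspace: "subspace Q" and dom_subset_form_dom: "dom A \<subseteq> Q"
    and form_ip_hermitian: "hermitian_form_on smul Q ip"
    and form_ip_self: "real_part (ip x x) = (N x)\<^sup>2"
    and form_norm_seminorm: "seminorm_on smul Q N"
    and norm_le_form_norm: "norm x \<le> N x"
proof -
  obtain S T where ST: "sqrt_abs smul m A = S" "self_adjoint smul m S" "dom A \<subseteq> dom S"
    by (rule form_structure[OF A]) blast
  have Q: "Q = dom S" by (simp add: Q_def form_dom_def ST)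
  have ip: "ip x y = m x y + m (the (S x)) (the (S y))" for x y by (simp add: ip_def form_ip_def ST)
  \<comment> \<open>The form norm is the norm of a point of the graph of \<open>S\<close> in the
    product space; the seminorm laws come from there.\<close>
  have N: "N x = norm (x, the (S x))" for x
    by (simp add: N_def form_norm_def ip_def[symmetric] ip m_self norm_Pair del: of_real_power)
  have lin: "linear_operator smul S" using ST(2) by (simp add: self_adjoint_def)
  then show sub: "subspace Q" by (simp add: Q linear_operator_def)
  show "dom A \<subseteq> Q" using ST Q by simp
  have add: "the (S (x + y)) = the (S x) + the (S y)" if "x \<in> Q" "y \<in> Q" for x y
    using lin that by (simp add: linear_operator_def Q)
  have sc: "the (S (smul c x)) = smul c (the (S x))" if "x \<in> Q" for c x
    using lin that by (simp add: linear_operator_def Q)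
  show "hermitian_form_on smul Q ip"
    unfolding hermitian_form_on_def
  proof (intro conjI ballI allI)
    show "ip y x = sconj (ip x y)" for x y
      using m_conj[of x y] m_conj[of "the (S x)" "the (S y)"] by (simp add: ip)
  qed (simp_all add: ip add sc m_add_left m_smul_left algebra_simps)
  show "real_part (ip x x) = (N x)\<^sup>2"
    by (simp add: ip N m_self norm_Pair del: of_real_power)
  show "seminorm_on smul Q N"
    unfolding seminorm_on_def
  proof (intro conjI ballI allI)
    show "0 \<le> N x" for x by (simp add: N)
    show "N (x + y) \<le> N x + N y" if "x \<in> Q" "y \<in> Q" for x y
      using norm_triangle_ineq[of "(x, the (S x))" "(y, the (S y))"] by (simp add: N add[OF that])
    show "N (smul c x) = norm c * N x" if "x \<in> Q" for c x
    proof -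
      have "N (smul c x) = sqrt ((norm c)\<^sup>2 * ((norm x)\<^sup>2 + (norm (the (S x)))\<^sup>2))"
        by (simp add: N sc[OF that] norm_Pair norm_smul power_mult_distrib distrib_left)
      also have "\<dots> = norm c * N x" by (simp add: N norm_Pair real_sqrt_mult)
      finally show ?thesis .
    qed
  qed
  show "norm x \<le> N x" by (simp add: N norm_Pair)
qed

text \<open>With \<open>T = A (1 + |A|)\<^sup>-\<^sup>1\<close>, the form of \<open>A\<close> is \<open>m (T x) y + m (T S x) (S y)\<close>.\<close>

lemma form_of_spec:
  assumes A: "self_adjoint smul m A"
  defines "Q \<equiv> form_dom smul m A" and "N \<equiv> form_norm smul m A" and "a \<equiv> form_of smul m A"
  shows form_of_hermitian: "hermitian_form_on smul Q a"
    and form_of_bounded: "\<exists>C. \<forall>x\<in>Q. \<forall>y\<in>Q. norm (a x y) \<le> C * N x * N y"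
    and form_of_dom: "x \<in> dom A \<Longrightarrow> y \<in> Q \<Longrightarrow> a x y = m (the (A x)) y"
proof -
  obtain S T where ST: "sqrt_abs smul m A = S" "self_adjoint smul m S" "dom A \<subseteq> dom S"
    "bdd_symmetric T" "\<And>x. norm (T x) \<le> norm x" "\<And>c x. T (smul c x) = smul c (T x)"
    "\<And>y z. S y = Some z \<Longrightarrow> S (T y) = Some (T z)"
    "\<And>x w. A x = Some w \<Longrightarrow> \<exists>s v. S x = Some s \<and> S s = Some v \<and> w = T (x + v)"
    by (rule form_structure[OF A]) blast
  have Q: "Q = dom S" by (simp add: Q_def form_dom_def ST)
  note Tlin = bounded_linear.linear[OF bdd_symmetricD(1)[OF ST(4)]]
  note Tm = bdd_symmetric_m[OF ST(4,6)]
  have lin: "linear_operator smul S" using ST(2) by (simp add: self_adjoint_def)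
  have add: "the (S (x + y)) = the (S x) + the (S y)" if "x \<in> Q" "y \<in> Q" for x y
    using lin that by (simp add: linear_operator_def Q)
  have sc: "the (S (smul c x)) = smul c (the (S x))" if "x \<in> Q" for c x
    using lin that by (simp add: linear_operator_def Q)
  define b where "b x y = m (T x) y + m (T (the (S x))) (the (S y))" for x y
  have herm: "hermitian_form_on smul Q b"
    unfolding hermitian_form_on_def
  proof (intro conjI ballI allI)
    show "b y x = sconj (b x y)" for x y
      using m_conj[of x "T y"] m_conj[of "the (S x)" "T (the (S y))"] by (simp add: b_def Tm)
  qed (simp_all add: b_def add sc linear_add[OF Tlin] ST(6) m_add_left m_smul_left algebra_simps)
  have bdd: "norm (b x y) \<le> 1 * N x * N y" for x y
  proof -
    have N: "N x = norm (norm x, norm (the (S x)))" for x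
      by (simp add: N_def form_norm_def form_ip_def ST(1) m_self norm_Pair del: of_real_power)
    have "norm (b x y) \<le> norm (T x) * norm y + norm (T (the (S x))) * norm (the (S y))"
      unfolding b_def by (intro order_trans[OF norm_triangle_ineq] add_mono norm_m_le)
    also have "\<dots> \<le> norm x * norm y + norm (the (S x)) * norm (the (S y))"
      by (intro add_mono mult_right_mono ST(5)) auto
    \<comment> \<open>Cauchy-Schwarz in the plane for the two pairs of norms, whose lengths are
      \<open>N x\<close> and \<open>N y\<close>.\<close>
    also have "\<dots> = inner (norm x, norm (the (S x))) (norm y, norm (the (S y)))" by simp
    also have "\<dots> \<le> N x * N y" unfolding N by (rule norm_cauchy_schwarz)
    finally show ?thesis by simp
  qed
  have dom: "b x y = m (the (A x)) y" if xy: "x \<in> dom A" "y \<in> Q" for x y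
  proof -
    obtain w where w: "A x = Some w" using xy by blast
    obtain s v where sv: "S x = Some s" "S s = Some v" "w = T (x + v)" using ST(8)[OF w] by blast
    obtain t where t: "S y = Some t" using xy Q by blast
    \<comment> \<open>\<open>T\<close> preserves the graph of \<open>S\<close>, so
      \<open>T s\<close> lies in the domain of \<open>S\<close> and \<open>S\<close> can be moved
      off \<open>y\<close>. What remains is \<open>m (T (x + v)) y\<close>.\<close>
    have "m (T s) t = m (T v) y" by (rule self_adjoint_m_sym[OF ST(2) ST(7)[OF sv(2)] t, symmetric])
    then show ?thesis by (simp add: b_def w sv t linear_add[OF Tlin] m_add_left)
  qed
  have "hermitian_form_on smul Q a \<and> (\<exists>C. \<forall>x\<in>Q. \<forall>y\<in>Q. norm (a x y) \<le> C * N x * N y) \<and>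
    (\<forall>x\<in>dom A. \<forall>y\<in>Q. a x y = m (the (A x)) y)"
    unfolding a_def form_of_def Q_def[symmetric] N_def[symmetric]
    by (rule someI[of _ b], intro conjI exI[of _ 1] ballI) (use herm bdd dom in auto)
  then show "hermitian_form_on smul Q a" "\<exists>C. \<forall>x\<in>Q. \<forall>y\<in>Q. norm (a x y) \<le> C * N x * N y"
    "x \<in> dom A \<Longrightarrow> y \<in> Q \<Longrightarrow> a x y = m (the (A x)) y" by auto
qed

end

section \<open>Positive forms and orthonormal bases\<close>

text \<open>Everything is relative to a subspace \<open>W\<close>, because the forms of the theorem
  are Hermitian on the form domain and unconstrained outside it.\<close>

locale herm_form = vector_space smul
  for smul :: "'k::real_or_complex \<Rightarrow> 'h::ab_group_add \<Rightarrow> 'h" +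
  fixes W :: "'h set" and b :: "('k, 'h) form"
  assumes subspace_W: "subspace W" and herm: "hermitian_form_on smul W b"
begin

lemma b_add_left: "x \<in> W \<Longrightarrow> y \<in> W \<Longrightarrow> z \<in> W \<Longrightarrow> b (x + y) z = b x z + b y z"
  and b_smul_left: "x \<in> W \<Longrightarrow> y \<in> W \<Longrightarrow> b (smul c x) y = c * b x y"
  and b_conj: "x \<in> W \<Longrightarrow> y \<in> W \<Longrightarrow> b y x = sconj (b x y)"
  using herm unfolding hermitian_form_on_def by blast+

lemma b_add_right: "x \<in> W \<Longrightarrow> y \<in> W \<Longrightarrow> z \<in> W \<Longrightarrow> b z (x + y) = b z x + b z y"
  using b_conj[of "x + y" z] b_conj[of x z] b_conj[of y z] subspace_add[OF subspace_W] by (simp add: b_add_left)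

lemma b_smul_right: "x \<in> W \<Longrightarrow> y \<in> W \<Longrightarrow> b y (smul c x) = sconj c * b y x"
  using b_conj[of "smul c x" y] b_conj[of x y] subspace_scale[OF subspace_W] by (simp add: b_smul_left)

lemma b_zero_left: "y \<in> W \<Longrightarrow> b 0 y = 0"
  using b_smul_left[of 0 y 0] subspace_0[OF subspace_W] by simp

lemma b_zero_right: "y \<in> W \<Longrightarrow> b y 0 = 0"
  using b_smul_right[of 0 y 0] subspace_0[OF subspace_W] by simp

lemma b_diff_left: "x \<in> W \<Longrightarrow> y \<in> W \<Longrightarrow> z \<in> W \<Longrightarrow> b (x - y) z = b x z - b y z"
  using b_add_left[of "x - y" y z] subspace_diff[OF subspace_W] by simp

lemma b_diff_right: "x \<in> W \<Longrightarrow> y \<in> W \<Longrightarrow> z \<in> W \<Longrightarrow> b z (x - y) = b z x - b z y"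
  using b_add_right[of "x - y" y z] subspace_diff[OF subspace_W] by simp

lemma b_sum_left:
  "(\<And>i. i \<in> I \<Longrightarrow> g i \<in> W) \<Longrightarrow> y \<in> W \<Longrightarrow> b (\<Sum>i\<in>I. smul (u i) (g i)) y = (\<Sum>i\<in>I. u i * b (g i) y)"
proof (induction I rule: infinite_finite_induct)
  case (insert i I)
  then show ?case
    by (simp add: b_add_left b_smul_left subspace_scale[OF subspace_W] subspace_sum[OF subspace_W])
qed (simp_all add: b_zero_left)

lemma b_sum_right:
  "(\<And>i. i \<in> I \<Longrightarrow> g i \<in> W) \<Longrightarrow> y \<in> W \<Longrightarrow> b y (\<Sum>i\<in>I. smul (u i) (g i)) = (\<Sum>i\<in>I. sconj (u i) * b y (g i))"
proof (induction I rule: infinite_finite_induct)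
  case (insert i I)
  then show ?case
    by (simp add: b_add_right b_smul_right subspace_scale[OF subspace_W] subspace_sum[OF subspace_W])
qed (simp_all add: b_zero_right)

lemma b_self: "x \<in> W \<Longrightarrow> b x x = of_real (real_part (b x x))"
  using b_conj[of x x] sconj_eq_self[of "b x x"] by simp

end

locale pos_form = herm_form smul W b
  for smul :: "'k::real_or_complex \<Rightarrow> 'h::ab_group_add \<Rightarrow> 'h" and W b +
  assumes pos: "x \<in> W \<Longrightarrow> x \<noteq> 0 \<Longrightarrow> 0 < real_part (b x x)"
begin

lemma b_self_nonneg: "x \<in> W \<Longrightarrow> 0 \<le> real_part (b x x)"
  using pos[of x] b_zero_left[of 0] subspace_0[OF subspace_W] by (cases "x = 0") auto

lemma cauchy_schwarz:
  assumes x: "x \<in> W" and y: "y \<in> W"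
  shows "(norm (b x y))\<^sup>2 \<le> real_part (b x x) * real_part (b y y)"
proof (cases "y = 0")
  case True then show ?thesis using x subspace_0[OF subspace_W] by (simp add: b_zero_right b_zero_left)
next
  case False
  define r where "r = real_part (b y y)"
  have r: "r > 0" "b y y = of_real r" using pos[OF y False] b_self[OF y] by (auto simp: r_def)
  define c where "c = b x y / of_real r"
  have xy: "b x y = c * of_real r" using r by (simp add: c_def)
  have yx: "b y x = sconj c * of_real r" unfolding b_conj[OF x y] xy by simp
  have cW: "smul c y \<in> W" using y subspace_scale[OF subspace_W] by blast
  have d: "x - smul c y \<in> W" using cW x subspace_diff[OF subspace_W] by blast
  have "b (x - smul c y) (x - smul c y) = b x x - sconj c * b x y - c * b y x + c * sconj c * b y y"
    using x y cW d by (simp add: b_diff_left b_diff_right b_smul_left b_smul_right algebra_simps)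
  also note yx
  also note xy
  also have "b x x - sconj c * (c * of_real r) - c * (sconj c * of_real r) + c * sconj c * b y y
      = b x x - of_real r * (c * sconj c)" by (simp add: r algebra_simps)
  finally have "real_part (b (x - smul c y) (x - smul c y)) = real_part (b x x) - r * (norm c)\<^sup>2"
    unfolding mult_sconj by (simp del: of_real_power)
  then have "r * (norm c)\<^sup>2 \<le> real_part (b x x)" using b_self_nonneg[OF d] by simp
  then have "r * r * (norm c)\<^sup>2 \<le> real_part (b x x) * r" using r by (simp add: mult.commute mult.left_commute)
  moreover have "(norm (b x y))\<^sup>2 = r * r * (norm c)\<^sup>2"
    using r by (simp add: c_def norm_divide power2_eq_square)
  ultimately show ?thesis by (simp add: r_def)
qed

definition orthonormal :: "'h set \<Rightarrow> bool"
  where "orthonormal U \<longleftrightarrow> (\<forall>e\<in>U. \<forall>f\<in>U. b e f = (if e = f then 1 else 0))"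

definition onb :: "'h set \<Rightarrow> 'h set \<Rightarrow> bool"
  where "onb V U \<longleftrightarrow> finite U \<and> U \<subseteq> V \<and> orthonormal U \<and> (\<forall>x\<in>V. x = (\<Sum>e\<in>U. smul (b x e) e))"

lemma orthonormal_coeff:
  assumes "orthonormal U" "finite U" "U \<subseteq> W" "f \<in> U"
  shows "b (\<Sum>e\<in>U. smul (u e) e) f = u f"
proof -
  have "b (\<Sum>e\<in>U. smul (u e) e) f = (\<Sum>e\<in>U. u e * b e f)" using assms by (intro b_sum_left) auto
  also have "\<dots> = (\<Sum>e\<in>U. if e = f then u e else 0)"
    using assms by (intro sum.cong) (auto simp: orthonormal_def)
  finally show ?thesis using assms by simp
qed

lemma orthonormal_independent:
  assumes "orthonormal U" "finite U" "U \<subseteq> W"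
  shows "independent U"
proof
  assume "dependent U"
  then obtain u v where v: "v \<in> U" "u v \<noteq> 0" and s: "(\<Sum>e\<in>U. smul (u e) e) = 0"
    using dependent_finite[OF assms(2)] by blast
  have "u v = b 0 v" using orthonormal_coeff[OF assms v(1), of u] s by simp
  then show False using v assms by (auto simp: b_zero_left)
qed

lemma residual_orthogonal:
  assumes "orthonormal U" "finite U" "U \<subseteq> W" "x \<in> W" "f \<in> U"
  shows "b (x - (\<Sum>e\<in>U. smul (b x e) e)) f = 0"
proof -
  have "(\<Sum>e\<in>U. smul (b x e) e) \<in> W"
    using assms by (intro subspace_sum[OF subspace_W] subspace_scale[OF subspace_W]) auto
  then show ?thesis using assms orthonormal_coeff[OF assms(1-3,5), of "b x"] by (subst b_diff_left) auto
qed

text \<open>An orthonormal subset with property \<open>P\<close> of maximal cardinality is a basis,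
  since \<open>ext\<close> would otherwise enlarge it; independence bounds the cardinality.
  \<open>P\<close> is trivial for plain bases and says "eigenvector" for the spectral
  theorem.\<close>

lemma onb_exists_with:
  assumes V: "subspace V" "V \<subseteq> span B" "finite B" "V \<subseteq> W"
    and ext: "\<And>U x. finite U \<Longrightarrow> U \<subseteq> V \<Longrightarrow> orthonormal U \<Longrightarrow> (\<And>e. e \<in> U \<Longrightarrow> P e) \<Longrightarrow> x \<in> V \<Longrightarrow> x \<noteq> 0 \<Longrightarrow>
      (\<And>e. e \<in> U \<Longrightarrow> b x e = 0) \<Longrightarrow> \<exists>e\<in>V. P e \<and> b e e = 1 \<and> (\<forall>f\<in>U. b e f = 0)"
  shows "\<exists>U. onb V U \<and> (\<forall>e\<in>U. P e)"
proof -
  define S where "S = {U. finite U \<and> U \<subseteq> V \<and> orthonormal U \<and> (\<forall>e\<in>U. P e)}"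
  have bound: "card U \<le> card B" if "U \<in> S" for U
    using that independent_span_bound[OF V(3), of U] orthonormal_independent[of U] V unfolding S_def by blast
  have "{} \<in> S" by (simp add: S_def orthonormal_def)
  then obtain U where U: "U \<in> S" "\<And>U'. U' \<in> S \<Longrightarrow> card U' \<le> card U"
    using ex_has_greatest_nat[of "\<lambda>U. U \<in> S" "{}" card "card B + 1"] bound by (metis less_Suc_eq_le Suc_eq_plus1)
  then have fin: "finite U" and OV: "U \<subseteq> V" and on: "orthonormal U" and P: "\<And>e. e \<in> U \<Longrightarrow> P e"
    by (auto simp: S_def)
  have OW: "U \<subseteq> W" using OV V(4) by blast
  have "x = (\<Sum>e\<in>U. smul (b x e) e)" if x: "x \<in> V" for x
  proof (rule ccontr)
    define y where "y = x - (\<Sum>e\<in>U. smul (b x e) e)"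
    assume "x \<noteq> (\<Sum>e\<in>U. smul (b x e) e)"
    then have "y \<noteq> 0" by (simp add: y_def)
    moreover have "y \<in> V" unfolding y_def
      using x OV by (intro subspace_diff[OF V(1)] subspace_sum[OF V(1)] subspace_scale[OF V(1)]) auto
    moreover have "b y e = 0" if "e \<in> U" for e
      unfolding y_def using that x V(4) by (intro residual_orthogonal[OF on fin OW]) auto
    ultimately obtain e where e: "e \<in> V" "P e" "b e e = 1" "\<forall>f\<in>U. b e f = 0"
      using ext[OF fin OV on P, of y] by blast
    have "e \<notin> U" using e by auto
    have "b f e = 0" if "f \<in> U" for f
      using b_conj[of e f] e that V(4) OW by auto
    then have "insert e U \<in> S" using e fin OV on P unfolding S_def orthonormal_def by auto
    then have "card (insert e U) \<le> card U" by (rule U(2))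
    then show False using fin \<open>e \<notin> U\<close> by simp
  qed
  then show ?thesis using fin OV on P unfolding onb_def by blast
qed

lemma onb_exists:
  assumes V: "subspace V" "V \<subseteq> span B" "finite B" "V \<subseteq> W"
  shows "\<exists>U. onb V U"
proof -
  have "\<exists>U. onb V U \<and> (\<forall>e\<in>U. True)"
  proof (rule onb_exists_with[OF V])
    fix U x assume x: "x \<in> V" "x \<noteq> 0" "\<And>e. e \<in> U \<Longrightarrow> b x e = 0" and U: "U \<subseteq> V"
    define r where "r = real_part (b x x)"
    have r: "r > 0" "b x x = of_real r" using x V pos[of x] b_self[of x] by (auto simp: r_def)
    define k where "k = 1 / sqrt r"
    have k: "k * (k * r) = 1" using r by (simp add: k_def)
    define e where "e = smul (of_real k) x"
    have "e \<in> V" unfolding e_def using x subspace_scale[OF V(1)] by blast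
    moreover have "b e e = of_real (k * (k * r))"
      using x V(4) subspace_scale[OF subspace_W] r(2) unfolding e_def by (simp add: b_smul_left b_smul_right subset_iff)
    then have "b e e = 1" unfolding k by simp
    moreover have "\<forall>f\<in>U. b e f = 0" using x U V(4) unfolding e_def by (auto simp: b_smul_left subset_iff)
    ultimately show "\<exists>e\<in>V. True \<and> b e e = 1 \<and> (\<forall>f\<in>U. b e f = 0)" by blast
  qed
  then show ?thesis by blast
qed

lemma onbD:
  assumes "onb V U"
  shows "finite U" "U \<subseteq> V" "orthonormal U" "x \<in> V \<Longrightarrow> (\<Sum>e\<in>U. smul (b x e) e) = x"
  using assms unfolding onb_def by auto

lemma eqI_orthogonal:
  assumes "subspace V" "V \<subseteq> W" "x \<in> V" "y \<in> V" "\<And>v. v \<in> V \<Longrightarrow> b x v = b y v"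
  shows "x = y"
proof (rule ccontr)
  assume "x \<noteq> y"
  have "x - y \<in> V" using assms subspace_diff by blast
  then have "b (x - y) (x - y) = 0" using assms by (subst b_diff_left) auto
  then show False using pos[of "x - y"] \<open>x \<noteq> y\<close> \<open>x - y \<in> V\<close> assms by auto
qed

lemma orthogonal_onb:
  assumes "onb V U" "V \<subseteq> W" "x \<in> W" "\<And>e. e \<in> U \<Longrightarrow> b x e = 0" "v \<in> V"
  shows "b x v = 0"
proof -
  have OW: "U \<subseteq> W" using onbD(2)[OF assms(1)] assms(2) by blast
  have "b x v = b x (\<Sum>e\<in>U. smul (b v e) e)" using onbD(4)[OF assms(1,5)] by simp
  also have "\<dots> = 0" using assms(3,4) OW by (subst b_sum_right) auto
  finally show ?thesis .
qed

lemma orth_proj_onb: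
  assumes U: "onb V U" and V: "subspace V" "V \<subseteq> W" and x: "x \<in> W"
  shows "orth_proj b V x = (\<Sum>e\<in>U. smul (b x e) e)"
  unfolding orth_proj_def
proof (rule the_equality)
  let ?p = "\<Sum>e\<in>U. smul (b x e) e"
  have OW: "U \<subseteq> W" using onbD(2)[OF U] V by blast
  have pV: "?p \<in> V" using onbD(2)[OF U] by (intro subspace_sum[OF V(1)] subspace_scale[OF V(1)]) auto
  have pW: "x - ?p \<in> W" using pV V x subspace_diff[OF subspace_W] by blast
  have orth: "\<And>v. v \<in> V \<Longrightarrow> b (x - ?p) v = 0"
    by (rule orthogonal_onb[OF U V(2) pW])
      (use residual_orthogonal[OF onbD(3,1)[OF U] OW x] in auto)
  then show "?p \<in> V \<and> (\<forall>v\<in>V. b (x - ?p) v = 0)" using pV by blast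
  fix y assume y: "y \<in> V \<and> (\<forall>v\<in>V. b (x - y) v = 0)"
  show "y = ?p"
  proof (rule eqI_orthogonal[OF V _ pV])
    fix v assume v: "v \<in> V"
    have "b x v - b y v = 0" using y v x V by (subst b_diff_left[symmetric]) auto
    moreover have "b x v - b ?p v = 0" using orth[OF v] v x V pV by (subst b_diff_left[symmetric]) auto
    ultimately show "b y v = b ?p v" by simp
  qed (use y in blast)
qed

lemma orth_proj:
  assumes V: "finite_dim_subspace smul V" "V \<subseteq> W" and x: "x \<in> W"
  shows orth_proj_in: "orth_proj b V x \<in> V"
    and orth_proj_orthogonal: "v \<in> V \<Longrightarrow> b (x - orth_proj b V x) v = 0"
    and orth_proj_id: "x \<in> V \<Longrightarrow> orth_proj b V x = x"
    and orth_proj_pythagoras: "real_part (b x x) =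
      real_part (b (orth_proj b V x) (orth_proj b V x)) + real_part (b (x - orth_proj b V x) (x - orth_proj b V x))"
    and orth_proj_add: "y \<in> W \<Longrightarrow> orth_proj b V (x + y) = orth_proj b V x + orth_proj b V y"
    and orth_proj_smul: "orth_proj b V (smul c x) = smul c (orth_proj b V x)"
proof -
  obtain B where B: "finite B" "V = span B" using V(1) unfolding finite_dim_subspace_def by blast
  then have sV: "subspace V" by simp
  obtain U where U: "onb V U" using onb_exists[OF sV _ B(1) V(2)] B by blast
  note p = orth_proj_onb[OF U sV V(2)]
  have OV: "U \<subseteq> V" by (rule onbD(2)[OF U])
  then have OW: "U \<subseteq> W" using V by blast
  show in': "orth_proj b V x \<in> V"
    unfolding p[OF x] using OV by (intro subspace_sum[OF sV] subspace_scale[OF sV]) auto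
  have dW: "x - orth_proj b V x \<in> W" using in' V x subspace_diff[OF subspace_W] by blast
  show orth: "b (x - orth_proj b V x) v = 0" if "v \<in> V" for v
    by (rule orthogonal_onb[OF U V(2) dW _ that])
      (use residual_orthogonal[OF onbD(3,1)[OF U] OW x] p[OF x] in auto)
  show "orth_proj b V x = x" if "x \<in> V" unfolding p[OF x] by (rule onbD(4)[OF U that])
  let ?p = "orth_proj b V x"
  have pW: "?p \<in> W" using in' V by blast
  have "b (y + d) (y + d) = b y y + b y d + b d y + b d d" if "y \<in> W" "d \<in> W" for y d
    using that subspace_add[OF subspace_W] by (simp add: b_add_left b_add_right)
  from this[OF pW dW]
  have "b x x = b ?p ?p + b ?p (x - ?p) + b (x - ?p) ?p + b (x - ?p) (x - ?p)" by simp
  also have "b (x - ?p) ?p = 0" using orth[OF in'] .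
  also have "b ?p (x - ?p) = 0" using b_conj[OF dW pW] orth[OF in'] by simp
  finally show "real_part (b x x) = real_part (b ?p ?p) + real_part (b (x - ?p) (x - ?p))" by simp
  show "orth_proj b V (x + y) = orth_proj b V x + orth_proj b V y" if y: "y \<in> W"
    using x y OW subspace_add[OF subspace_W x y]
    by (simp add: p sum.distrib[symmetric] scale_left_distrib[symmetric] b_add_left subset_iff cong: sum.cong)
  show "orth_proj b V (smul c x) = smul c (orth_proj b V x)"
    using x OW subspace_scale[OF subspace_W x]
    by (simp add: p scale_sum_right b_smul_left subset_iff cong: sum.cong)
qed

end

section \<open>Spectral theorem in finite dimension\<close>

context hilbert_space
begin

lemma pos_form_m: "pos_form smul UNIV m"
  by standard (auto simp: hermitian_form_m m_self simp del: of_real_power)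

sublocale mf: pos_form smul UNIV m
  by (rule pos_form_m)

definition lin_on :: "'h set \<Rightarrow> ('h \<Rightarrow> 'h) \<Rightarrow> bool"
  where "lin_on V T \<longleftrightarrow> (\<forall>x\<in>V. T x \<in> V) \<and> (\<forall>x\<in>V. \<forall>y\<in>V. T (x + y) = T x + T y) \<and>
    (\<forall>c. \<forall>x\<in>V. T (smul c x) = smul c (T x))"

definition symm_on :: "'h set \<Rightarrow> ('h \<Rightarrow> 'h) \<Rightarrow> bool"
  where "symm_on V T \<longleftrightarrow> lin_on V T \<and> (\<forall>x\<in>V. \<forall>y\<in>V. m (T x) y = m x (T y))"

lemma lin_onD:
  assumes "lin_on V T"
  shows "x \<in> V \<Longrightarrow> T x \<in> V" "x \<in> V \<Longrightarrow> y \<in> V \<Longrightarrow> T (x + y) = T x + T y" "x \<in> V \<Longrightarrow> T (smul c x) = smul c (T x)"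
  using assms unfolding lin_on_def by auto

lemma symm_onD:
  assumes "symm_on V T"
  shows "lin_on V T" "x \<in> V \<Longrightarrow> y \<in> V \<Longrightarrow> m (T x) y = m x (T y)"
  using assms unfolding symm_on_def by auto

lemma lin_on_diff: "lin_on V T \<Longrightarrow> subspace V \<Longrightarrow> x \<in> V \<Longrightarrow> y \<in> V \<Longrightarrow> T (x - y) = T x - T y"
  using lin_onD(2)[of V T "x - y" y] subspace_diff by simp

lemma lin_on_sum:
  assumes T: "lin_on V T" and V: "subspace V"
  shows "(\<And>i. i \<in> I \<Longrightarrow> g i \<in> V) \<Longrightarrow> T (\<Sum>i\<in>I. smul (u i) (g i)) = (\<Sum>i\<in>I. smul (u i) (T (g i)))"
proof (induction I rule: infinite_finite_induct)
  case (insert i I)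
  have "smul (u i) (g i) \<in> V" "(\<Sum>i\<in>I. smul (u i) (g i)) \<in> V"
    using insert.prems by (auto intro!: subspace_scale[OF V] subspace_sum[OF V])
  then show ?case using insert by (simp add: lin_onD[OF T])
qed (use lin_onD(3)[OF T subspace_0[OF V], of 0] in simp_all)

lemma onb_norm:
  assumes "mf.onb V U" "e \<in> U" shows "norm e = 1"
proof -
  have "m e e = 1" using assms mf.onbD(3) by (auto simp: mf.orthonormal_def)
  then have "(of_real ((norm e)\<^sup>2) :: 'k) = of_real 1" unfolding m_self by simp
  then have "(norm e)\<^sup>2 = 1\<^sup>2" unfolding of_real_eq_iff by simp
  then show ?thesis by (rule power2_eq_imp_eq) auto
qed

lemma lin_on_bounded:
  assumes T: "lin_on V T" and V: "subspace V" and U: "mf.onb V U" and x: "x \<in> V"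
  shows "norm (T x) \<le> (\<Sum>e\<in>U. norm (T e)) * norm x"
proof -
  note e1 = onb_norm[OF U]
  have "T x = T (\<Sum>e\<in>U. smul (m x e) e)" using mf.onbD(4)[OF U x] by simp
  also have "\<dots> = (\<Sum>e\<in>U. smul (m x e) (T e))"
    using mf.onbD(2)[OF U] by (intro lin_on_sum[OF T V]) auto
  also have "norm \<dots> \<le> (\<Sum>e\<in>U. norm (T e) * norm x)"
  proof (rule order_trans[OF norm_sum], rule sum_mono)
    fix e assume "e \<in> U"
    then show "norm (smul (m x e) (T e)) \<le> norm (T e) * norm x"
      using mult_right_mono[OF norm_m_le[of x e], of "norm (T e)"] by (simp add: norm_smul e1 mult.commute)
  qed
  finally show ?thesis by (simp add: sum_distrib_right)
qed

lemma lin_on_scaleR: "lin_on V T \<Longrightarrow> x \<in> V \<Longrightarrow> T (r *\<^sub>R x) = r *\<^sub>R T x"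
  using lin_onD(3)[of V T x "of_real r"] by (simp add: smul_of_real)

lemma subspace_scaleR: "subspace V \<Longrightarrow> x \<in> V \<Longrightarrow> r *\<^sub>R x \<in> V"
  using subspace_scale[of V x "of_real r"] by (simp add: smul_of_real)

text \<open>The supremum \<open>l\<close> of the Rayleigh quotient is an eigenvalue: otherwise \<open>l - T\<close> is injective, hence
  (by symmetry) onto and bounded below, and as \<open>\<parallel>(l - T) x\<parallel>\<^sup>2 \<le> L \<langle>(l - T) x, x\<rangle>\<close> the supremum would
  not be approached.\<close>

lemma symmetric_eigenvector_exists:
  assumes T: "symm_on V T" and V: "subspace V" "V \<subseteq> span B" "finite B" and x0: "x0 \<in> V" "x0 \<noteq> 0"
  shows "\<exists>e\<in>V. norm e = 1 \<and> (\<exists>t. T e = smul (of_real t) e)"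
proof -
  note Tl = symm_onD(1)[OF T] and Ts = symm_onD(2)[OF T]
  obtain U where U: "mf.onb V U" using mf.onb_exists[OF V] by auto
  define K where "K = (\<Sum>e\<in>U. norm (T e))"
  have K: "norm (T x) \<le> K * norm x" if "x \<in> V" for x
    unfolding K_def by (rule lin_on_bounded[OF Tl V(1) U that])
  have K0: "0 \<le> K" by (simp add: K_def sum_nonneg)
  define R where "R = (\<lambda>x. inner (T x) x) ` {x \<in> V. norm x = 1}"
  define l where "l = Sup R"
  have "R \<noteq> {}"
  proof -
    have "(1 / norm x0) *\<^sub>R x0 \<in> {x \<in> V. norm x = 1}" using x0 subspace_scaleR[OF V(1)] by simp
    then show ?thesis unfolding R_def by blast
  qed
  have "r \<le> K" if rR: "r \<in> R" for r
  proof -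
    obtain x where x: "x \<in> V" "norm x = 1" "r = inner (T x) x" using rR R_def by blast
    then show ?thesis using norm_cauchy_schwarz[of "T x" x] K[OF x(1)] by simp
  qed
  then have bdd: "bdd_above R" by (rule bdd_aboveI)
  define S where "S x = l *\<^sub>R x - T x" for x
  have Sl: "lin_on V S"
    unfolding lin_on_def
  proof (intro conjI ballI allI)
    show "S x \<in> V" if "x \<in> V" for x
      unfolding S_def using that subspace_scaleR[OF V(1)] lin_onD(1)[OF Tl] subspace_diff[OF V(1)] by blast
    show "S (x + y) = S x + S y" if "x \<in> V" "y \<in> V" for x y
      unfolding S_def by (simp add: lin_onD(2)[OF Tl that] algebra_simps)
    show "S (smul c x) = smul c (S x)" if "x \<in> V" for c x
      unfolding S_def smul_of_real[symmetric]
      by (simp add: lin_onD(3)[OF Tl that] scale_left_commute scale_right_diff_distrib)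
  qed
  have Ss: "m (S x) y = m x (S y)" if "x \<in> V" "y \<in> V" for x y
    unfolding S_def smul_of_real[symmetric] by (simp add: m_diff_left m_diff_right m_smul_left m_smul_right Ts[OF that])
  have Spos: "0 \<le> inner (S x) x" if x: "x \<in> V" for x
  proof (cases "x = 0")
    case False
    let ?y = "(1 / norm x) *\<^sub>R x"
    have "inner (T ?y) ?y \<in> R" unfolding R_def by (rule imageI) (use x False subspace_scaleR[OF V(1)] in simp)
    then have "inner (T ?y) ?y \<le> l" unfolding l_def by (rule cSup_upper[OF _ bdd])
    then have "inner (T x) x / (norm x)\<^sup>2 \<le> l"
      by (simp add: lin_on_scaleR[OF Tl x] power2_eq_square)
    then have "inner (T x) x \<le> l * (norm x)\<^sup>2" using False by (simp add: field_simps)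
    then show ?thesis by (simp add: S_def inner_diff_left power2_norm_eq_inner)
  qed simp
  have "\<exists>x\<in>V. x \<noteq> 0 \<and> S x = 0"
  proof (rule ccontr)
    assume "\<not> (\<exists>x\<in>V. x \<noteq> 0 \<and> S x = 0)"
    then have inj: "\<And>x. x \<in> V \<Longrightarrow> S x = 0 \<Longrightarrow> x = 0" by blast
    have sub: "subspace (S ` V)"
    proof (rule subspaceI)
      show "0 \<in> S ` V" using lin_onD(3)[OF Sl subspace_0[OF V(1)], of 0] subspace_0[OF V(1)] by (metis image_eqI scale_zero_left)
      show "u + v \<in> S ` V" if "u \<in> S ` V" "v \<in> S ` V" for u v
        using that lin_onD(2)[OF Sl] subspace_add[OF V(1)] by (metis (no_types, lifting) imageE image_eqI)
      show "smul c u \<in> S ` V" if "u \<in> S ` V" for c u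
        using that lin_onD(3)[OF Sl] subspace_scale[OF V(1)] by (metis (no_types, lifting) imageE image_eqI)
    qed
    have SV: "S ` V \<subseteq> V" using lin_onD(1)[OF Sl] by blast
    then obtain U' where U': "mf.onb (S ` V) U'" using mf.onb_exists[OF sub _ V(3)] V(2) by auto
    have onto: "x \<in> S ` V" if x: "x \<in> V" for x
    proof -
      define p where "p = (\<Sum>e\<in>U'. smul (m x e) e)"
      have pS: "p \<in> S ` V" unfolding p_def
        using mf.onbD(2)[OF U'] by (intro subspace_sum[OF sub] subspace_scale[OF sub]) auto
      then have zV: "x - p \<in> V" using SV x subspace_diff[OF V(1)] by blast
      have orth: "m (x - p) v = 0" if "v \<in> S ` V" for v
        by (rule mf.orthogonal_onb[OF U' _ _ _ that])
          (auto simp: p_def intro!: mf.residual_orthogonal[OF mf.onbD(3,1)[OF U']])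
      have "m (S (x - p)) (S (x - p)) = 0"
        using Ss[OF zV lin_onD(1)[OF Sl zV]] orth lin_onD(1)[OF Sl zV] by simp
      then have "S (x - p) = 0" using mf.pos[of "S (x - p)"] by auto
      then show ?thesis using inj[OF zV] pS by simp
    qed
    have "\<exists>f. \<forall>e\<in>U. f e \<in> V \<and> S (f e) = e"
      using onto mf.onbD(2)[OF U] by (intro bchoice) blast
    then obtain f where f: "\<And>e. e \<in> U \<Longrightarrow> f e \<in> V" "\<And>e. e \<in> U \<Longrightarrow> S (f e) = e" by blast
    define G where "G y = (\<Sum>e\<in>U. smul (m y e) (f e))" for y
    define k where "k = (\<Sum>e\<in>U. norm (f e)) + 1"
    note e1 = onb_norm[OF U]
    have k1: "k \<ge> 1" by (simp add: k_def sum_nonneg)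
    have low: "norm x \<le> k * norm (S x)" if x: "x \<in> V" for x
    proof -
      have GV: "G (S x) \<in> V" unfolding G_def using f(1) by (intro subspace_sum[OF V(1)] subspace_scale[OF V(1)])
      have "S (G (S x)) = (\<Sum>e\<in>U. smul (m (S x) e) (S (f e)))" unfolding G_def by (rule lin_on_sum[OF Sl V(1) f(1)])
      also have "\<dots> = S x" using mf.onbD(4)[OF U lin_onD(1)[OF Sl x]] f(2) by simp
      finally have "S (x - G (S x)) = 0" by (simp add: lin_on_diff[OF Sl V(1) x GV])
      then have "x - G (S x) = 0" by (rule inj[OF subspace_diff[OF V(1) x GV]])
      then have "x = G (S x)" by simp
      moreover have "norm (G (S x)) \<le> (\<Sum>e\<in>U. norm (f e) * norm (S x))"
        unfolding G_def
      proof (rule order_trans[OF norm_sum], rule sum_mono)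
        fix e assume "e \<in> U"
        then show "norm (smul (m (S x) e) (f e)) \<le> norm (f e) * norm (S x)"
          using mult_right_mono[OF norm_m_le[of "S x" e], of "norm (f e)"] by (simp add: norm_smul e1 mult.commute)
      qed
      ultimately have "norm x \<le> (\<Sum>e\<in>U. norm (f e)) * norm (S x)" by (simp add: sum_distrib_right)
      then show ?thesis by (simp add: k_def distrib_right add_increasing2)
    qed
    define L where "L = \<bar>l\<bar> + K + 1"
    have L: "L \<ge> 1" using K0 by (simp add: L_def)
    have Lb: "norm (S x) \<le> L * norm x" if "x \<in> V" for x
    proof -
      have "norm (S x) \<le> \<bar>l\<bar> * norm x + K * norm x"
        unfolding S_def using norm_triangle_ineq4[of "l *\<^sub>R x" "T x"] K[OF that] by simp
      then show ?thesis by (simp add: L_def distrib_right add_increasing2)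
    qed
    have cs: "(norm (S x))\<^sup>2 \<le> L * inner (S x) x" if x: "x \<in> V" for x
    proof -
      \<comment> \<open>The value \<open>- 1 / L\<close> minimizes the quadratic polynomial that
        arises when \<open>inner (S ?y) ?y\<close> is replaced by its bound
        \<open>L * (norm ?y)^2\<close>.\<close>
      let ?y = "S x" and ?t = "- 1 / L"
      have yV: "?y \<in> V" by (rule lin_onD(1)[OF Sl x])
      have Si: "inner (S ?y) x = inner ?y ?y"
        using Ss[OF yV x] real_part_m by metis
      have SSy: "inner (S ?y) ?y \<le> L * (norm ?y)\<^sup>2"
      proof -
        have "inner (S ?y) ?y \<le> norm (S ?y) * norm ?y" by (rule norm_cauchy_schwarz)
        also have "\<dots> \<le> (L * norm ?y) * norm ?y" by (intro mult_right_mono Lb[OF yV]) simp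
        finally show ?thesis by (simp add: power2_eq_square)
      qed
      have expand: "inner (S (x + t *\<^sub>R ?y)) (x + t *\<^sub>R ?y)
          = inner ?y x + 2 * t * inner ?y ?y + t\<^sup>2 * inner (S ?y) ?y" for t
        using x yV subspace_scaleR[OF V(1) yV]
        by (simp add: lin_onD(2)[OF Sl] lin_on_scaleR[OF Sl] inner_add_left inner_add_right Si power2_eq_square algebra_simps)
      have "0 \<le> inner (S (x + ?t *\<^sub>R ?y)) (x + ?t *\<^sub>R ?y)"
        by (intro Spos subspace_add[OF V(1)] x subspace_scaleR[OF V(1)] yV)
      also have "\<dots> = inner ?y x + 2 * ?t * inner ?y ?y + ?t\<^sup>2 * inner (S ?y) ?y"
        by (rule expand)
      also have "?t\<^sup>2 * inner (S ?y) ?y \<le> ?t\<^sup>2 * (L * (norm ?y)\<^sup>2)" by (intro mult_left_mono SSy) simp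
      also have "?t\<^sup>2 * (L * (norm ?y)\<^sup>2) = (norm ?y)\<^sup>2 / L" using L by (simp add: power2_eq_square)
      finally have "0 \<le> inner ?y x - (norm ?y)\<^sup>2 / L" by (simp add: power2_norm_eq_inner)
      then show ?thesis using L by (simp add: field_simps)
    qed
    \<comment> \<open>A unit vector with Rayleigh quotient \<open>r\<close> satisfies
      \<open>1 <= k^2 * (norm (S x))^2 <= k^2 * L * (l - r)\<close>, so every quotient stays below
      the supremum by at least \<open>d\<close>.\<close>
    define d where "d = 1 / (k\<^sup>2 * L)"
    have kL: "k\<^sup>2 * L > 0" using k1 L by simp
    have "r \<le> l - d" if rR: "r \<in> R" for r
    proof -
      obtain x where x: "x \<in> V" "norm x = 1" "r = inner (T x) x" using rR R_def by blast
      have "1 \<le> (k * norm (S x))\<^sup>2" using low[OF x(1)] x(2) by simp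
      also have "\<dots> \<le> k\<^sup>2 * (L * inner (S x) x)" unfolding power_mult_distrib by (intro mult_left_mono cs[OF x(1)]) simp
      also have "inner (S x) x = l - r" using x by (simp add: S_def inner_diff_left power2_norm_eq_inner[symmetric])
      finally have "1 \<le> (k\<^sup>2 * L) * (l - r)" by simp
      then have "d \<le> l - r" unfolding d_def pos_divide_le_eq[OF kL] by (simp add: mult.commute)
      then show ?thesis by simp
    qed
    then have "l \<le> l - d" unfolding l_def by (intro cSup_least \<open>R \<noteq> {}\<close>) (simp add: l_def)
    then show False using kL by (simp add: d_def)
  qed
  then obtain x where x: "x \<in> V" "x \<noteq> 0" "S x = 0" by blast
  let ?e = "(1 / norm x) *\<^sub>R x"
  have "T x = l *\<^sub>R x" using x(3) by (simp add: S_def)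
  then have "T ?e = smul (of_real l) ?e" by (simp add: lin_on_scaleR[OF Tl x(1)] smul_of_real)
  moreover have "?e \<in> V" "norm ?e = 1" using x subspace_scaleR[OF V(1)] by auto
  ultimately show ?thesis by blast
qed

definition eigenbasis :: "'h set \<Rightarrow> ('h \<Rightarrow> 'h) \<Rightarrow> 'h set \<Rightarrow> ('h \<Rightarrow> real) \<Rightarrow> bool"
  where "eigenbasis V T U t \<longleftrightarrow> mf.onb V U \<and> (\<forall>e\<in>U. T e = smul (of_real (t e)) e)"

text \<open>The orthogonal complement of the eigenvectors found so far is invariant by symmetry, so
  it contains a further eigenvector unless it is zero.\<close>

lemma eigenbasis_exists:
  assumes T: "symm_on V T" and fd: "finite_dim_subspace smul V"
  shows "\<exists>U t. eigenbasis V T U t"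
proof -
  obtain B where B: "finite B" "V = span B" using fd unfolding finite_dim_subspace_def by blast
  then have V: "subspace V" "V \<subseteq> span B" "finite B" "V \<subseteq> UNIV" by auto
  note Tl = symm_onD(1)[OF T] and Ts = symm_onD(2)[OF T]
  have "\<exists>U. mf.onb V U \<and> (\<forall>e\<in>U. \<exists>t. T e = smul (of_real t) e)"
  proof (rule mf.onb_exists_with[OF V])
    fix U x
    assume U: "U \<subseteq> V" "\<And>e. e \<in> U \<Longrightarrow> \<exists>t. T e = smul (of_real t) e" and x: "x \<in> V" "x \<noteq> 0" "\<And>e. e \<in> U \<Longrightarrow> m x e = 0"
    define V' where "V' = {y \<in> V. \<forall>e\<in>U. m y e = 0}"
    have V': "subspace V'"
      by (rule subspaceI) (auto simp: V'_def m_add_left m_smul_left subspace_0[OF V(1)] subspace_add[OF V(1)] subspace_scale[OF V(1)])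
    have "T y \<in> V'" if y: "y \<in> V'" for y
    proof -
      have "m (T y) e = 0" if e: "e \<in> U" for e
      proof -
        obtain t where "T e = smul (of_real t) e" using U(2)[OF e] by blast
        moreover have "m (T y) e = m y (T e)" using y e U(1) by (intro Ts) (auto simp: V'_def)
        ultimately show ?thesis using y e by (simp add: m_smul_right V'_def)
      qed
      then show ?thesis using y lin_onD(1)[OF Tl] by (auto simp: V'_def)
    qed
    then have "symm_on V' T" using T unfolding symm_on_def lin_on_def V'_def by auto
    moreover have "x \<in> V'" using x by (simp add: V'_def)
    ultimately obtain e t where e: "e \<in> V'" "norm e = 1" "T e = smul (of_real t) e"
      using symmetric_eigenvector_exists[OF _ V' _ V(3), of T x] V(2) x(2) unfolding V'_def by blast
    then show "\<exists>e\<in>V. (\<exists>t. T e = smul (of_real t) e) \<and> m e e = 1 \<and> (\<forall>f\<in>U. m e f = 0)"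
      by (intro bexI[of _ e]) (auto simp: V'_def m_self)
  qed
  then obtain U where U: "mf.onb V U" "\<forall>e\<in>U. \<exists>t. T e = smul (of_real t) e" by blast
  then obtain t where "\<forall>e\<in>U. T e = smul (of_real (t e)) e" using bchoice by metis
  then show ?thesis using U(1) unfolding eigenbasis_def by blast
qed

lemma eigenbasisD:
  assumes "eigenbasis V T U t"
  shows "mf.onb V U" "finite U" "U \<subseteq> V" "mf.orthonormal U" "e \<in> U \<Longrightarrow> T e = smul (of_real (t e)) e"
    "x \<in> V \<Longrightarrow> (\<Sum>e\<in>U. smul (m x e) e) = x"
  using assms mf.onbD[of V U] unfolding eigenbasis_def by auto

lemma eigenbasis_coeff:
  assumes "eigenbasis V T U t" "symm_on V T" "x \<in> V" "e \<in> U"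
  shows "m (T x) e = of_real (t e) * m x e"
proof -
  have "m (T x) e = m x (T e)" using assms(4) eigenbasisD(3)[OF assms(1)] by (intro symm_onD(2)[OF assms(2,3)]) auto
  then show ?thesis by (simp add: eigenbasisD(5)[OF assms(1,4)] m_smul_right)
qed

lemma eigenspace_onb:
  assumes E: "eigenbasis V T U t" and T: "symm_on V T" and V: "subspace V"
  shows "subspace (eigenspace smul V T (of_real s))"
    and "mf.onb (eigenspace smul V T (of_real s)) {e \<in> U. t e = s}"
proof -
  note Tl = symm_onD(1)[OF T]
  let ?E = "eigenspace smul V T (of_real s)"
  show "subspace ?E"
  proof (rule subspaceI)
    show "0 \<in> ?E" using lin_onD(3)[OF Tl subspace_0[OF V], of 0] subspace_0[OF V] by (simp add: eigenspace_def)
    show "x + y \<in> ?E" if "x \<in> ?E" "y \<in> ?E" for x y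
      using that lin_onD(2)[OF Tl] subspace_add[OF V] by (simp add: eigenspace_def scale_right_distrib)
    show "smul c x \<in> ?E" if "x \<in> ?E" for c x
      using that lin_onD(3)[OF Tl] subspace_scale[OF V] by (simp add: eigenspace_def mult.commute)
  qed
  have "x = (\<Sum>e\<in>{e \<in> U. t e = s}. smul (m x e) e)" if x: "x \<in> ?E" for x
  proof -
    have xV: "x \<in> V" and Tx: "T x = smul (of_real s) x" using x by (auto simp: eigenspace_def)
    have "m x e = 0" if e: "e \<in> U" "t e \<noteq> s" for e
    proof -
      have "of_real s * m x e = of_real (t e) * m x e"
        using eigenbasis_coeff[OF E T xV e(1)] by (simp add: Tx m_smul_left)
      then show ?thesis using e(2) by simp
    qed
    then have "(\<Sum>e\<in>U. smul (m x e) e) = (\<Sum>e\<in>{e \<in> U. t e = s}. smul (m x e) e)"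
      using eigenbasisD(2)[OF E] by (intro sum.mono_neutral_right) auto
    then show ?thesis using eigenbasisD(6)[OF E xV] by simp
  qed
  then show "mf.onb ?E {e \<in> U. t e = s}"
    using eigenbasisD[OF E] unfolding mf.onb_def mf.orthonormal_def eigenspace_def by auto
qed

text \<open>The eigenvalues are exactly the values of \<open>t\<close> on \<open>U\<close>, a finite
  set, so the sum over eigenvalues is a genuine one; regrouping it by the fibres of \<open>t\<close>
  makes the functional calculus diagonal in one basis.\<close>

lemma fun_calc_eq:
  assumes E: "eigenbasis V T U t" and T: "symm_on V T" and V: "subspace V"
  shows "fun_calc smul m V f T x = (\<Sum>e\<in>U. smul (of_real (f (t e)) * m x e) e)"
proof -
  let ?E = "\<lambda>s. eigenspace smul V T (of_real s)"
  note Eo = eigenspace_onb[OF E T V]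
  have fin: "finite U" by (rule eigenbasisD(2)[OF E])
  have nz: "?E s \<noteq> {0} \<longleftrightarrow> s \<in> t ` U" for s
  proof
    assume "?E s \<noteq> {0}"
    then obtain x where x: "x \<in> ?E s" "x \<noteq> 0" using subspace_0[OF Eo(1)] by blast
    show "s \<in> t ` U"
    proof (rule ccontr)
      assume "s \<notin> t ` U"
      then have emp: "{e \<in> U. t e = s} = {}" by auto
      have "0 = x" using mf.onbD(4)[OF Eo(2)[of s] x(1)] unfolding emp sum.empty .
      then show False using x(2) by blast
    qed
  next
    assume "s \<in> t ` U"
    then obtain e where e: "e \<in> U" "t e = s" by blast
    then have "e \<in> ?E s" using mf.onbD(2)[OF Eo(2)[of s]] by auto
    moreover have "e \<noteq> 0" using onb_norm[OF eigenbasisD(1)[OF E] e(1)] by auto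
    ultimately show "?E s \<noteq> {0}" by blast
  qed
  have set: "{s. ?E s \<noteq> {0}} = t ` U" by (simp only: nz Collect_mem_eq)
  have "fun_calc smul m V f T x = (\<Sum>s\<in>t ` U. smul (of_real (f s)) (orth_proj m (?E s) x))"
    unfolding fun_calc_def set ..
  also have "\<dots> = (\<Sum>s\<in>t ` U. \<Sum>e\<in>{e \<in> U. t e = s}. smul (of_real (f (t e)) * m x e) e)"
  proof (rule sum.cong[OF refl])
    fix s
    have "orth_proj m (?E s) x = (\<Sum>e\<in>{e \<in> U. t e = s}. smul (m x e) e)"
      by (rule mf.orth_proj_onb[OF Eo(2,1)]) auto
    then show "smul (of_real (f s)) (orth_proj m (?E s) x) = (\<Sum>e\<in>{e \<in> U. t e = s}. smul (of_real (f (t e)) * m x e) e)"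
      by (auto simp: scale_sum_right intro!: sum.cong)
  qed
  also have "\<dots> = (\<Sum>e\<in>U. smul (of_real (f (t e)) * m x e) e)"
    by (rule sum.image_gen[OF fin, symmetric])
  finally show ?thesis .
qed

lemma spectrum_eq:
  assumes E: "eigenbasis V T U t" and T: "symm_on V T" and V: "subspace V"
  shows "spectrum smul V V T = (\<lambda>e. complex_of_real (t e)) ` U"
proof -
  note Tl = symm_onD(1)[OF T] and UV = eigenbasisD(3)[OF E] and fin = eigenbasisD(2)[OF E]
  have key: "\<not> (bij_betw (\<lambda>x. T x - smul c x) V V \<and> (\<exists>C. \<forall>x\<in>V. norm x \<le> C * norm (T x - smul c x)))
      \<longleftrightarrow> c \<in> (\<lambda>e. of_real (t e)) ` U" for c :: 'k
  proof
    assume "c \<in> (\<lambda>e. of_real (t e)) ` U"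
    then obtain e where e: "e \<in> U" "c = of_real (t e)" by blast
    have "norm e = 1" by (rule onb_norm[OF eigenbasisD(1)[OF E] e(1)])
    moreover have "T e - smul c e = 0" using eigenbasisD(5)[OF E e(1)] e(2) by simp
    ultimately show "\<not> (bij_betw (\<lambda>x. T x - smul c x) V V \<and> (\<exists>C. \<forall>x\<in>V. norm x \<le> C * norm (T x - smul c x)))"
      using e(1) UV by (metis mult_zero_right norm_zero not_one_le_zero subset_iff)
  next
    assume *: "\<not> (bij_betw (\<lambda>x. T x - smul c x) V V \<and> (\<exists>C. \<forall>x\<in>V. norm x \<le> C * norm (T x - smul c x)))"
    show "c \<in> (\<lambda>e. of_real (t e)) ` U"
    proof (rule ccontr)
      assume "c \<notin> (\<lambda>e. of_real (t e)) ` U"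
      then have ne: "of_real (t e) - c \<noteq> 0" if "e \<in> U" for e using that by auto
      have co: "m (T x - smul c x) e = (of_real (t e) - c) * m x e" if "x \<in> V" "e \<in> U" for x e
        by (simp add: m_diff_left m_smul_left eigenbasis_coeff[OF E T that] left_diff_distrib)
      define G where "G y = (\<Sum>e\<in>U. smul (m y e / (of_real (t e) - c)) e)" for y
      have GV: "G y \<in> V" for y unfolding G_def using UV by (intro subspace_sum[OF V] subspace_scale[OF V]) auto
      have GT: "G (T x - smul c x) = x" if "x \<in> V" for x
        unfolding G_def using ne eigenbasisD(6)[OF E that] by (simp add: co[OF that] cong: sum.cong)
      have inV: "T x - smul c x \<in> V" if "x \<in> V" for x
        using that lin_onD(1)[OF Tl] subspace_scale[OF V] subspace_diff[OF V] by blast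
      have TG: "T (G y) - smul c (G y) = y" if y: "y \<in> V" for y
      proof -
        let ?z = "T (G y) - smul c (G y)"
        have "m ?z e = m y e" if e: "e \<in> U" for e
        proof -
          have "m (G y) e = m y e / (of_real (t e) - c)"
            unfolding G_def by (rule mf.orthonormal_coeff[OF eigenbasisD(4,2)[OF E] _ e]) simp
          then show ?thesis using ne[OF e] by (simp add: co[OF GV e])
        qed
        then have "(\<Sum>e\<in>U. smul (m ?z e) e) = (\<Sum>e\<in>U. smul (m y e) e)" by (intro sum.cong) auto
        then show ?thesis using eigenbasisD(6)[OF E inV[OF GV]] eigenbasisD(6)[OF E y] by simp
      qed
      have "bij_betw (\<lambda>x. T x - smul c x) V V"
        by (rule bij_betw_byWitness[where f' = G]) (use GT TG GV inV in auto)
      moreover have "norm x \<le> (\<Sum>e\<in>U. 1 / norm (of_real (t e) - c)) * norm (T x - smul c x)" if x: "x \<in> V" for x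
      proof -
        have "norm x = norm (G (T x - smul c x))" by (simp add: GT[OF x])
        also have "\<dots> \<le> (\<Sum>e\<in>U. 1 / norm (of_real (t e) - c) * norm (T x - smul c x))"
          unfolding G_def
        proof (rule order_trans[OF norm_sum], rule sum_mono)
          fix e assume "e \<in> U"
          then show "norm (smul (m (T x - smul c x) e / (of_real (t e) - c)) e) \<le> 1 / norm (of_real (t e) - c) * norm (T x - smul c x)"
            using norm_m_le[of "T x - smul c x" e] onb_norm[OF eigenbasisD(1)[OF E]]
            by (simp add: norm_smul norm_divide divide_right_mono)
        qed
        finally show ?thesis by (simp add: sum_distrib_right)
      qed
      ultimately show False using * by blast
    qed
  qed
  have "spectrum smul V V T = to_complex ` (\<lambda>e. of_real (t e) :: 'k) ` U"
    unfolding spectrum_def key by blast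
  then show ?thesis by (simp add: image_image)
qed

lemma form_operator_props:
  assumes fd: "finite_dim_subspace smul V" and b: "hermitian_form_on smul V b"
  shows form_operator_m: "x \<in> V \<Longrightarrow> v \<in> V \<Longrightarrow> m (form_operator m V b x) v = b x v"
    and form_operator_symm: "symm_on V (form_operator m V b)"
proof -
  obtain B where B: "finite B" "V = span B" using fd unfolding finite_dim_subspace_def by blast
  then have V: "subspace V" "V \<subseteq> span B" "finite B" "V \<subseteq> UNIV" by auto
  obtain U where U: "mf.onb V U" using mf.onb_exists[OF V] by blast
  have UV: "U \<subseteq> V" and fin: "finite U" using mf.onbD[OF U] by auto
  have badd: "b (x + y) z = b x z + b y z" and bsm: "b (smul c x) z = c * b x z" and bc: "b z x = sconj (b x z)"
    if "x \<in> V" "y \<in> V" "z \<in> V" for x y z c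
    using b that unfolding hermitian_form_on_def by blast+
  have bsum: "b (\<Sum>e\<in>I. smul (u e) e) z = (\<Sum>e\<in>I. u e * b e z)" if "finite I" "I \<subseteq> V" "z \<in> V" for I u z
    using that
  proof (induction I)
    case empty
    then show ?case using bsm[OF subspace_0[OF V(1)] _ empty(2), of 0 0] subspace_0[OF V(1)] by simp
  next
    case (insert e I)
    have "smul (u e) e \<in> V" "(\<Sum>e\<in>I. smul (u e) e) \<in> V"
      using insert.prems by (auto intro!: subspace_scale[OF V(1)] subspace_sum[OF V(1)])
    then show ?case using insert by (simp add: badd bsm)
  qed
  define w where "w x = (\<Sum>e\<in>U. smul (b x e) e)" for x
  have wV: "w x \<in> V" for x unfolding w_def using UV by (intro subspace_sum[OF V(1)] subspace_scale[OF V(1)]) auto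
  have wm: "m (w x) v = b x v" if x: "x \<in> V" and v: "v \<in> V" for x v
  proof -
    have "m (w x) v = (\<Sum>e\<in>U. b x e * m e v)" unfolding w_def by (rule mf.b_sum_left) auto
    also have "\<dots> = (\<Sum>e\<in>U. sconj (m v e * b e x))"
    proof (rule sum.cong[OF refl])
      fix e assume "e \<in> U"
      then show "b x e * m e v = sconj (m v e * b e x)"
        using bc[of e x x] m_conj[of v e] UV x by (auto simp: mult.commute)
    qed
    also have "\<dots> = sconj (\<Sum>e\<in>U. m v e * b e x)" by (induction U rule: infinite_finite_induct) auto
    also have "\<dots> = sconj (b v x)" using bsum[OF fin UV x, of "m v"] mf.onbD(4)[OF U v] by simp
    also have "\<dots> = b x v" using bc[OF v v x] by simp
    finally show ?thesis .
  qed
  have eq: "form_operator m V b x = w x" if x: "x \<in> V" for x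
    unfolding form_operator_def
  proof (rule the_equality)
    show "w x \<in> V \<and> (\<forall>v\<in>V. m (w x) v = b x v)" using wV wm[OF x] by blast
    show "y = w x" if "y \<in> V \<and> (\<forall>v\<in>V. m y v = b x v)" for y
      by (rule mf.eqI_orthogonal[OF V(1)]) (use that wV wm[OF x] in auto)
  qed
  show "m (form_operator m V b x) v = b x v" if "x \<in> V" "v \<in> V" for x v
    using that by (simp add: eq wm)
  have "w (x + y) = w x + w y" if "x \<in> V" "y \<in> V" for x y
    using that UV by (simp add: w_def sum.distrib[symmetric] scale_left_distrib[symmetric] badd subset_iff cong: sum.cong)
  moreover have "w (smul c x) = smul c (w x)" if "x \<in> V" for c x
    using that UV by (simp add: w_def scale_sum_right bsm subset_iff cong: sum.cong)
  moreover have "m (w x) y = m x (w y)" if x: "x \<in> V" and y: "y \<in> V" for x y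
    unfolding m_conj[of x "w y"] wm[OF y x] wm[OF x y] by (rule bc[OF y y x])
  ultimately show "symm_on V (form_operator m V b)"
    unfolding symm_on_def lin_on_def
    using wV subspace_add[OF V(1)] subspace_scale[OF V(1)] by (simp add: eq)
qed

end

section \<open>Functional calculus of a pencil\<close>

context pos_form
begin

text \<open>If \<open>U\<close> is an eigenbasis with eigenvalues \<open>t\<close>, the choice
  \<open>f e = g (t e)\<close> gives the operator \<open>g(T)\<close>. Indexing \<open>f\<close> by
  basis vectors makes products and sums of such operators pointwise.\<close>

definition diag :: "'h set \<Rightarrow> ('h \<Rightarrow> real) \<Rightarrow> 'h \<Rightarrow> 'h"
  where "diag U f x = (\<Sum>e\<in>U. smul (of_real (f e) * b x e) e)"

lemma diag_cong: "(\<And>e. e \<in> U \<Longrightarrow> f e = g e) \<Longrightarrow> diag U f x = diag U g x"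
  by (simp add: diag_def cong: sum.cong)

lemma diag_add_fun: "diag U (\<lambda>e. f e + g e) x = diag U f x + diag U g x"
  by (simp add: diag_def sum.distrib[symmetric] scale_left_distrib distrib_right)

lemma diag_scale_fun: "diag U (\<lambda>e. c * f e) x = smul (of_real c) (diag U f x)"
  by (simp add: diag_def scale_sum_right mult.assoc)

context
  fixes V U
  assumes U: "onb V U" and V: "subspace V" "V \<subseteq> W"
begin

lemma onb_facts: "finite U" "U \<subseteq> V" "U \<subseteq> W" "orthonormal U"
  using onbD[OF U] V by auto

lemma diag_in: "diag U f x \<in> V"
  unfolding diag_def using onb_facts by (intro subspace_sum[OF V(1)] subspace_scale[OF V(1)]) auto

lemma diag_coeff: "e \<in> U \<Longrightarrow> b (diag U f x) e = of_real (f e) * b x e"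
  unfolding diag_def by (rule orthonormal_coeff[OF onb_facts(4,1,3)])

lemma diag_diag: "diag U f (diag U g x) = diag U (\<lambda>e. f e * g e) x"
  unfolding diag_def[of _ f] diag_def[of _ "\<lambda>e. f e * g e"]
  by (intro sum.cong) (simp_all add: diag_coeff mult.assoc)

lemma diag_add: "x \<in> W \<Longrightarrow> y \<in> W \<Longrightarrow> diag U f (x + y) = diag U f x + diag U f y"
  using onb_facts
  by (simp add: diag_def sum.distrib[symmetric] scale_left_distrib[symmetric] distrib_left[symmetric] b_add_left subset_iff cong: sum.cong)

lemma diag_smul: "x \<in> W \<Longrightarrow> diag U f (smul c x) = smul c (diag U f x)"
  using onb_facts
  by (simp add: diag_def scale_sum_right b_smul_left subset_iff mult.left_commute cong: sum.cong)

lemma diag_diff: "x \<in> W \<Longrightarrow> y \<in> W \<Longrightarrow> diag U f (x - y) = diag U f x - diag U f y"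
  using diag_add[of "x - y" y f] subspace_diff[OF subspace_W, of x y] by simp

lemma diag_const: "x \<in> V \<Longrightarrow> diag U (\<lambda>_. c) x = smul (of_real c) x"
  using onbD(4)[OF U, of x] by (simp add: diag_def scale_sum_right[symmetric] scale_scale[symmetric] del: scale_scale)

lemma diag_symm: "x \<in> W \<Longrightarrow> y \<in> W \<Longrightarrow> b (diag U f x) y = b x (diag U f y)"
proof -
  assume x: "x \<in> W" and y: "y \<in> W"
  have "b (diag U f x) y = (\<Sum>e\<in>U. of_real (f e) * b x e * b e y)"
    unfolding diag_def using onb_facts y by (intro b_sum_left) auto
  also have "\<dots> = (\<Sum>e\<in>U. sconj (of_real (f e) * b y e) * b x e)"
    using onb_facts y by (intro sum.cong) (auto simp: b_conj[of y] subset_iff)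
  also have "\<dots> = b x (diag U f y)"
    unfolding diag_def using onb_facts x by (intro b_sum_right[symmetric]) auto
  finally show ?thesis .
qed

lemma diag_norm: "x \<in> W \<Longrightarrow> real_part (b (diag U f x) (diag U f x)) = (\<Sum>e\<in>U. (f e)\<^sup>2 * (norm (b x e))\<^sup>2)"
proof -
  assume x: "x \<in> W"
  have d: "diag U f x \<in> W" using diag_in V by blast
  have "b (diag U f x) (diag U f x) = (\<Sum>e\<in>U. sconj (of_real (f e) * b x e) * b (diag U f x) e)"
    by (subst (2) diag_def, rule b_sum_right) (use onb_facts d in auto)
  also have "\<dots> = (\<Sum>e\<in>U. of_real ((f e)\<^sup>2 * (norm (b x e))\<^sup>2))"
  proof (rule sum.cong[OF refl])
    fix e assume "e \<in> U"
    then have "sconj (of_real (f e) * b x e) * b (diag U f x) e = of_real ((f e)\<^sup>2) * (b x e * sconj (b x e))"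
      by (simp add: diag_coeff power2_eq_square)
    then show "sconj (of_real (f e) * b x e) * b (diag U f x) e = of_real ((f e)\<^sup>2 * (norm (b x e))\<^sup>2)"
      unfolding mult_sconj by simp
  qed
  finally show ?thesis unfolding of_real_sum[symmetric] by (simp only: real_part_simps)
qed

lemma diag_norm_le:
  assumes x: "x \<in> V" and f: "\<And>e. e \<in> U \<Longrightarrow> \<bar>f e\<bar> \<le> K" and K: "0 \<le> K"
  shows "real_part (b (diag U f x) (diag U f x)) \<le> K\<^sup>2 * real_part (b x x)"
proof -
  have xW: "x \<in> W" using x V by blast
  have "real_part (b (diag U f x) (diag U f x)) \<le> (\<Sum>e\<in>U. K\<^sup>2 * (1\<^sup>2 * (norm (b x e))\<^sup>2))"
    unfolding diag_norm[OF xW] using f K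
    by (intro sum_mono) (simp add: mult_right_mono abs_le_square_iff[symmetric])
  also have "\<dots> = K\<^sup>2 * real_part (b (diag U (\<lambda>_. 1) x) (diag U (\<lambda>_. 1) x))"
    unfolding diag_norm[OF xW] by (simp add: sum_distrib_left)
  finally show ?thesis by (simp add: diag_const[OF x])
qed

end

end

context hilbert_space
begin

text \<open>The basis \<open>F\<close> is \<open>M\<^sup>-\<^sup>1\<^sup>/\<^sup>2\<close> applied to an orthonormal eigenbasis of \<open>A\<^sub>n\<close>.\<close>

lemma pencil_eigenbasis:
  assumes fd: "finite_dim_subspace smul V" and mn: "pos_form smul V mn" and an: "hermitian_form_on smul V an"
  obtains F t where "pos_form.onb smul mn V F"
    "\<And>e v. e \<in> F \<Longrightarrow> v \<in> V \<Longrightarrow> an e v = of_real (t e) * mn e v"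
    "approx_spectrum smul m V an mn = (\<lambda>e. complex_of_real (t e)) ` F"
    "\<And>J x. approx_projector smul m V an mn J x =
      pos_form.diag smul mn F (\<lambda>e. indicator J (t e)) (orth_proj m V x)"
proof -
  interpret n: pos_form smul V mn by (rule mn)
  have V: "subspace V" by (rule n.subspace_W)
  let ?M = "form_operator m V mn" and ?A = "form_operator m V an"
  note Mm = form_operator_m[OF fd n.herm] and Msym = form_operator_symm[OF fd n.herm]
  note Am = form_operator_m[OF fd an] and Asym = form_operator_symm[OF fd an]
  obtain U s where E: "eigenbasis V ?M U s" using eigenbasis_exists[OF Msym fd] by blast
  note onbU = eigenbasisD(1)[OF E]
  note d = mf.diag_in[OF onbU V subset_UNIV] mf.diag_diag[OF onbU V subset_UNIV] mf.diag_symm[OF onbU V subset_UNIV UNIV_I UNIV_I]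
  have s: "s e > 0" if e: "e \<in> U" for e
  proof -
    have eV: "e \<in> V" using e eigenbasisD(3)[OF E] by blast
    have ee: "m e e = 1" using e eigenbasisD(4)[OF E] by (simp add: mf.orthonormal_def)
    have "mn e e = m (?M e) e" using Mm[OF eV eV] by simp
    also have "\<dots> = of_real (s e)" using eigenbasisD(5)[OF E e] by (simp add: m_smul_left ee)
    finally have "real_part (mn e e) = s e" by simp
    moreover have "e \<noteq> 0" using ee by auto
    ultimately show ?thesis using n.pos[OF eV] by simp
  qed
  define H where "H = mf.diag U (\<lambda>e. sqrt (s e))"
  define G where "G = mf.diag U (\<lambda>e. 1 / sqrt (s e))"
  have sq: "mass_sqrt smul m V mn = H"
    unfolding mass_sqrt_def H_def by (rule ext) (simp add: fun_calc_eq[OF E Msym V] mf.diag_def)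
  have isq: "mass_inv_sqrt smul m V mn = G"
    unfolding mass_inv_sqrt_def G_def by (rule ext) (simp add: fun_calc_eq[OF E Msym V] mf.diag_def)
  have HV: "H x \<in> V" and GV: "G x \<in> V" for x unfolding H_def G_def by (rule d(1))+
  have one: "mf.diag U (\<lambda>_. 1) x = x" if "x \<in> V" for x
    using mf.diag_const[OF onbU V subset_UNIV that, of 1] by simp
  have HG: "H (G x) = x" if x: "x \<in> V" for x
    unfolding H_def G_def d(2) using mf.diag_cong[of U "\<lambda>e. sqrt (s e) * (1 / sqrt (s e))" "\<lambda>_. 1" x] s one[OF x] by force
  have GH: "G (H x) = x" if x: "x \<in> V" for x
    unfolding H_def G_def d(2) using mf.diag_cong[of U "\<lambda>e. 1 / sqrt (s e) * sqrt (s e)" "\<lambda>_. 1" x] s one[OF x] by force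
  have HH: "H (H x) = ?M x" if x: "x \<in> V" for x
  proof -
    have MV: "?M x \<in> V" using lin_onD(1)[OF symm_onD(1)[OF Msym] x] .
    have "H (H x) = mf.diag U s x" unfolding H_def d(2) by (rule mf.diag_cong) (use s in \<open>auto simp: less_imp_le\<close>)
    also have "\<dots> = (\<Sum>e\<in>U. smul (m (?M x) e) e)"
      unfolding mf.diag_def by (intro sum.cong) (simp_all add: eigenbasis_coeff[OF E Msym x])
    also have "\<dots> = ?M x" by (rule eigenbasisD(6)[OF E MV])
    finally show ?thesis .
  qed
  have Hs: "m (H x) y = m x (H y)" and Gs: "m (G x) y = m x (G y)" for x y unfolding H_def G_def by (rule d(3))+
  have Gadd: "G (x + y) = G x + G y" and Gsm: "G (smul c x) = smul c (G x)" for x y c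
    unfolding G_def using mf.diag_add[OF onbU V] mf.diag_smul[OF onbU V] by auto
  have mnH: "mn x v = m (H x) (H v)" if "x \<in> V" "v \<in> V" for x v
    using Mm[OF that] HH[OF that(1)] Hs[of "H x" v] by simp
  let ?T = "approx_operator smul m V an mn"
  have T: "?T x = G (?A (G x))" for x by (simp add: approx_operator_def isq)
  note Al = symm_onD(1)[OF Asym]
  have Tsym: "symm_on V ?T"
    unfolding symm_on_def lin_on_def T
    using GV lin_onD[OF Al] symm_onD(2)[OF Asym] Gs by (simp add: Gadd Gsm)
  obtain U' t' where E': "eigenbasis V ?T U' t'" using eigenbasis_exists[OF Tsym fd] by blast
  note U' = eigenbasisD[OF E']
  have GinjU: "inj_on G U'" using HG U'(3) by (metis inj_onI subsetD)
  define F where "F = G ` U'"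
  \<comment> \<open>\<open>H\<close> inverts \<open>G\<close> on \<open>V\<close>, so this carries
    the eigenvalues from \<open>U'\<close> over to \<open>F\<close>.\<close>
  define t where "t e = t' (H e)" for e
  have FV: "F \<subseteq> V" unfolding F_def using GV by blast
  have co: "mn x (G e) = m (H x) e" if "x \<in> V" "e \<in> U'" for x e
    using mnH[OF that(1) GV] HG[of e] U'(3) that(2) by auto
  have sumF: "(\<Sum>e\<in>F. g e) = (\<Sum>e\<in>U'. g (G e))" for g :: "'h \<Rightarrow> 'h"
    unfolding F_def by (simp add: sum.reindex[OF GinjU])
  have tG: "t (G e) = t' e" if "e \<in> U'" for e unfolding t_def using HG[of e] U'(3) that by auto
  have Gsum: "G (\<Sum>e\<in>I. smul (u e) e) = (\<Sum>e\<in>I. smul (u e) (G e))" for u and I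
    by (induction I rule: infinite_finite_induct) (use Gadd Gsm Gsm[of 0 0] in auto)
  have "n.onb V F"
    unfolding n.onb_def n.orthonormal_def
  proof (intro conjI ballI)
    show "finite F" using U'(2) by (simp add: F_def)
    show "F \<subseteq> V" by (rule FV)
    show "mn e f = (if e = f then 1 else 0)" if ef: "e \<in> F" "f \<in> F" for e f
    proof -
      obtain e' f' where e': "e' \<in> U'" "e = G e'" and f': "f' \<in> U'" "f = G f'" using ef unfolding F_def by blast
      have "mn e f = m e' f'" using co[OF GV f'(1), of e'] HG[of e'] U'(3) e' f' by auto
      also have "\<dots> = (if e' = f' then 1 else 0)" using U'(4) e' f' by (simp add: mf.orthonormal_def)
      finally show ?thesis using GinjU e' f' by (simp add: inj_on_eq_iff)
    qed
    show "x = (\<Sum>e\<in>F. smul (mn x e) e)" if x: "x \<in> V" for x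
    proof -
      have "x = G (\<Sum>e\<in>U'. smul (m (H x) e) e)" using GH[OF x] U'(6)[OF HV] by simp
      also have "\<dots> = (\<Sum>e\<in>U'. smul (mn x (G e)) (G e))" unfolding Gsum using co[OF x] by simp
      finally show ?thesis unfolding sumF .
    qed
  qed
  moreover have "an e v = of_real (t e) * mn e v" if e: "e \<in> F" and v: "v \<in> V" for e v
  proof -
    obtain e' where e': "e' \<in> U'" "e = G e'" using e unfolding F_def by blast
    have "an e v = m (?A (G e')) (G (H v))" unfolding e'(2) using Am[OF GV v] GH[OF v] by simp
    also have "\<dots> = m (?T e') (H v)" by (simp add: T Gs)
    also have "\<dots> = of_real (t' e') * m e' (H v)" using U'(5)[OF e'(1)] by (simp add: m_smul_left)
    also have "m e' (H v) = mn e v" unfolding e'(2) using mnH[OF GV v, of e'] HG[of e'] U'(3) e'(1) by auto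
    finally show ?thesis using tG[OF e'(1)] e'(2) by simp
  qed
  moreover have "approx_spectrum smul m V an mn = (\<lambda>e. complex_of_real (t e)) ` F"
    unfolding approx_spectrum_def spectrum_eq[OF E' Tsym V] F_def image_image using tG by (intro image_cong) auto
  \<comment> \<open>Conjugation by the square root of the mass operator makes the projector diagonal
    in \<open>F\<close>. On \<open>V\<close> it is therefore orthogonal for \<open>mn\<close>,
    though in general not for \<open>m\<close>.\<close>
  moreover have "approx_projector smul m V an mn J x = n.diag F (\<lambda>e. indicator J (t e)) (orth_proj m V x)" for J x
  proof -
    let ?p = "orth_proj m V x"
    have p: "?p \<in> V" by (rule mf.orth_proj_in[OF fd]) auto
    have "approx_projector smul m V an mn J x = G (fun_calc smul m V (indicator J) ?T (H ?p))"
      by (simp add: approx_projector_def sq isq)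
    also have "\<dots> = (\<Sum>e\<in>U'. smul (of_real (indicator J (t' e)) * m (H ?p) e) (G e))"
      unfolding fun_calc_eq[OF E' Tsym V] Gsum ..
    also have "\<dots> = n.diag F (\<lambda>e. indicator J (t e)) ?p"
      unfolding n.diag_def sumF by (intro sum.cong) (simp_all add: co[OF p] tG)
    finally show ?thesis .
  qed
  ultimately show ?thesis by (rule that)
qed

end

section \<open>Stability of a pencil\<close>

text \<open>\<open>stable\<close> is the inf-sup bound at \<mu> in the shape in which it is applied:
  a bound on the residual functional of \<open>x\<close> by \<delta> in the dual of the form norm
  bounds the form norm of \<open>x\<close>. No suprema have to be handled after this point.\<close>

locale stable_pencil = hilbert_space smul m
  for smul :: "'k::real_or_complex \<Rightarrow> 'h::{real_inner, polish_space} \<Rightarrow> 'h" and m :: "('k, 'h) form" +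
  fixes V :: "'h set" and an mn :: "('k, 'h) form" and F :: "'h set" and t N :: "'h \<Rightarrow> real" and \<Gamma> c \<mu> :: real
  assumes mn_pos: "pos_form smul V mn" and an_herm: "hermitian_form_on smul V an"
    and onb_F: "pos_form.onb smul mn V F"
    and eigen: "e \<in> F \<Longrightarrow> v \<in> V \<Longrightarrow> an e v = of_real (t e) * mn e v"
    and mn_upper: "x \<in> V \<Longrightarrow> real_part (mn x x) \<le> \<Gamma> * (norm x)\<^sup>2" and \<Gamma>_pos: "0 < \<Gamma>"
    and N: "seminorm_on smul V N" and norm_le_N: "x \<in> V \<Longrightarrow> norm x \<le> N x"
    and stable: "x \<in> V \<Longrightarrow> 0 \<le> \<delta> \<Longrightarrow>
      (\<And>v. v \<in> V \<Longrightarrow> norm (an x v - of_real \<mu> * mn x v) \<le> \<delta> * N v) \<Longrightarrow> c * N x \<le> \<delta>"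
    and c_pos: "0 < c"
begin

sublocale n: pos_form smul V mn by (rule mn_pos)

lemma subspace_V: "subspace V" by (rule n.subspace_W)

sublocale a: herm_form smul V an
  by standard (rule subspace_V, rule an_herm)

abbreviation "\<Phi> g \<equiv> n.diag F g"

definition "mnorm x = sqrt (real_part (mn x x))"

lemmas \<Phi>_in = n.diag_in[OF onb_F subspace_V order_refl]
  and \<Phi>_comp = n.diag_diag[OF onb_F subspace_V order_refl]
  and \<Phi>_symm = n.diag_symm[OF onb_F subspace_V order_refl]
  and \<Phi>_add = n.diag_add[OF onb_F subspace_V order_refl]
  and \<Phi>_diff = n.diag_diff[OF onb_F subspace_V order_refl]
  and \<Phi>_norm_le = n.diag_norm_le[OF onb_F subspace_V order_refl]

lemma \<Phi>_one: "x \<in> V \<Longrightarrow> \<Phi> (\<lambda>_. 1) x = x"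
  using n.diag_const[OF onb_F subspace_V order_refl, of x 1] by simp

lemma mnorm_sq: "x \<in> V \<Longrightarrow> (mnorm x)\<^sup>2 = real_part (mn x x)"
  by (simp add: mnorm_def n.b_self_nonneg)

lemma mnorm_nonneg: "x \<in> V \<Longrightarrow> 0 \<le> mnorm x"
  by (simp add: mnorm_def n.b_self_nonneg)

lemma N_nonneg: "x \<in> V \<Longrightarrow> 0 \<le> N x" and N_add: "x \<in> V \<Longrightarrow> y \<in> V \<Longrightarrow> N (x + y) \<le> N x + N y"
  using N unfolding seminorm_on_def by blast+

lemma N_diff: "x \<in> V \<Longrightarrow> y \<in> V \<Longrightarrow> N (x - y) \<le> N x + N y"
proof -
  assume xy: "x \<in> V" "y \<in> V"
  have "N (smul (-1) y) = norm (- 1 :: 'k) * N y" using N xy unfolding seminorm_on_def by blast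
  then show ?thesis using N_add[of x "- y"] xy subspace_neg[OF subspace_V] by simp
qed

lemma norm_mn_le: "x \<in> V \<Longrightarrow> v \<in> V \<Longrightarrow> norm (mn x v) \<le> mnorm x * mnorm v"
  using n.cauchy_schwarz[of x v]
  by - (rule power2_le_imp_le; simp add: power_mult_distrib mnorm_sq mnorm_nonneg)

lemma mnorm_le_norm: "x \<in> V \<Longrightarrow> mnorm x \<le> sqrt \<Gamma> * norm x"
  using mn_upper[of x] \<Gamma>_pos
  by - (rule power2_le_imp_le; simp add: power_mult_distrib mnorm_sq)

lemma mnorm_le_N: "x \<in> V \<Longrightarrow> mnorm x \<le> sqrt \<Gamma> * N x"
  using order_trans[OF mnorm_le_norm[of x] mult_left_mono[OF norm_le_N[of x], of "sqrt \<Gamma>"]] \<Gamma>_pos by simp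

lemma mnorm_\<Phi>_le:
  assumes "x \<in> V" "\<And>e. e \<in> F \<Longrightarrow> \<bar>g e\<bar> \<le> K" "0 \<le> K"
  shows "mnorm (\<Phi> g x) \<le> K * mnorm x"
  using \<Phi>_norm_le[of x g K] assms
  by - (rule power2_le_imp_le; simp add: power_mult_distrib mnorm_sq mnorm_nonneg \<Phi>_in)

text \<open>In the basis \<open>F\<close> the pencil \<open>an - s mn\<close> is multiplication by
  \<open>t - s\<close>, paired through \<open>mn\<close>.\<close>

lemma residual_\<Phi>:
  assumes v: "v \<in> V"
  shows "an (\<Phi> g x) v - of_real s * mn (\<Phi> g x) v = mn (\<Phi> (\<lambda>e. (t e - s) * g e) x) v"
proof -
  have FV: "\<And>e. e \<in> F \<Longrightarrow> e \<in> V" using n.onb_facts[OF onb_F subspace_V order_refl] by auto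
  have "an (\<Phi> g x) v = (\<Sum>e\<in>F. of_real (g e) * mn x e * an e v)"
    unfolding n.diag_def by (rule a.b_sum_left) (use FV v in auto)
  also have "\<dots> = (\<Sum>e\<in>F. of_real (t e * g e) * mn x e * mn e v)"
    by (intro sum.cong) (simp_all add: eigen[OF _ v])
  also have "\<dots> = mn (\<Phi> (\<lambda>e. t e * g e) x) v"
    unfolding n.diag_def by (rule n.b_sum_left[symmetric]) (use FV v in auto)
  finally have 1: "an (\<Phi> g x) v = mn (\<Phi> (\<lambda>e. t e * g e) x) v" .
  have "\<Phi> (\<lambda>e. (t e - s) * g e) x = \<Phi> (\<lambda>e. t e * g e + (- s) * g e) x"
    by (rule n.diag_cong) (simp add: left_diff_distrib)
  also have "\<dots> = \<Phi> (\<lambda>e. t e * g e) x + smul (of_real (- s)) (\<Phi> g x)"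
    by (simp only: n.diag_add_fun n.diag_scale_fun)
  finally show ?thesis
    using v \<Phi>_in subspace_scale[OF subspace_V \<Phi>_in] subspace_neg[OF subspace_V]
    by (simp add: 1 n.b_add_left n.b_smul_left del: of_real_minus) (simp add: n.b_diff_left n.b_smul_left)
qed

text \<open>The bridge from spectral bounds to the form norm. The residual of
  \<open>\<Phi> g x\<close> at \<mu> has the symbol \<open>(t - \<mu>) g\<close>, its
  \<open>mn\<close> norm is at most \<open>K * mnorm x\<close>, and pairing with \<open>v\<close>
  costs another factor \<open>sqrt \<Gamma> * N v\<close>.\<close>

lemma N_\<Phi>_le:
  assumes x: "x \<in> V" and g: "\<And>e. e \<in> F \<Longrightarrow> \<bar>(t e - \<mu>) * g e\<bar> \<le> K" and K: "0 \<le> K"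
  shows "c * N (\<Phi> g x) \<le> sqrt \<Gamma> * K * mnorm x"
proof (rule stable[OF \<Phi>_in])
  show "0 \<le> sqrt \<Gamma> * K * mnorm x" using \<Gamma>_pos K mnorm_nonneg[OF x] by simp
  fix v assume v: "v \<in> V"
  have "norm (an (\<Phi> g x) v - of_real \<mu> * mn (\<Phi> g x) v) \<le> mnorm (\<Phi> (\<lambda>e. (t e - \<mu>) * g e) x) * mnorm v"
    unfolding residual_\<Phi>[OF v] by (rule norm_mn_le[OF \<Phi>_in v])
  also have "\<dots> \<le> (K * mnorm x) * (sqrt \<Gamma> * N v)"
    by (intro mult_mono mnorm_\<Phi>_le x g K mnorm_le_N v mult_nonneg_nonneg mnorm_nonneg)
  finally show "norm (an (\<Phi> g x) v - of_real \<mu> * mn (\<Phi> g x) v) \<le> sqrt \<Gamma> * K * mnorm x * N v"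
    by (simp add: mult.commute mult.left_commute)
qed

lemma N_spectral_projection_le:
  assumes \<mu>: "\<mu> = l + \<epsilon> / 2" and \<epsilon>: "0 < \<epsilon>" and x: "x \<in> V"
  shows "N (\<Phi> (\<lambda>e. indicator {l - \<epsilon> / 2<..<l + \<epsilon> / 2} (t e)) x) \<le> \<Gamma> * \<epsilon> / c * norm x"
proof -
  let ?p = "\<lambda>e. indicator {l - \<epsilon> / 2<..<l + \<epsilon> / 2} (t e)"
  \<comment> \<open>On the window, whose right end is \<mu>, the distance of \<open>t\<close> to
    \<mu> is at most its length \<epsilon>.\<close>
  have "c * N (\<Phi> ?p x) \<le> sqrt \<Gamma> * \<epsilon> * mnorm x"
    by (rule N_\<Phi>_le[OF x]) (use \<epsilon> in \<open>auto simp: \<mu> indicator_def abs_le_iff\<close>)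
  also have "\<dots> \<le> sqrt \<Gamma> * \<epsilon> * (sqrt \<Gamma> * norm x)"
    using \<epsilon> \<Gamma>_pos by (intro mult_left_mono mnorm_le_norm x) simp
  also have "\<dots> = \<Gamma> * \<epsilon> * norm x" using \<Gamma>_pos by simp
  finally show ?thesis using c_pos by (simp add: field_simps)
qed

text \<open>The complementary part \<open>z\<close> of \<open>w\<close> is first bounded in \<open>H\<close> by testing the residual with
  \<open>(B - l)\<^sup>-\<^sup>1 z\<close>, where \<open>B\<close> is the operator of the pencil, and then in the form norm by stability at \<open>\<mu>\<close>.\<close>

lemma spectral_projection_error:
  assumes \<mu>: "\<mu> = l + \<epsilon> / 2" and \<epsilon>: "0 < \<epsilon>" and w: "w \<in> V" and \<delta>: "0 \<le> \<delta>"
    and res: "\<And>v. v \<in> V \<Longrightarrow> norm (an w v - of_real l * mn w v) \<le> \<delta> * N v"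
  shows "N (w - \<Phi> (\<lambda>e. indicator {l - \<epsilon> / 2<..<l + \<epsilon> / 2} (t e)) w) \<le> (1 + 2 * (\<Gamma> * \<epsilon> / c)) / c * \<delta>"
proof -
  define p where "p e = (indicator {l - \<epsilon> / 2<..<l + \<epsilon> / 2} (t e) :: real)" for e
  define q where "q e = 1 - p e" for e
  \<comment> \<open>The symbol of the reduced resolvent at \<open>l\<close>; the numerator vanishes
    on the whole window, so no division by zero interferes at \<open>t = l\<close>.\<close>
  define h where "h e = q e / (t e - l)" for e
  have q01: "q e = 0 \<or> (q e = 1 \<and> \<epsilon> / 2 \<le> \<bar>t e - l\<bar>)" for e
    by (auto simp: q_def p_def indicator_def abs_if)
  have qq: "q e * q e = q e" for e using q01[of e] by auto
  have th: "(t e - l) * h e = q e" for e using q01[of e] \<epsilon> by (auto simp: h_def)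
  have hq: "h e * q e = h e" for e using qq[of e] by (simp add: h_def)
  \<comment> \<open>Outside the window \<open>t\<close> is at least \<open>\<epsilon> / 2\<close>
    away from \<open>l\<close>, which is also the distance from \<open>l\<close> to \<mu>; hence the
    factor 2.\<close>
  have hb: "\<bar>(t e - \<mu>) * h e\<bar> \<le> 2" for e
  proof (cases "q e = 0")
    case False
    then have q: "q e = 1" "\<epsilon> / 2 \<le> \<bar>t e - l\<bar>" using q01[of e] by auto
    have "\<bar>t e - \<mu>\<bar> \<le> \<bar>t e - l\<bar> + \<bar>\<epsilon> / 2\<bar>"
      using abs_triangle_ineq4[of "t e - l" "\<epsilon> / 2"] by (simp add: \<mu> diff_diff_eq)
    then have "\<bar>t e - \<mu>\<bar> \<le> 2 * \<bar>t e - l\<bar>" using q(2) \<epsilon> by simp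
    moreover have "\<bar>t e - l\<bar> > 0" using q(2) \<epsilon> by linarith
    ultimately show ?thesis by (simp add: h_def q(1) abs_mult field_simps)
  qed (simp add: h_def)
  define z where "z = \<Phi> q w"
  define y where "y = \<Phi> h w"
  have zV: "z \<in> V" and yV: "y \<in> V" by (simp_all add: z_def y_def \<Phi>_in)
  have proj: "\<Phi> q v = v - \<Phi> p v" if "v \<in> V" for v
  proof -
    have "\<Phi> (\<lambda>e. q e + p e) v = v" using \<Phi>_one[OF that] by (simp add: q_def)
    then show ?thesis unfolding n.diag_add_fun by (simp add: eq_diff_eq)
  qed
  have residual: "an w v - of_real l * mn w v = mn (\<Phi> (\<lambda>e. t e - l) w) v" if "v \<in> V" for v
    using residual_\<Phi>[OF that, of "\<lambda>_. 1" w l] by (simp add: \<Phi>_one[OF w])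
  have "an w y - of_real l * mn w y = mn w (\<Phi> (\<lambda>e. t e - l) y)"
    unfolding residual[OF yV] by (rule \<Phi>_symm[OF w yV])
  also have "\<Phi> (\<lambda>e. t e - l) y = \<Phi> q (\<Phi> q w)"
    unfolding y_def \<Phi>_comp by (rule n.diag_cong) (simp add: th qq)
  also have "mn w (\<Phi> q (\<Phi> q w)) = mn z z" unfolding z_def by (rule \<Phi>_symm[OF w \<Phi>_in, symmetric])
  finally have "mn z z = an w y - of_real l * mn w y" by simp
  then have "(mnorm z)\<^sup>2 \<le> \<delta> * N y"
    using res[OF yV] abs_real_part_le[of "mn z z"] by (simp add: mnorm_sq[OF zV])
  moreover have "c * N y \<le> sqrt \<Gamma> * 2 * mnorm z"
  proof -
    \<comment> \<open>As \<open>h q = h\<close>, the test vector depends on \<open>w\<close> only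
      through \<open>z\<close>. Its form norm is then of the order of \<open>mnorm z\<close>, and
      one factor \<open>mnorm z\<close> cancels below.\<close>
    have "y = \<Phi> h z" unfolding y_def z_def \<Phi>_comp by (rule n.diag_cong) (simp add: hq)
    then show ?thesis using N_\<Phi>_le[OF zV hb] by simp
  qed
  ultimately have "c * (mnorm z)\<^sup>2 \<le> \<delta> * (sqrt \<Gamma> * 2 * mnorm z)"
    using mult_left_mono[of "(mnorm z)\<^sup>2" "\<delta> * N y" c] mult_left_mono[of "c * N y" _ \<delta>] c_pos \<delta>
    by (smt (verit) mult.assoc mult.commute)
  then have mz: "mnorm z \<le> 2 * sqrt \<Gamma> / c * \<delta>"
  proof (cases "mnorm z = 0")
    case False
    then have "mnorm z > 0" using mnorm_nonneg[OF zV] by simp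
    moreover have "(c * mnorm z) * mnorm z \<le> (\<delta> * sqrt \<Gamma> * 2) * mnorm z"
      using \<open>c * (mnorm z)\<^sup>2 \<le> _\<close> by (simp add: power2_eq_square mult.assoc)
    ultimately have "c * mnorm z \<le> \<delta> * sqrt \<Gamma> * 2" by (rule mult_right_le_imp_le[rotated])
    then show ?thesis using c_pos by (simp add: field_simps)
  qed (use \<delta> c_pos \<Gamma>_pos in simp)
  have "c * N z \<le> (1 + 2 * (\<Gamma> * \<epsilon> / c)) * \<delta>"
  proof (rule stable[OF zV])
    show "0 \<le> (1 + 2 * (\<Gamma> * \<epsilon> / c)) * \<delta>" using \<delta> c_pos \<Gamma>_pos \<epsilon> by simp
    fix v assume v: "v \<in> V"
    have qv: "\<Phi> q v \<in> V" by (rule \<Phi>_in)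
    have "N (\<Phi> q v) \<le> N v + N (\<Phi> p v)" unfolding proj[OF v] by (rule N_diff[OF v \<Phi>_in])
    also have "N (\<Phi> p v) \<le> \<Gamma> * \<epsilon> / c * norm v"
      using N_spectral_projection_le[OF \<mu> \<epsilon> v] by (simp add: p_def[abs_def])
    also have "\<dots> \<le> \<Gamma> * \<epsilon> / c * N v" using c_pos \<Gamma>_pos \<epsilon> by (intro mult_left_mono norm_le_N v) simp
    finally have Nq: "N (\<Phi> q v) \<le> (1 + \<Gamma> * \<epsilon> / c) * N v" by (simp add: distrib_right)
    \<comment> \<open>Passing from \<mu> back to \<open>l\<close> costs
      \<open>(\<epsilon> / 2) mn z v\<close>, already under control. The projection \<open>q\<close>
      is then moved onto \<open>v\<close>, where the residual of \<open>w\<close> can be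
      used.\<close>
    have "an z v - of_real \<mu> * mn z v = (an z v - of_real l * mn z v) - of_real (\<epsilon> / 2) * mn z v"
      by (simp add: \<mu> distrib_right)
    also have "an z v - of_real l * mn z v = mn (\<Phi> q (\<Phi> (\<lambda>e. t e - l) w)) v"
      unfolding z_def residual_\<Phi>[OF v] \<Phi>_comp by (simp add: mult.commute)
    also have "\<dots> = an w (\<Phi> q v) - of_real l * mn w (\<Phi> q v)"
      unfolding residual[OF qv] by (rule \<Phi>_symm[OF \<Phi>_in v])
    finally have "norm (an z v - of_real \<mu> * mn z v) \<le> \<delta> * N (\<Phi> q v) + (\<epsilon> / 2) * norm (mn z v)"
      using res[OF qv] norm_triangle_ineq4[of "an w (\<Phi> q v) - of_real l * mn w (\<Phi> q v)" "of_real (\<epsilon> / 2) * mn z v"] \<epsilon>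
      by (simp add: norm_mult del: of_real_divide)
    also have "\<dots> \<le> \<delta> * ((1 + \<Gamma> * \<epsilon> / c) * N v) + (\<epsilon> / 2) * ((2 * sqrt \<Gamma> / c * \<delta>) * (sqrt \<Gamma> * N v))"
      using \<delta> \<epsilon> Nq norm_mn_le[OF zV v] mult_mono[OF mz mnorm_le_N[OF v]] mnorm_nonneg[OF v] c_pos \<Gamma>_pos
      by (intro add_mono mult_left_mono) auto
    \<comment> \<open>One term \<open>\<Gamma> * \<epsilon> / c\<close> is the price of
      \<open>\<Phi> q v\<close> in place of \<open>v\<close>, the other comes from the bound on
      \<open>mnorm z\<close>.\<close>
    also have "\<dots> = (1 + 2 * (\<Gamma> * \<epsilon> / c)) * \<delta> * N v"
    proof -
      have "(\<epsilon> / 2) * ((2 * sqrt \<Gamma> / c * \<delta>) * (sqrt \<Gamma> * N v)) = (sqrt \<Gamma> * sqrt \<Gamma>) * \<epsilon> / c * \<delta> * N v"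
        by simp
      also have "sqrt \<Gamma> * sqrt \<Gamma> = \<Gamma>" using \<Gamma>_pos by simp
      finally show ?thesis by (simp only:) (simp add: algebra_simps)
    qed
    finally show "norm (an z v - of_real \<mu> * mn z v) \<le> (1 + 2 * (\<Gamma> * \<epsilon> / c)) * \<delta> * N v" .
  qed
  then have "N z \<le> (1 + 2 * (\<Gamma> * \<epsilon> / c)) * \<delta> / c" using c_pos by (simp add: field_simps)
  then show ?thesis unfolding z_def proj[OF w] by (simp add: p_def[abs_def])
qed

end

section \<open>Approximation of an eigenvalue\<close>

lemma (in vector_space) independent_card_le_dim_of_finite_span:
  assumes "independent S" "S \<subseteq> V" "V \<subseteq> span B" "finite B"
  shows "finite S \<and> card S \<le> dim V"
proof -
  obtain C where C: "C \<subseteq> V" "independent C" "V \<subseteq> span C" "card C = dim V" by (rule basis_exists)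
  have "finite C" using independent_span_bound[OF assms(4) C(2)] C(1) assms(3) by blast
  then show ?thesis using independent_span_bound[OF _ assms(1), of C] assms(2) C by auto
qed

lemma hermitian_form_on_subset: "V \<subseteq> W \<Longrightarrow> hermitian_form_on smul W b \<Longrightarrow> hermitian_form_on smul V b"
  unfolding hermitian_form_on_def by blast

text \<open>Turns the failure of an eventual property, for a whole scale of tolerances
  \<open>k\<close>, into one subsequence; stability and the upper limit of spectra are both phrased
  with subsequences.\<close>

lemma ex_strict_mono_selection:
  fixes P :: "nat \<Rightarrow> nat \<Rightarrow> bool"
  assumes "\<And>k N. \<exists>n\<ge>N. P k n"
  shows "\<exists>r. strict_mono r \<and> (\<forall>k. P k (r k))"
proof -
  have "\<exists>f. \<forall>k. P k (f k) \<and> f k < f (Suc k)"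
  proof (rule dependent_nat_choice)
    show "\<exists>x. P 0 x" using assms by blast
    show "\<exists>y. P (Suc n) y \<and> x < y" for x n using assms[of "Suc x" "Suc n"] by (auto simp: Suc_le_eq)
  qed
  then show ?thesis by (auto simp: strict_mono_Suc_iff)
qed

text \<open>The sequence consists of nearest points to \<open>l\<close>, which exist because each
  set is finite and nonempty; one choice then works for every tolerance.\<close>

lemma liminf_setsI:
  assumes near: "\<And>\<delta>. 0 < \<delta> \<Longrightarrow> \<forall>\<^sub>F n in sequentially. \<exists>z\<in>E n. cmod (z - l) < \<delta>"
    and fin: "\<And>n. finite (E n)" and ne: "\<And>n. E n \<noteq> {}"
  shows "l \<in> liminf_sets E"
proof -
  have "\<exists>z\<in>E n. \<forall>y\<in>E n. cmod (z - l) \<le> cmod (y - l)" for n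
    using ex_is_arg_min_if_finite[OF fin[of n] ne[of n], of "\<lambda>z. cmod (z - l)"]
    by (auto simp: is_arg_min_def not_less)
  then obtain x where x: "\<And>n. x n \<in> E n" "\<And>n y. y \<in> E n \<Longrightarrow> cmod (x n - l) \<le> cmod (y - l)" by metis
  have "x \<longlonglongrightarrow> l"
  proof (rule tendstoI)
    fix e :: real assume "e > 0"
    from near[OF this] show "\<forall>\<^sub>F n in sequentially. dist (x n) l < e"
      by eventually_elim (use x(2) in \<open>auto simp: dist_norm intro: le_less_trans\<close>)
  qed
  then show ?thesis unfolding liminf_sets_def using x(1) by blast
qed

context hilbert_space
begin

lemma norm_orth_proj_le:
  assumes V: "finite_dim_subspace smul V" shows "norm (orth_proj m V x) \<le> norm x"
proof -
  have *: "real_part (m z z) = (norm z)\<^sup>2" for z by (simp add: m_self del: of_real_power)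
  have "(norm (orth_proj m V x))\<^sup>2 \<le> (norm x)\<^sup>2"
    using mf.orth_proj_pythagoras[OF V subset_UNIV UNIV_I, of x] unfolding * by simp
  then show ?thesis by (rule power2_le_imp_le) simp
qed

text \<open>A seminorm on a finite dimensional space is controlled by its values on an orthonormal
  basis. This is how pointwise convergence of the errors becomes uniform on the eigenspace.\<close>

lemma seminorm_le_sum:
  assumes p: "seminorm_on smul Q p" and Q: "subspace Q" and U: "mf.onb E U" "E \<subseteq> Q" and x: "x \<in> E"
  shows "p x \<le> (\<Sum>e\<in>U. p e) * norm x"
proof -
  have UQ: "U \<subseteq> Q" and fin: "finite U" using mf.onbD[OF U(1)] U(2) by auto
  have p0: "p 0 = 0" using p subspace_0[OF Q] unfolding seminorm_on_def by (metis mult_zero_left norm_zero scale_zero_left)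
  have "p (\<Sum>e\<in>I. smul (m x e) e) \<le> (\<Sum>e\<in>I. norm (m x e) * p e)" if "finite I" "I \<subseteq> Q" for I
    using that
  proof (induction I)
    case (insert e I)
    have *: "smul (m x e) e \<in> Q" "(\<Sum>e\<in>I. smul (m x e) e) \<in> Q"
      using insert.prems by (auto intro!: subspace_scale[OF Q] subspace_sum[OF Q])
    have "p (smul (m x e) e + (\<Sum>e\<in>I. smul (m x e) e)) \<le> p (smul (m x e) e) + p (\<Sum>e\<in>I. smul (m x e) e)"
      using p * unfolding seminorm_on_def by blast
    moreover have "p (smul (m x e) e) = norm (m x e) * p e" using p insert.prems unfolding seminorm_on_def by blast
    ultimately show ?case using insert by simp
  qed (simp add: p0)
  from this[OF fin UQ] have "p x \<le> (\<Sum>e\<in>U. norm (m x e) * p e)" using mf.onbD(4)[OF U(1) x] by simp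
  also have "\<dots> \<le> (\<Sum>e\<in>U. norm x * p e)"
  proof (intro sum_mono mult_right_mono)
    fix e assume e: "e \<in> U"
    show "norm (m x e) \<le> norm x" using norm_m_le[of x e] onb_norm[OF U(1) e] by simp
    show "0 \<le> p e" using p e UQ unfolding seminorm_on_def by blast
  qed
  finally show ?thesis by (simp add: sum_distrib_left mult.commute)
qed

end

section \<open>The data of the theorem, the eigenspace and the consistency bounds\<close>

locale eigenvalue_approximation = hilbert_space smul m
  for smul :: "'k::real_or_complex \<Rightarrow> 'h::{real_inner, polish_space} \<Rightarrow> 'h" and m :: "('k, 'h) form" +
  fixes A :: "'h \<rightharpoonup> 'h" and lam :: real and X :: "nat \<Rightarrow> 'h set"
    and an mn an' mn' :: "nat \<Rightarrow> ('k, 'h) form" and \<gamma> \<Gamma> \<kappa> :: real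
    and ra rm sa sm :: "nat \<Rightarrow> 'h \<Rightarrow> real"
  assumes A: "self_adjoint smul m A"
    and lam: "complex_of_real lam \<in> discrete_spectrum smul A"
    and approx: "approximation smul m A X an mn"
    and A1: "approximability smul m A X"
    and A2: "0 < \<gamma>" "\<gamma> \<le> \<Gamma>" "uniform_bounds smul m A X an mn \<gamma> \<Gamma>"
    and A3: "inf_sup_stability smul m A X an mn"
    and A4: "0 \<le> \<kappa>" "consistency smul m A X an mn an' mn' \<kappa> ra rm sa sm"
begin

definition "Q = form_dom smul m A"
definition "N = form_norm smul m A"
definition "ip = form_ip smul m A"
definition "a = form_of smul m A"
definition "Pr n = form_proj smul m A (X n)"
definition "E = op_eigenspace smul A (of_real lam)"
definition "P = orth_proj m E"
definition "\<sigma> n = approx_spectrum smul m (X n) (an n) (mn n)"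

lemma \<Gamma>_pos: "0 < \<Gamma>" using A2 by simp

lemma Q_subspace: "subspace Q" and dom_Q: "dom A \<subseteq> Q" and N_seminorm: "seminorm_on smul Q N"
    and norm_le_N: "norm x \<le> N x"
  unfolding Q_def N_def
  by (rule form_dom_subspace[OF A] dom_subset_form_dom[OF A] form_norm_seminorm[OF A] norm_le_form_norm[OF A])+

lemma ip_self: "real_part (ip x x) = (N x)\<^sup>2"
  unfolding ip_def N_def by (rule form_ip_self[OF A])

lemma N_nonneg: "0 \<le> N x" using norm_ge_zero norm_le_N by (rule order_trans)

lemma N_add: "x \<in> Q \<Longrightarrow> y \<in> Q \<Longrightarrow> N (x + y) \<le> N x + N y"
  and N_smul: "x \<in> Q \<Longrightarrow> N (smul c x) = norm c * N x"
  using N_seminorm unfolding seminorm_on_def by blast+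

lemma Q_diff: "x \<in> Q \<Longrightarrow> y \<in> Q \<Longrightarrow> x - y \<in> Q"
  by (rule subspace_diff[OF Q_subspace])

lemma N_minus: "x \<in> Q \<Longrightarrow> y \<in> Q \<Longrightarrow> N (x - y) = N (y - x)"
  using N_smul[OF Q_diff[of x y], of "-1"] by simp

lemma N_diff: "x \<in> Q \<Longrightarrow> y \<in> Q \<Longrightarrow> N (x - y) \<le> N x + N y"
  using N_add[of x "- y"] N_smul[of y "-1"] subspace_neg[OF Q_subspace, of y] by simp

lemma N_triangle: "x \<in> Q \<Longrightarrow> y \<in> Q \<Longrightarrow> z \<in> Q \<Longrightarrow> N (x - z) \<le> N (x - y) + N (y - z)"
  using N_add[of "x - y" "y - z"] Q_diff by simp

lemma ip_pos_form: "pos_form smul Q ip"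
proof
  show "subspace Q" by (rule Q_subspace)
  show "hermitian_form_on smul Q ip" unfolding Q_def ip_def by (rule form_ip_hermitian[OF A])
  show "0 < real_part (ip x x)" if "x \<noteq> 0" for x
    unfolding ip_self using that norm_le_N[of x] by (smt (verit) zero_less_norm_iff zero_less_power)
qed

sublocale ipf: pos_form smul Q ip by (rule ip_pos_form)

lemma X_fd: "finite_dim_subspace smul (X n)" and X_Q: "X n \<subseteq> Q"
  and an_herm: "hermitian_form_on smul Q (an n)" and mn_herm: "hermitian_form_on smul Q (mn n)"
  and mn_pos: "x \<in> X n \<Longrightarrow> x \<noteq> 0 \<Longrightarrow> 0 < real_part (mn n x x)"
  using approx unfolding approximation_def Q_def by blast+

lemma X_subspace: "subspace (X n)"
  using X_fd[of n] unfolding finite_dim_subspace_def by auto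

lemma Pr_in: "x \<in> Q \<Longrightarrow> Pr n x \<in> X n"
  unfolding Pr_def form_proj_def ip_def[symmetric] by (rule ipf.orth_proj_in[OF X_fd X_Q])

lemma Pr_Q: "x \<in> Q \<Longrightarrow> Pr n x \<in> Q" using Pr_in X_Q by blast

lemma Pr_lin: "x \<in> Q \<Longrightarrow> y \<in> Q \<Longrightarrow> Pr n (x + y) = Pr n x + Pr n y"
  "x \<in> Q \<Longrightarrow> Pr n (smul c x) = smul c (Pr n x)"
  unfolding Pr_def form_proj_def ip_def[symmetric]
  using ipf.orth_proj_add[OF X_fd X_Q] ipf.orth_proj_smul[OF X_fd X_Q] by blast+

text \<open>Puts the projection error on the same footing as the consistency seminorms, so that
  \<open>seminorm_le_sum\<close> applies to all of them.\<close>

lemma Pr_residual_seminorm: "seminorm_on smul Q (\<lambda>x. N (x - Pr n x))"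
  unfolding seminorm_on_def
proof (intro conjI ballI allI)
  show "N (x + y - Pr n (x + y)) \<le> N (x - Pr n x) + N (y - Pr n y)" if "x \<in> Q" "y \<in> Q" for x y
    using N_add[of "x - Pr n x" "y - Pr n y"] that Q_diff Pr_Q by (simp add: Pr_lin algebra_simps)
  show "N (smul c x - Pr n (smul c x)) = norm c * N (x - Pr n x)" if "x \<in> Q" for x c
    using N_smul[of "x - Pr n x" c] that Q_diff Pr_Q by (simp add: Pr_lin scale_right_diff_distrib)
qed (rule N_nonneg)

lemma Pr_residual_tendsto: "x \<in> Q \<Longrightarrow> (\<lambda>n. N (x - Pr n x)) \<longlonglongrightarrow> 0"
  using A1 unfolding approximability_def Q_def N_def Pr_def by blast

lemma mn_pos_form: "pos_form smul (X n) (mn n)"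
  by standard (fact X_subspace hermitian_form_on_subset[OF X_Q mn_herm] mn_pos)+

lemma an_herm_X: "hermitian_form_on smul (X n) (an n)"
  by (rule hermitian_form_on_subset[OF X_Q an_herm])

lemma eigen_E: "E \<noteq> {0}" "finite_dim_subspace smul E" "E \<subseteq> dom A" "u \<in> E \<Longrightarrow> the (A u) = smul (of_real lam) u"
proof -
  obtain c where c: "complex_of_real lam = to_complex c" "op_eigenspace smul A c \<noteq> {0}"
    "finite_dim_subspace smul (op_eigenspace smul A c)"
    using lam unfolding discrete_spectrum_def by blast
  have "to_complex (of_real lam :: 'k) = to_complex c" using c(1) by simp
  then have "c = of_real lam" unfolding to_complex_eq_iff by simp
  then show "E \<noteq> {0}" "finite_dim_subspace smul E" using c by (auto simp: E_def)
  show "E \<subseteq> dom A" "u \<in> E \<Longrightarrow> the (A u) = smul (of_real lam) u"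
    by (auto simp: E_def op_eigenspace_def eigenspace_def)
qed

lemma E_subspace: "subspace E"
  using eigen_E(2) unfolding finite_dim_subspace_def by auto

lemma E_Q: "u \<in> E \<Longrightarrow> u \<in> Q" using eigen_E(3) dom_Q by blast

lemma a_herm: "herm_form smul Q a"
  by standard (rule Q_subspace, unfold Q_def a_def, rule form_of_hermitian[OF A])

sublocale af: herm_form smul Q a by (rule a_herm)

lemma a_eigen_left: "u \<in> E \<Longrightarrow> v \<in> Q \<Longrightarrow> a u v = of_real lam * m u v"
  using form_of_dom[OF A, of u v] eigen_E(3,4) by (auto simp: a_def Q_def m_smul_left)

lemma a_eigen_right: "u \<in> E \<Longrightarrow> v \<in> Q \<Longrightarrow> a v u = of_real lam * m v u"
  using af.b_conj[of u v] a_eigen_left[of u v] E_Q[of u] m_conj[of v u] by simp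

lemma P_in: "P x \<in> E"
  unfolding P_def by (rule mf.orth_proj_in[OF eigen_E(2)]) auto

lemma P_id: "u \<in> E \<Longrightarrow> P u = u"
  unfolding P_def by (rule mf.orth_proj_id[OF eigen_E(2)]) auto

lemma P_diff: "P (x - y) = P x - P y"
proof -
  have "P (x - y + y) = P (x - y) + P y"
    unfolding P_def by (rule mf.orth_proj_add[OF eigen_E(2)]) auto
  then show ?thesis by simp
qed

lemma norm_P_le: "norm (P x) \<le> norm x"
  unfolding P_def by (rule norm_orth_proj_le[OF eigen_E(2)])

lemma range_P: "range P = E"
  using P_in P_id by (metis rangeI subsetI subset_antisym image_subset_iff)

lemma a_bound: obtains Ca where "0 \<le> Ca" "\<And>x y. x \<in> Q \<Longrightarrow> y \<in> Q \<Longrightarrow> norm (a x y) \<le> Ca * N x * N y"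
proof -
  obtain C where C: "\<forall>x\<in>Q. \<forall>y\<in>Q. norm (a x y) \<le> C * N x * N y"
    using form_of_bounded[OF A] unfolding a_def Q_def N_def by blast
  show ?thesis
  proof (rule that[of "\<bar>C\<bar>"])
    fix x y assume "x \<in> Q" "y \<in> Q"
    then have "norm (a x y) \<le> C * (N x * N y)" using C by (simp add: mult.assoc)
    also have "\<dots> \<le> \<bar>C\<bar> * (N x * N y)" using N_nonneg by (intro mult_right_mono) auto
    finally show "norm (a x y) \<le> \<bar>C\<bar> * N x * N y" by (simp add: mult.assoc)
  qed simp
qed

lemma consistent:
  shows seminorms: "seminorm_on smul Q (ra n)" "seminorm_on smul Q (rm n)" "seminorm_on smul Q (sa n)" "seminorm_on smul Q (sm n)"
    and r_bound: "x \<in> Q \<Longrightarrow> y \<in> Q \<Longrightarrow> norm (a x y - an' n x y) \<le> ra n x * ra n y"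
      "x \<in> Q \<Longrightarrow> y \<in> Q \<Longrightarrow> norm (m x y - mn' n x y) \<le> rm n x * rm n y"
    and upper: "x \<in> Q \<Longrightarrow> ra n x \<le> \<kappa> * N x" "x \<in> Q \<Longrightarrow> rm n x \<le> \<kappa> * norm x" "x \<in> Q \<Longrightarrow> sa n x \<le> \<kappa> * N x" "x \<in> Q \<Longrightarrow> sm n x \<le> \<kappa> * norm x"
    and s_bound: "x \<in> Q \<Longrightarrow> w \<in> X n \<Longrightarrow> norm (an n (Pr n x) w - an' n (Pr n x) w) \<le> sa n x * N w"
      "x \<in> Q \<Longrightarrow> w \<in> X n \<Longrightarrow> norm (mn n (Pr n x) w - mn' n (Pr n x) w) \<le> sm n x * N w"
    and to_zero: "x \<in> Q \<Longrightarrow> (\<lambda>n. ra n x) \<longlonglongrightarrow> 0" "x \<in> Q \<Longrightarrow> (\<lambda>n. rm n x) \<longlonglongrightarrow> 0"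
      "x \<in> Q \<Longrightarrow> (\<lambda>n. sa n x) \<longlonglongrightarrow> 0" "x \<in> Q \<Longrightarrow> (\<lambda>n. sm n x) \<longlonglongrightarrow> 0"
proof -
  note c = A4(2)[unfolded consistency_def Let_def, folded Q_def N_def a_def Pr_def]
  note c1 = conjunct1[OF c] and c2 = conjunct1[OF conjunct2[OF c]] and c3 = conjunct1[OF conjunct2[OF conjunct2[OF c]]]
    and c4 = conjunct2[OF conjunct2[OF conjunct2[OF c]]]
  show sn: "seminorm_on smul Q (ra n)" "seminorm_on smul Q (rm n)" "seminorm_on smul Q (sa n)" "seminorm_on smul Q (sm n)" for n
    using c1 by blast+
  show "x \<in> Q \<Longrightarrow> y \<in> Q \<Longrightarrow> norm (a x y - an' n x y) \<le> ra n x * ra n y"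
      "x \<in> Q \<Longrightarrow> y \<in> Q \<Longrightarrow> norm (m x y - mn' n x y) \<le> rm n x * rm n y"
    using c2 by blast+
  show "x \<in> Q \<Longrightarrow> ra n x \<le> \<kappa> * N x" "x \<in> Q \<Longrightarrow> rm n x \<le> \<kappa> * norm x" "x \<in> Q \<Longrightarrow> sa n x \<le> \<kappa> * N x" "x \<in> Q \<Longrightarrow> sm n x \<le> \<kappa> * norm x"
    using c3 by blast+
  show "x \<in> Q \<Longrightarrow> (\<lambda>n. ra n x) \<longlonglongrightarrow> 0" "x \<in> Q \<Longrightarrow> (\<lambda>n. rm n x) \<longlonglongrightarrow> 0"
      "x \<in> Q \<Longrightarrow> (\<lambda>n. sa n x) \<longlonglongrightarrow> 0" "x \<in> Q \<Longrightarrow> (\<lambda>n. sm n x) \<longlonglongrightarrow> 0"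
    using c4 by blast+
  \<comment> \<open>The suprema of the hypothesis run over nonzero \<open>w\<close> in extended
    reals. At \<open>w = 0\<close> both forms vanish, so the linear version of the bound holds on
    all of \<open>X n\<close>.\<close>
  have conv: "norm (f (Pr n x) w - g (Pr n x) w) \<le> s * N w"
    if f: "hermitian_form_on smul Q f" "hermitian_form_on smul Q g" and s: "0 \<le> s" and x: "x \<in> Q" and w: "w \<in> X n"
      and S: "(SUP w\<in>X n - {0}. ennreal (norm (f (Pr n x) w - g (Pr n x) w) / N w)) \<le> ennreal s"
    for f g :: "('k, 'h) form" and s x w
  proof (cases "w = 0")
    case True
    interpret f: herm_form smul Q f by standard (rule Q_subspace, rule f(1))
    interpret g: herm_form smul Q g by standard (rule Q_subspace, rule f(2))
    show ?thesis using s N_nonneg[of 0] Pr_Q[OF x] by (simp add: True f.b_zero_right g.b_zero_right)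
  next
    case False
    have "N w > 0" using False norm_le_N[of w] by (smt (verit) zero_less_norm_iff)
    have "ennreal (norm (f (Pr n x) w - g (Pr n x) w) / N w) \<le> ennreal s"
      by (rule order_trans[OF SUP_upper S]) (use w False in simp)
    then have "norm (f (Pr n x) w - g (Pr n x) w) / N w \<le> s" using s by (simp add: ennreal_le_iff)
    then show ?thesis using \<open>N w > 0\<close> by (simp add: field_simps)
  qed
  show "norm (an n (Pr n x) w - an' n (Pr n x) w) \<le> sa n x * N w" if xw: "x \<in> Q" "w \<in> X n"
  proof (rule conv[OF an_herm _ _ xw])
    show "hermitian_form_on smul Q (an' n)" using c1 by blast
    show "0 \<le> sa n x" using sn(3)[of n] xw(1) unfolding seminorm_on_def by blast
  qed (use c3 xw(1) in blast)
  show "norm (mn n (Pr n x) w - mn' n (Pr n x) w) \<le> sm n x * N w" if xw: "x \<in> Q" "w \<in> X n"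
  proof (rule conv[OF mn_herm _ _ xw])
    show "hermitian_form_on smul Q (mn' n)" using c1 by blast
    show "0 \<le> sm n x" using sn(4)[of n] xw(1) unfolding seminorm_on_def by blast
  qed (use c3 xw(1) in blast)
qed

section \<open>Consistency error and convergence of the spectrum\<close>

lemma seminorm_nonneg: "x \<in> Q \<Longrightarrow> 0 \<le> ra n x" "x \<in> Q \<Longrightarrow> 0 \<le> rm n x" "x \<in> Q \<Longrightarrow> 0 \<le> sa n x" "x \<in> Q \<Longrightarrow> 0 \<le> sm n x"
  using seminorms[of n] unfolding seminorm_on_def by blast+

text \<open>Carries the seminorms from an eigenvector \<open>y\<close>, where they tend to zero, to
  a nearby vector \<open>x\<close> such as its projection.\<close>

lemma r_triangle:
  assumes "x \<in> Q" "y \<in> Q"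
  shows "ra n x \<le> ra n y + \<kappa> * N (y - x)" "rm n x \<le> rm n y + \<kappa> * N (y - x)"
proof -
  have d: "x - y \<in> Q" using assms Q_diff by blast
  have "ra n (y + (x - y)) \<le> ra n y + ra n (x - y)" "rm n (y + (x - y)) \<le> rm n y + rm n (x - y)"
    using seminorms(1,2)[of n] assms d unfolding seminorm_on_def by blast+
  moreover have "ra n (x - y) \<le> \<kappa> * N (y - x)" using upper(1)[OF d, of n] N_minus[OF assms] by simp
  moreover have "rm n (x - y) \<le> \<kappa> * N (y - x)"
    using upper(2)[OF d, of n] mult_left_mono[OF norm_le_N[of "x - y"] A4(1)] N_minus[OF assms] by simp
  ultimately show "ra n x \<le> ra n y + \<kappa> * N (y - x)" "rm n x \<le> rm n y + \<kappa> * N (y - x)" by simp_all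
qed

lemma rm_le_N: "x \<in> Q \<Longrightarrow> rm n x \<le> \<kappa> * N x"
  using upper(2)[of x n] mult_left_mono[OF norm_le_N[of x] A4(1)] by linarith

text \<open>The auxiliary forms and then \<open>a\<close>, \<open>m\<close> are inserted, and
  \<open>a - lam m\<close> annihilates \<open>u\<close>. The products of seminorms are kept
  unevaluated: for a general \<open>v\<close> only the first factor is small, but for a discrete
  eigenvector both are, which produces the quadratic term of the eigenvalue estimate.\<close>

lemma residual_split:
  assumes u: "u \<in> E" and v: "v \<in> X n"
  shows "norm (an n (Pr n u) v - of_real lam * mn n (Pr n u) v)
    \<le> norm (a (Pr n u - u) v - of_real lam * m (Pr n u - u) v)
      + ra n (Pr n u) * ra n v + \<bar>lam\<bar> * (rm n (Pr n u) * rm n v) + (sa n u + \<bar>lam\<bar> * sm n u) * N v"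
proof -
  let ?w = "Pr n u"
  have uQ: "u \<in> Q" by (rule E_Q[OF u])
  have wQ: "?w \<in> Q" by (rule Pr_Q[OF uQ])
  have vQ: "v \<in> Q" using v X_Q by blast
  have five: "norm (p - x + y + z - w) \<le> norm p + norm x + norm y + norm z + norm w" for p x y z w :: 'k
    using norm_triangle_ineq4[of "p - x + y + z" w] norm_triangle_ineq[of "p - x + y" z]
      norm_triangle_ineq[of "p - x" y] norm_triangle_ineq4[of p x] by linarith
  let ?a1 = "a ?w v - an' n ?w v" and ?a2 = "an n ?w v - an' n ?w v"
  let ?m1 = "m ?w v - mn' n ?w v" and ?m2 = "mn n ?w v - mn' n ?w v"
  have "an n ?w v - of_real lam * mn n ?w v
      = (a ?w v - of_real lam * m ?w v) - ?a1 + of_real lam * ?m1 + ?a2 - of_real lam * ?m2"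
    by (simp add: algebra_simps)
  also have "a ?w v - of_real lam * m ?w v = a (?w - u) v - of_real lam * m (?w - u) v"
    using a_eigen_left[OF u vQ] wQ uQ vQ by (simp add: af.b_diff_left m_diff_left right_diff_distrib)
  finally have eq: "an n ?w v - of_real lam * mn n ?w v
      = a (?w - u) v - of_real lam * m (?w - u) v - ?a1 + of_real lam * ?m1 + ?a2 - of_real lam * ?m2" .
  have "norm (an n ?w v - of_real lam * mn n ?w v)
      \<le> norm (a (?w - u) v - of_real lam * m (?w - u) v) + norm ?a1 + \<bar>lam\<bar> * norm ?m1 + norm ?a2 + \<bar>lam\<bar> * norm ?m2"
    using five[of "a (?w - u) v - of_real lam * m (?w - u) v" ?a1 "of_real lam * ?m1" ?a2 "of_real lam * ?m2"]
    unfolding eq norm_mult norm_of_real .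
  moreover have "norm ?a1 \<le> ra n ?w * ra n v" "norm ?m1 \<le> rm n ?w * rm n v"
    using r_bound wQ vQ by blast+
  moreover have "norm ?a2 \<le> sa n u * N v" "norm ?m2 \<le> sm n u * N v"
    using s_bound uQ v by blast+
  ultimately show ?thesis
    using mult_left_mono[of "norm ?m1" "rm n ?w * rm n v" "\<bar>lam\<bar>"] mult_left_mono[of "norm ?m2" "sm n u * N v" "\<bar>lam\<bar>"]
    by (simp add: distrib_right mult.assoc)
qed

definition "err n u = N (u - Pr n u) + ra n u + rm n u + sa n u + sm n u"

lemma err_nonneg: "u \<in> E \<Longrightarrow> 0 \<le> err n u"
  using seminorm_nonneg[OF E_Q] N_nonneg by (simp add: err_def add_nonneg_nonneg)

lemma err_tendsto: "u \<in> E \<Longrightarrow> (\<lambda>n. err n u) \<longlonglongrightarrow> 0"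
  using tendsto_add[OF tendsto_add[OF tendsto_add[OF tendsto_add[OF Pr_residual_tendsto to_zero(1)] to_zero(2)] to_zero(3)] to_zero(4), of u] E_Q[of u]
  by (simp add: err_def)

lemma form_difference_bound:
  obtains C where "0 \<le> C"
    "\<And>x y. x \<in> Q \<Longrightarrow> y \<in> Q \<Longrightarrow> norm (a x y - of_real lam * m x y) \<le> C * N x * N y"
proof -
  obtain Ca where Ca: "0 \<le> Ca" "\<And>x y. x \<in> Q \<Longrightarrow> y \<in> Q \<Longrightarrow> norm (a x y) \<le> Ca * N x * N y"
    using a_bound by blast
  show ?thesis
  proof (rule that[of "Ca + \<bar>lam\<bar>"])
    fix x y assume xy: "x \<in> Q" "y \<in> Q"
    have "norm (m x y) \<le> N x * N y"
      using norm_m_le[of x y] mult_mono[OF norm_le_N norm_le_N N_nonneg norm_ge_zero, of x y] by linarith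
    then have "\<bar>lam\<bar> * norm (m x y) \<le> \<bar>lam\<bar> * (N x * N y)" by (rule mult_left_mono) simp
    then show "norm (a x y - of_real lam * m x y) \<le> (Ca + \<bar>lam\<bar>) * N x * N y"
      using norm_triangle_ineq4[of "a x y" "of_real lam * m x y"] Ca(2)[OF xy]
      by (simp add: norm_mult distrib_right mult.assoc)
  qed (use Ca in simp)
qed

lemma residual_bound:
  obtains C where "0 \<le> C"
    "\<And>n u v. u \<in> E \<Longrightarrow> v \<in> X n \<Longrightarrow> norm (an n (Pr n u) v - of_real lam * mn n (Pr n u) v) \<le> C * err n u * N v"
proof -
  obtain Ca where Ca: "0 \<le> Ca" "\<And>x y. x \<in> Q \<Longrightarrow> y \<in> Q \<Longrightarrow> norm (a x y - of_real lam * m x y) \<le> Ca * N x * N y"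
    using form_difference_bound by blast
  \<comment> \<open>\<open>L\<close> absorbs the factors 1 and \<open>|lam|\<close>. In
    \<open>K\<close>, the seminorm at the projected vector contributes
    \<open>(1 + \<kappa>) * err\<close> and the one at \<open>v\<close> contributes
    \<open>\<kappa> * N v\<close>; the two products give the coefficient 2.\<close>
  define L where "L = 1 + \<bar>lam\<bar>"
  define K where "K = \<kappa> * (1 + \<kappa>)"
  have L: "1 \<le> L" "\<bar>lam\<bar> \<le> L" by (auto simp: L_def)
  have K: "0 \<le> K" using A4(1) by (simp add: K_def)
  show ?thesis
  proof (rule that[of "Ca + 2 * L * K + L"])
    show "0 \<le> Ca + 2 * L * K + L" using Ca K L by simp
    fix n u v assume u: "u \<in> E" and v: "v \<in> X n"
    let ?w = "Pr n u"
    have uQ: "u \<in> Q" by (rule E_Q[OF u])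
    have wQ: "?w \<in> Q" by (rule Pr_Q[OF uQ])
    have vQ: "v \<in> Q" using v X_Q by blast
    have Nv: "0 \<le> N v" by (rule N_nonneg)
    note nn = seminorm_nonneg[OF uQ, of n] N_nonneg[of "u - ?w"] err_nonneg[OF u, of n]
    have e: "N (u - ?w) \<le> err n u" "ra n u + N (u - ?w) \<le> err n u" "rm n u + N (u - ?w) \<le> err n u" "sa n u + sm n u \<le> err n u"
      using nn by (simp_all add: err_def)
    have 1: "norm (a (?w - u) v - of_real lam * m (?w - u) v) \<le> Ca * err n u * N v"
      using Ca(2)[OF Q_diff[OF wQ uQ] vQ] mult_right_mono[OF mult_left_mono[OF e(1) Ca(1)] Nv] N_minus[OF wQ uQ] by simp
    have r: "f * g \<le> K * err n u * N v" if f: "f \<le> f0 + \<kappa> * N (u - ?w)" "f0 + N (u - ?w) \<le> err n u" "0 \<le> f0" and g: "g \<le> \<kappa> * N v" "0 \<le> g" for f f0 g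
    proof -
      have "\<kappa> * N (u - ?w) \<le> \<kappa> * err n u" by (rule mult_left_mono[OF e(1) A4(1)])
      then have "f \<le> (1 + \<kappa>) * err n u" using f N_nonneg[of "u - ?w"] by (simp add: distrib_right)
      then have "f * g \<le> ((1 + \<kappa>) * err n u) * (\<kappa> * N v)"
        using g A4(1) nn by (intro mult_mono) auto
      then show ?thesis by (simp add: K_def algebra_simps)
    qed
    have 2: "ra n ?w * ra n v \<le> K * err n u * N v"
      by (rule r[OF r_triangle(1)[OF wQ uQ] e(2) _ upper(1)[OF vQ] seminorm_nonneg(1)[OF vQ]]) (use nn in simp)
    have 3: "rm n ?w * rm n v \<le> K * err n u * N v"
      by (rule r[OF r_triangle(2)[OF wQ uQ] e(3) _ rm_le_N[OF vQ] seminorm_nonneg(2)[OF vQ]]) (use nn in simp)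
    have KeN: "0 \<le> K * err n u * N v" using K nn Nv by simp
    have 4: "\<bar>lam\<bar> * (rm n ?w * rm n v) \<le> L * (K * err n u * N v)"
      using mult_mono[OF L(2) 3] L seminorm_nonneg(2)[OF wQ] seminorm_nonneg(2)[OF vQ] by simp
    have 5: "K * err n u * N v \<le> L * (K * err n u * N v)" using mult_right_mono[OF L(1) KeN] by simp
    have "sa n u + \<bar>lam\<bar> * sm n u \<le> L * (sa n u + sm n u)"
      using nn L(1) mult_right_mono[OF L(1), of "sa n u"] mult_right_mono[OF L(2), of "sm n u"] by (simp add: distrib_left)
    also have "\<dots> \<le> L * err n u" using L e(4) by (intro mult_left_mono) auto
    finally have 6: "(sa n u + \<bar>lam\<bar> * sm n u) * N v \<le> L * err n u * N v" by (rule mult_right_mono[OF _ Nv])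
    show "norm (an n ?w v - of_real lam * mn n ?w v) \<le> (Ca + 2 * L * K + L) * err n u * N v"
      using residual_split[OF u v] 1 2 4 5 6 by (simp add: algebra_simps)
  qed
qed

text \<open>(A3) is used for one-point compact sets only: \<open>lam\<close> in the convergence
  argument and \<open>lam + \<epsilon> / 2\<close> for the projectors.\<close>

lemma inf_sup_at:
  assumes r: "strict_mono (r :: nat \<Rightarrow> nat)" and \<alpha>: "0 < \<alpha>"
    and far: "\<And>k z. z \<in> \<sigma> (r k) \<Longrightarrow> \<alpha> \<le> cmod (z - complex_of_real s)"
  obtains c where "c > 0" "\<And>k. ennreal c \<le> inf_sup smul m A (X (r k)) (an (r k)) (mn (r k)) (complex_of_real s)"
proof -
  have "\<forall>k. \<forall>\<mu>\<in>{complex_of_real s}. \<forall>z\<in>\<sigma> (r k). \<alpha> \<le> dist \<mu> z"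
    using far by (simp add: dist_norm norm_minus_commute)
  then have ex: "\<exists>\<alpha>>0. \<forall>k. \<forall>\<mu>\<in>{complex_of_real s}. \<forall>z\<in>\<sigma> (r k). \<alpha> \<le> dist \<mu> z" using \<alpha> by blast
  note A3' = A3[unfolded inf_sup_stability_def, folded \<sigma>_def, THEN spec[of _ "{complex_of_real s}"], THEN spec[of _ r]]
  have "\<exists>c>0. \<forall>\<mu>\<in>{complex_of_real s}. \<forall>k. ennreal c \<le> inf_sup smul m A (X (r k)) (an (r k)) (mn (r k)) \<mu>"
    by (rule A3'[THEN mp, THEN mp, THEN mp, OF compact_sing r ex])
  then show ?thesis using that by blast
qed

text \<open>Supplies the assumption \<open>stable\<close> of \<open>stable_pencil\<close> from the
  quotient form of (A3). The infimum omits \<open>x = 0\<close>, where the claim is just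
  \<open>0 <= \<delta>\<close>.\<close>

lemma inf_sup_stable:
  assumes c: "ennreal c \<le> inf_sup smul m A (X n) (an n) (mn n) (complex_of_real s)"
    and x: "x \<in> X n" and \<delta>: "0 \<le> \<delta>"
    and le: "\<And>v. v \<in> X n \<Longrightarrow> norm (an n x v - of_real s * mn n x v) \<le> \<delta> * N v"
  shows "c * N x \<le> \<delta>"
proof (cases "x = 0")
  case True
  have "N 0 = 0" using N_smul[of 0 0] subspace_0[OF Q_subspace] by simp
  then show ?thesis using True \<delta> by simp
next
  case False
  have pos: "0 < N v" if "v \<noteq> 0" for v using that norm_le_N[of v] by (smt (verit) zero_less_norm_iff)
  have "ennreal c \<le> (SUP v\<in>X n - {0}. ennreal (cmod (to_complex (an n x v) - complex_of_real s * to_complex (mn n x v)) / (N x * N v)))"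
    using order_trans[OF c[unfolded inf_sup_def] INF_lower[of x]] x False unfolding N_def by simp
  also have "\<dots> \<le> ennreal (\<delta> / N x)"
  proof (rule SUP_least)
    fix v assume v: "v \<in> X n - {0}"
    have "to_complex (an n x v) - complex_of_real s * to_complex (mn n x v) = to_complex (an n x v - of_real s * mn n x v)"
      by (simp add: to_complex_diff to_complex_mult)
    then have "cmod (to_complex (an n x v) - complex_of_real s * to_complex (mn n x v)) \<le> \<delta> * N v"
      using le[of v] v by (simp add: norm_to_complex)
    then have "cmod (to_complex (an n x v) - complex_of_real s * to_complex (mn n x v)) / (N x * N v) \<le> \<delta> / N x"
      using pos[of v] pos[OF False] v by (simp add: field_simps)
    then show "ennreal (cmod (to_complex (an n x v) - complex_of_real s * to_complex (mn n x v)) / (N x * N v)) \<le> ennreal (\<delta> / N x)"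
      by (rule ennreal_leI)
  qed
  finally have "c \<le> \<delta> / N x" using \<delta> pos[OF False] by (simp add: ennreal_le_iff)
  then show ?thesis using pos[OF False] by (simp add: field_simps)
qed

lemma pencil:
  obtains F t where "pos_form.onb smul (mn n) (X n) F"
    "\<And>e v. e \<in> F \<Longrightarrow> v \<in> X n \<Longrightarrow> an n e v = of_real (t e) * mn n e v"
    "\<sigma> n = (\<lambda>e. complex_of_real (t e)) ` F"
    "\<And>J x. approx_projector smul m (X n) (an n) (mn n) J x =
      pos_form.diag smul (mn n) F (\<lambda>e. indicator J (t e)) (orth_proj m (X n) x)"
  using pencil_eigenbasis[OF X_fd mn_pos_form an_herm_X, of n] unfolding \<sigma>_def by blast

lemma \<sigma>_finite: "finite (\<sigma> n)" and \<sigma>_nonempty: "X n \<noteq> {0} \<Longrightarrow> \<sigma> n \<noteq> {}"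
proof -
  interpret n: pos_form smul "X n" "mn n" by (rule mn_pos_form)
  obtain F t where F: "n.onb (X n) F" "\<sigma> n = (\<lambda>e. complex_of_real (t e)) ` F" using pencil[of n] by metis
  then show "finite (\<sigma> n)" using n.onbD(1) by simp
  show "\<sigma> n \<noteq> {}" if "X n \<noteq> {0}"
  proof
    assume "\<sigma> n = {}"
    then have "F = {}" using F(2) by simp
    then have "x = 0" if "x \<in> X n" for x using n.onbD(4)[OF F(1) that] by simp
    then show False using that subspace_0[OF X_subspace] by blast
  qed
qed

lemma spectrum_near:
  assumes \<delta>: "0 < \<delta>"
  shows "\<forall>\<^sub>F n in sequentially. \<exists>z\<in>\<sigma> n. cmod (z - complex_of_real lam) < \<delta>"
proof (rule ccontr)
  assume "\<not> ?thesis"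
  then have far: "\<exists>n\<ge>M. \<forall>z\<in>\<sigma> n. \<delta> \<le> cmod (z - complex_of_real lam)" for M
    unfolding eventually_sequentially by (meson not_less)
  have "\<exists>r. strict_mono (r :: nat \<Rightarrow> nat) \<and> (\<forall>k. \<forall>z\<in>\<sigma> (r k). \<delta> \<le> cmod (z - complex_of_real lam))"
    by (rule ex_strict_mono_selection[of "\<lambda>k n. \<forall>z\<in>\<sigma> n. \<delta> \<le> cmod (z - complex_of_real lam)"]) (rule far)
  then obtain r :: "nat \<Rightarrow> nat" where r: "strict_mono r" "\<And>k z. z \<in> \<sigma> (r k) \<Longrightarrow> \<delta> \<le> cmod (z - complex_of_real lam)"
    by blast
  obtain c where c: "c > 0" "\<And>k. ennreal c \<le> inf_sup smul m A (X (r k)) (an (r k)) (mn (r k)) (complex_of_real lam)"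
    by (rule inf_sup_at[OF r(1) \<delta>], erule r(2), rule that)
  obtain C where C: "0 \<le> C"
    "\<And>n u v. u \<in> E \<Longrightarrow> v \<in> X n \<Longrightarrow> norm (an n (Pr n u) v - of_real lam * mn n (Pr n u) v) \<le> C * err n u * N v"
    using residual_bound by blast
  obtain u where u: "u \<in> E" "u \<noteq> 0" using eigen_E(1) subspace_0[OF E_subspace] by blast
  have uQ: "u \<in> Q" by (rule E_Q[OF u(1)])
  have "c * N u \<le> (C + c) * err (r k) u" for k
  proof -
    let ?n = "r k"
    have "c * N (Pr ?n u) \<le> C * err ?n u"
      by (rule inf_sup_stable[OF c(2) Pr_in[OF uQ]]) (use C err_nonneg[OF u(1)] u(1) in auto)
    moreover have "N u \<le> N (Pr ?n u) + N (u - Pr ?n u)"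
      using N_add[of "Pr ?n u" "u - Pr ?n u"] uQ Pr_Q Q_diff by simp
    moreover have "N (u - Pr ?n u) \<le> err ?n u" using seminorm_nonneg[OF uQ] by (simp add: err_def)
    ultimately have "c * N u \<le> c * (N (Pr ?n u) + err ?n u)" using c(1) by (intro mult_left_mono) auto
    then show ?thesis using \<open>c * N (Pr ?n u) \<le> C * err ?n u\<close> by (simp add: distrib_left distrib_right)
  qed
  moreover have "(\<lambda>k. (C + c) * err (r k) u) \<longlonglongrightarrow> 0"
    using tendsto_mult_left[OF LIMSEQ_subseq_LIMSEQ[OF err_tendsto[OF u(1)] r(1)], of "C + c"] by (simp add: o_def)
  ultimately have "c * N u \<le> 0" using LIMSEQ_le_const by blast
  moreover have "N u > 0" using u(2) norm_le_N[of u] by (smt (verit) zero_less_norm_iff)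
  ultimately show False using c(1) by (simp add: mult_le_0_iff)
qed

text \<open>The lower limit asks for a point in every set of the sequence, and the spectrum is empty
  when \<open>X n = {0}\<close>. Since the spectra are nonempty from some index on, either the
  sequence is shifted or trivial spaces are excluded.\<close>

lemma eigenvalue_liminf:
  shows "\<exists>M. complex_of_real lam \<in> liminf_sets (\<lambda>n. \<sigma> (n + M))"
    and "\<forall>n. X n \<noteq> {0} \<Longrightarrow> complex_of_real lam \<in> liminf_sets \<sigma>"
proof -
  obtain M where "\<forall>n\<ge>M. \<exists>z\<in>\<sigma> n. cmod (z - complex_of_real lam) < 1"
    using spectrum_near[of 1] unfolding eventually_sequentially by auto
  then have M: "\<sigma> n \<noteq> {}" if "M \<le> n" for n using that by blast
  have "complex_of_real lam \<in> liminf_sets (\<lambda>n. \<sigma> (n + M))"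
  proof (rule liminf_setsI)
    show "\<forall>\<^sub>F n in sequentially. \<exists>z\<in>\<sigma> (n + M). cmod (z - complex_of_real lam) < \<delta>" if "0 < \<delta>" for \<delta>
      using spectrum_near[OF that] sequentially_offset by fast
  qed (use \<sigma>_finite M in auto)
  then show "\<exists>M. complex_of_real lam \<in> liminf_sets (\<lambda>n. \<sigma> (n + M))" ..
  show "complex_of_real lam \<in> liminf_sets \<sigma>" if "\<forall>n. X n \<noteq> {0}"
    by (rule liminf_setsI) (use spectrum_near \<sigma>_finite \<sigma>_nonempty that in auto)
qed

section \<open>Spectral projectors\<close>

text \<open>A real supremum carries information only over a nonempty set with bounded values: the
  unit sphere of \<open>E\<close> is nonempty as \<open>E\<close> is nonzero, and an orthonormal
  basis of \<open>E\<close> gives the bound.\<close>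

lemma sphere_sup_bounds:
  assumes p: "seminorm_on smul Q p" and U: "mf.onb E U"
  shows sphere_sup_upper: "u \<in> E \<Longrightarrow> p u \<le> sphere_sup P p * norm u"
    and sphere_sup_nonneg: "0 \<le> sphere_sup P p"
    and sphere_sup_le: "sphere_sup P p \<le> (\<Sum>e\<in>U. p e)"
proof -
  let ?S = "{x \<in> range P. norm x = 1}"
  have EQ: "E \<subseteq> Q" using E_Q by blast
  note le = seminorm_le_sum[OF p Q_subspace U EQ]
  have S: "?S = {x \<in> E. norm x = 1}" by (simp add: range_P)
  have up: "p x \<le> (\<Sum>e\<in>U. p e)" if "x \<in> ?S" for x using le[of x] that unfolding S by simp
  then have bdd: "bdd_above (p ` ?S)" by (intro bdd_aboveI2) blast
  obtain u0 where u0: "u0 \<in> E" "u0 \<noteq> 0" using eigen_E(1) subspace_0[OF E_subspace] by blast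
  have normalized: "smul (of_real (1 / norm u)) u \<in> ?S" if "u \<in> E" "u \<noteq> 0" for u
    unfolding S using that subspace_scale[OF E_subspace] by (simp add: norm_smul norm_divide)
  show "sphere_sup P p \<le> (\<Sum>e\<in>U. p e)"
    unfolding sphere_sup_def by (rule cSUP_least) (use normalized[OF u0] up in auto)
  have upper: "p x \<le> sphere_sup P p" if "x \<in> ?S" for x
    unfolding sphere_sup_def by (rule cSUP_upper[OF that bdd])
  have pQ: "p (smul c x) = norm c * p x" "0 \<le> p x" if "x \<in> Q" for x c
    using p that unfolding seminorm_on_def by blast+
  show "0 \<le> sphere_sup P p"
    using upper[OF normalized[OF u0]] pQ(2)[OF E_Q, of "smul (of_real (1 / norm u0)) u0"]
      subspace_scale[OF E_subspace u0(1)] by fastforce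
  show "p u \<le> sphere_sup P p * norm u" if u: "u \<in> E"
  proof (cases "u = 0")
    case True
    then show ?thesis using le[OF u] by simp
  next
    case False
    have "p u / norm u \<le> sphere_sup P p"
      using upper[OF normalized[OF u False]] pQ(1)[OF E_Q[OF u], of "of_real (1 / norm u)"] by (simp add: norm_divide)
    then show ?thesis using False by (simp add: field_simps)
  qed
qed

definition "proj_err n = form_op_norm smul m A (\<lambda>x. P x - Pr n (P x))"

text \<open>Here the supremum is over the unit ball of the whole space. Contractivity of
  \<open>P\<close> brings it down to \<open>E\<close>, and vectors of \<open>E\<close> are fixed by
  \<open>P\<close>, so the bound can be read back there.\<close>

lemma proj_err_bounds:
  assumes U: "mf.onb E U"
  shows proj_err_upper: "u \<in> E \<Longrightarrow> N (u - Pr n u) \<le> proj_err n * norm u"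
    and proj_err_nonneg: "0 \<le> proj_err n"
    and proj_err_le: "proj_err n \<le> (\<Sum>e\<in>U. N (e - Pr n e))"
proof -
  let ?p = "\<lambda>x. N (x - Pr n x)" and ?S = "{x::'h. norm x \<le> 1}"
  have EQ: "E \<subseteq> Q" using E_Q by blast
  have s0: "0 \<le> (\<Sum>e\<in>U. ?p e)" by (simp add: sum_nonneg N_nonneg)
  have up: "?p (P x) \<le> (\<Sum>e\<in>U. ?p e)" if "x \<in> ?S" for x
  proof -
    have "?p (P x) \<le> (\<Sum>e\<in>U. ?p e) * norm (P x)"
      by (rule seminorm_le_sum[OF Pr_residual_seminorm Q_subspace U EQ P_in])
    also have "\<dots> \<le> (\<Sum>e\<in>U. ?p e) * 1" using norm_P_le[of x] that by (intro mult_left_mono s0) simp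
    finally show ?thesis by simp
  qed
  then have bdd: "bdd_above ((\<lambda>x. ?p (P x)) ` ?S)" by (intro bdd_aboveI2) blast
  have zS: "0 \<in> ?S" by simp
  show "proj_err n \<le> (\<Sum>e\<in>U. ?p e)"
    unfolding proj_err_def form_op_norm_def N_def[symmetric] by (rule cSUP_least) (use up zS in blast)+
  have upper: "?p (P x) \<le> proj_err n" if "x \<in> ?S" for x
    unfolding proj_err_def form_op_norm_def N_def[symmetric] by (rule cSUP_upper[OF that bdd])
  then show "0 \<le> proj_err n" using N_nonneg zS order_trans by blast
  show "?p u \<le> proj_err n * norm u" if u: "u \<in> E"
  proof (cases "u = 0")
    case True
    then show ?thesis using seminorm_le_sum[OF Pr_residual_seminorm Q_subspace U EQ u] by simp
  next
    case False
    let ?v = "smul (of_real (1 / norm u)) u"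
    have v: "?v \<in> E" "?v \<in> ?S" using u False subspace_scale[OF E_subspace] by (auto simp: norm_smul norm_divide)
    have "?p ?v = norm (of_real (1 / norm u) :: 'k) * ?p u"
      using Pr_residual_seminorm E_Q[OF u] unfolding seminorm_on_def by blast
    then have "?p u / norm u \<le> proj_err n" using upper[OF v(2)] P_id[OF v(1)] by (simp add: norm_divide)
    then show ?thesis using False by (simp add: field_simps)
  qed
qed

text \<open>The errors are split in two groups because the eigenvalue estimate squares the first and
  keeps the second to first order.\<close>

definition "r_err n = proj_err n + sphere_sup P (ra n) + sphere_sup P (rm n)"
definition "s_err n = sphere_sup P (sa n) + sphere_sup P (sm n)"

lemma onb_E: obtains U where "mf.onb E U"
proof -
  obtain B where "finite B" "E = span B" using eigen_E(2) unfolding finite_dim_subspace_def by blast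
  then show ?thesis using mf.onb_exists[OF E_subspace, of B] that by auto
qed

lemma E_bounds:
  assumes u: "u \<in> E"
  shows "N (u - Pr n u) \<le> r_err n * norm u" "ra n u \<le> r_err n * norm u" "rm n u \<le> r_err n * norm u"
    "sa n u + sm n u \<le> s_err n * norm u" "sa n u \<le> s_err n * norm u" "sm n u \<le> s_err n * norm u"
    "err n u \<le> (r_err n + s_err n) * norm u"
    and err_sup_nonneg: "0 \<le> r_err n" "0 \<le> s_err n"
proof -
  obtain U where U: "mf.onb E U" by (rule onb_E)
  note b = proj_err_upper[OF U u, of n] sphere_sup_upper[OF seminorms(1) U u, of n]
    sphere_sup_upper[OF seminorms(2) U u, of n] sphere_sup_upper[OF seminorms(3) U u, of n]
    sphere_sup_upper[OF seminorms(4) U u, of n]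
  note nn = proj_err_nonneg[OF U, of n] sphere_sup_nonneg[OF seminorms(1) U, of n]
    sphere_sup_nonneg[OF seminorms(2) U, of n] sphere_sup_nonneg[OF seminorms(3) U, of n]
    sphere_sup_nonneg[OF seminorms(4) U, of n]
  note nn' = nn[THEN mult_nonneg_nonneg, OF norm_ge_zero[of u]]
  show "N (u - Pr n u) \<le> r_err n * norm u" "ra n u \<le> r_err n * norm u" "rm n u \<le> r_err n * norm u"
    "sa n u + sm n u \<le> s_err n * norm u" "sa n u \<le> s_err n * norm u" "sm n u \<le> s_err n * norm u"
    "err n u \<le> (r_err n + s_err n) * norm u"
    unfolding r_err_def s_err_def err_def distrib_right using b nn' by linarith+
  show "0 \<le> r_err n" "0 \<le> s_err n" unfolding r_err_def s_err_def using nn by linarith+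
qed

lemma err_sup_nonneg': "0 \<le> r_err n" "0 \<le> s_err n"
  using err_sup_nonneg[OF subspace_0[OF E_subspace]] by auto

text \<open>The suprema are dominated by a finite sum over an orthonormal basis of \<open>E\<close>,
  and each summand tends to zero by (A1) and (A4).\<close>

lemma err_sup_tendsto: "(\<lambda>n. r_err n + s_err n) \<longlonglongrightarrow> 0"
proof -
  obtain U where U: "mf.onb E U" by (rule onb_E)
  have UE: "U \<subseteq> E" by (rule mf.onbD(2)[OF U])
  show ?thesis
  proof (rule tendsto_sandwich[OF _ _ tendsto_const])
    show "\<forall>\<^sub>F n in sequentially. 0 \<le> r_err n + s_err n" using err_sup_nonneg' by (simp add: add_nonneg_nonneg)
    show "\<forall>\<^sub>F n in sequentially. r_err n + s_err n \<le> (\<Sum>e\<in>U. err n e)"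
    proof (rule always_eventually, rule allI)
      fix n show "r_err n + s_err n \<le> (\<Sum>e\<in>U. err n e)"
        using proj_err_le[OF U, of n] sphere_sup_le[OF seminorms(1) U, of n] sphere_sup_le[OF seminorms(2) U, of n]
          sphere_sup_le[OF seminorms(3) U, of n] sphere_sup_le[OF seminorms(4) U, of n]
        unfolding r_err_def s_err_def err_def sum.distrib by linarith
    qed
    show "(\<lambda>n. \<Sum>e\<in>U. err n e) \<longlonglongrightarrow> 0"
      using UE by (intro tendsto_null_sum err_tendsto) auto
  qed
qed

lemma N_E_bound: obtains K where "0 \<le> K" "\<And>u. u \<in> E \<Longrightarrow> N u \<le> K * norm u"
proof -
  obtain U where U: "mf.onb E U" by (rule onb_E)
  show ?thesis
    by (rule that[of "\<Sum>e\<in>U. N e"])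
      (use seminorm_le_sum[OF N_seminorm Q_subspace U] E_Q N_nonneg in \<open>auto intro: sum_nonneg\<close>)
qed

section \<open>Uniform bounds for the discrete spectral projector\<close>

definition "window \<epsilon> = {lam - \<epsilon> / 2<..<lam + \<epsilon> / 2}"
definition "Pn \<epsilon> n = approx_projector smul m (X n) (an n) (mn n) (window \<epsilon>)"

text \<open>The point \<open>lam + \<epsilon> / 2\<close> belongs to the interval in (B1) and
  differs from \<open>lam\<close>, so it is not a limit of discrete eigenvalues. If no positive
  distance survived, a subsequence would converge to it.\<close>

lemma inf_sup_eventually:
  assumes \<epsilon>: "0 < \<epsilon>"
    and lim: "limsup_sets \<sigma> \<inter> complex_of_real ` {lam - \<epsilon><..<lam + \<epsilon>} = {complex_of_real lam}"
  obtains c M where "0 < c"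
    "\<And>n. M \<le> n \<Longrightarrow> ennreal c \<le> inf_sup smul m A (X n) (an n) (mn n) (complex_of_real (lam + \<epsilon> / 2))"
proof -
  let ?\<mu> = "complex_of_real (lam + \<epsilon> / 2)"
  have "\<exists>k M. \<forall>n\<ge>M. \<forall>z\<in>\<sigma> n. 1 / real (Suc k) \<le> cmod (z - ?\<mu>)"
  proof (rule ccontr)
    assume "\<not> ?thesis"
    then have near: "\<exists>n\<ge>M. \<exists>z\<in>\<sigma> n. cmod (z - ?\<mu>) < 1 / real (Suc k)" for k M by (meson not_less)
    have "\<exists>r. strict_mono (r :: nat \<Rightarrow> nat) \<and> (\<forall>k. \<exists>z\<in>\<sigma> (r k). cmod (z - ?\<mu>) < 1 / real (Suc k))"
      by (rule ex_strict_mono_selection[of "\<lambda>k n. \<exists>z\<in>\<sigma> n. cmod (z - ?\<mu>) < 1 / real (Suc k)"]) (rule near)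
    then obtain r where r: "strict_mono (r :: nat \<Rightarrow> nat)" "\<forall>k. \<exists>z\<in>\<sigma> (r k). cmod (z - ?\<mu>) < 1 / real (Suc k)" by blast
    then obtain z where z: "\<And>k. z k \<in> \<sigma> (r k)" "\<And>k. cmod (z k - ?\<mu>) < 1 / real (Suc k)" by metis
    have "(\<lambda>k. z k - ?\<mu>) \<longlonglongrightarrow> 0"
      by (rule Lim_null_comparison[OF _ LIMSEQ_Suc[OF lim_1_over_n]]) (use z(2) in \<open>auto intro!: always_eventually less_imp_le\<close>)
    then have "z \<longlonglongrightarrow> ?\<mu>" by (rule LIM_zero_cancel)
    then have "?\<mu> \<in> limsup_sets \<sigma>" unfolding limsup_sets_def using r(1) z(1) by blast
    moreover have "?\<mu> \<in> complex_of_real ` {lam - \<epsilon><..<lam + \<epsilon>}" using \<epsilon> by (intro imageI) auto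
    ultimately have "?\<mu> = complex_of_real lam" using lim by blast
    then show False using \<epsilon> unfolding of_real_eq_iff by simp
  qed
  then obtain k M where far: "\<And>n z. M \<le> n \<Longrightarrow> z \<in> \<sigma> n \<Longrightarrow> 1 / real (Suc k) \<le> cmod (z - ?\<mu>)" by blast
  \<comment> \<open>The distance bound must hold along the entire subsequence given to (A3), so the
    first \<open>M\<close> indices are dropped.\<close>
  have mono: "strict_mono (\<lambda>k. k + M)" by (simp add: strict_mono_def)
  obtain c where c: "0 < c" "\<And>j. ennreal c \<le> inf_sup smul m A (X (j + M)) (an (j + M)) (mn (j + M)) ?\<mu>"
    by (rule inf_sup_at[OF mono, of "1 / real (Suc k)" "lam + \<epsilon> / 2"], simp, erule far[rotated], simp, rule that)
  show ?thesis
  proof (rule that[OF c(1), of M])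
    fix n assume "M \<le> n"
    then show "ennreal c \<le> inf_sup smul m A (X n) (an n) (mn n) ?\<mu>" using c(2)[of "n - M"] by simp
  qed
qed

text \<open>Collects what the estimates use, with constants independent of \<open>n\<close>, so that
  the basis and the eigenvalues of the pencil can be forgotten. The last clause keeps an
  eigenvector, normalized for \<open>mn\<close>, for each discrete eigenvalue in the window.\<close>

definition good_projector :: "real \<Rightarrow> real \<Rightarrow> real \<Rightarrow> nat \<Rightarrow> bool"
  where "good_projector \<epsilon> B C n \<longleftrightarrow>
    (\<forall>x. Pn \<epsilon> n x \<in> X n) \<and>
    (\<forall>x y. Pn \<epsilon> n (x + y) = Pn \<epsilon> n x + Pn \<epsilon> n y) \<and>
    (\<forall>c x. Pn \<epsilon> n (smul c x) = smul c (Pn \<epsilon> n x)) \<and>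
    (\<forall>x. Pn \<epsilon> n (Pn \<epsilon> n x) = Pn \<epsilon> n x) \<and>
    (\<forall>x. N (Pn \<epsilon> n x) \<le> B * norm x) \<and>
    (\<forall>u\<in>E. N (u - Pn \<epsilon> n u) \<le> C * err n u) \<and>
    (\<forall>z\<in>\<sigma> n \<inter> complex_of_real ` window \<epsilon>. \<exists>s e. z = complex_of_real s \<and> e \<in> X n \<and> Pn \<epsilon> n e = e \<and>
      mn n e e = 1 \<and> (\<forall>v\<in>X n. an n v e = of_real s * mn n v e))"

lemma good_projector_eventually:
  assumes \<epsilon>: "0 < \<epsilon>"
    and lim: "limsup_sets \<sigma> \<inter> complex_of_real ` {lam - \<epsilon><..<lam + \<epsilon>} = {complex_of_real lam}"
  obtains B C where "0 \<le> B" "0 \<le> C" "\<forall>\<^sub>F n in sequentially. good_projector \<epsilon> B C n"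
proof -
  obtain c M where c: "0 < c"
    "\<And>n. M \<le> n \<Longrightarrow> ennreal c \<le> inf_sup smul m A (X n) (an n) (mn n) (complex_of_real (lam + \<epsilon> / 2))"
    using inf_sup_eventually[OF assms] by blast
  obtain C1 where C1: "0 \<le> C1"
    "\<And>n u v. u \<in> E \<Longrightarrow> v \<in> X n \<Longrightarrow> norm (an n (Pr n u) v - of_real lam * mn n (Pr n u) v) \<le> C1 * err n u * N v"
    using residual_bound by blast
  define B where "B = \<Gamma> * \<epsilon> / c"
  define C2 where "C2 = (1 + 2 * (\<Gamma> * \<epsilon> / c)) / c"
  have B: "0 \<le> B" and C2: "0 \<le> C2" using \<Gamma>_pos \<epsilon> c(1) by (simp_all add: B_def C2_def)
  \<comment> \<open>The constant has one summand per segment of the path from \<open>u\<close> to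
    its projection \<open>w\<close>, from \<open>w\<close> to \<open>Pn w\<close>, and from
    \<open>Pn w\<close> to \<open>Pn u\<close>.\<close>
  have "good_projector \<epsilon> B (1 + C2 * C1 + B) n" if n: "M \<le> n" for n
  proof -
    obtain F t where F: "pos_form.onb smul (mn n) (X n) F"
      "\<And>e v. e \<in> F \<Longrightarrow> v \<in> X n \<Longrightarrow> an n e v = of_real (t e) * mn n e v"
      "\<sigma> n = (\<lambda>e. complex_of_real (t e)) ` F"
      "\<And>J x. approx_projector smul m (X n) (an n) (mn n) J x =
        pos_form.diag smul (mn n) F (\<lambda>e. indicator J (t e)) (orth_proj m (X n) x)"
      using pencil[of n] by metis
    interpret s: stable_pencil smul m "X n" "an n" "mn n" F t N \<Gamma> c "lam + \<epsilon> / 2"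
    proof (rule stable_pencil.intro[OF hilbert_space_axioms], rule stable_pencil_axioms.intro)
      show "pos_form smul (X n) (mn n)" by (rule mn_pos_form)
      show "hermitian_form_on smul (X n) (an n)" by (rule an_herm_X)
      show "real_part (mn n x x) \<le> \<Gamma> * (norm x)\<^sup>2" if "x \<in> X n" for x
        using A2(3) that unfolding uniform_bounds_def by blast
      show "seminorm_on smul (X n) N" using N_seminorm X_Q[of n] unfolding seminorm_on_def by blast
      show "norm x \<le> N x" for x by (rule norm_le_N)
      show "c * N x \<le> \<delta>" if "x \<in> X n" "0 \<le> \<delta>" "\<And>v. v \<in> X n \<Longrightarrow> norm (an n x v - of_real (lam + \<epsilon> / 2) * mn n x v) \<le> \<delta> * N v" for x \<delta>
        by (rule inf_sup_stable[OF c(2)[OF n] that])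
    qed (fact F(1) F(2) \<Gamma>_pos c(1))+
    let ?p = "\<lambda>e. indicator (window \<epsilon>) (t e) :: real"
    let ?\<pi> = "orth_proj m (X n)"
    have \<pi>_in: "?\<pi> x \<in> X n" for x by (rule mf.orth_proj_in[OF X_fd]) auto
    have \<pi>_id: "x \<in> X n \<Longrightarrow> ?\<pi> x = x" for x by (rule mf.orth_proj_id[OF X_fd]) auto
    have \<pi>_add: "?\<pi> (x + y) = ?\<pi> x + ?\<pi> y" for x y by (rule mf.orth_proj_add[OF X_fd]) auto
    have \<pi>_smul: "?\<pi> (smul c x) = smul c (?\<pi> x)" for c x by (rule mf.orth_proj_smul[OF X_fd]) auto
    have \<pi>_norm: "norm (?\<pi> x) \<le> norm x" for x by (rule norm_orth_proj_le[OF X_fd])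
    have Pn: "Pn \<epsilon> n x = s.\<Phi> ?p (?\<pi> x)" for x unfolding Pn_def by (rule F(4))
    have PnX: "Pn \<epsilon> n x = s.\<Phi> ?p x" if "x \<in> X n" for x by (simp add: Pn \<pi>_id[OF that])
    have in_X: "Pn \<epsilon> n x \<in> X n" for x unfolding Pn by (rule s.\<Phi>_in)
    have add: "Pn \<epsilon> n (x + y) = Pn \<epsilon> n x + Pn \<epsilon> n y" for x y
      unfolding Pn \<pi>_add by (rule s.\<Phi>_add[OF \<pi>_in \<pi>_in])
    have scale: "Pn \<epsilon> n (smul c x) = smul c (Pn \<epsilon> n x)" for c x
      unfolding Pn \<pi>_smul by (rule s.n.diag_smul[OF F(1) X_subspace order_refl \<pi>_in])
    have idem: "Pn \<epsilon> n (Pn \<epsilon> n x) = Pn \<epsilon> n x" for x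
      unfolding PnX[OF in_X] unfolding Pn s.\<Phi>_comp by (rule s.n.diag_cong) (simp add: indicator_def)
    have bound: "N (Pn \<epsilon> n x) \<le> B * norm x" for x
    proof -
      have "N (Pn \<epsilon> n x) \<le> B * norm (?\<pi> x)"
        unfolding Pn B_def window_def by (rule s.N_spectral_projection_le[OF refl \<epsilon> \<pi>_in])
      then show ?thesis using mult_left_mono[OF \<pi>_norm B, of x] by linarith
    qed
    have est: "N (u - Pn \<epsilon> n u) \<le> (1 + C2 * C1 + B) * err n u" if u: "u \<in> E" for u
    proof -
      let ?w = "Pr n u"
      have uQ: "u \<in> Q" by (rule E_Q[OF u])
      have wX: "?w \<in> X n" by (rule Pr_in[OF uQ])
      have Q: "?w \<in> Q" "Pn \<epsilon> n ?w \<in> Q" "Pn \<epsilon> n u \<in> Q" using wX in_X X_Q by blast+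
      have d: "N (u - ?w) \<le> err n u" using seminorm_nonneg[OF uQ] by (simp add: err_def)
      have "N (?w - Pn \<epsilon> n ?w) \<le> C2 * (C1 * err n u)"
        unfolding PnX[OF wX] C2_def window_def
        by (rule s.spectral_projection_error[OF refl \<epsilon> wX]) (use C1 u err_nonneg[OF u] in auto)
      moreover have "N (Pn \<epsilon> n ?w - Pn \<epsilon> n u) \<le> B * err n u"
      proof -
        have "Pn \<epsilon> n (?w - u) + Pn \<epsilon> n u = Pn \<epsilon> n ?w" by (simp add: add[symmetric])
        then have "Pn \<epsilon> n ?w - Pn \<epsilon> n u = Pn \<epsilon> n (?w - u)" by (simp add: algebra_simps)
        moreover have "norm (?w - u) \<le> err n u" using norm_le_N[of "u - ?w"] d by (simp add: norm_minus_commute)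
        ultimately show ?thesis using bound[of "?w - u"] mult_left_mono[OF _ B, of "norm (?w - u)" "err n u"] by simp
      qed
      moreover have "N (u - Pn \<epsilon> n u) \<le> N (u - ?w) + (N (?w - Pn \<epsilon> n ?w) + N (Pn \<epsilon> n ?w - Pn \<epsilon> n u))"
        using N_triangle[OF uQ Q(1) Q(3)] N_triangle[OF Q(1) Q(2) Q(3)] by linarith
      ultimately show ?thesis using d by (simp add: algebra_simps)
    qed
    have eig: "\<exists>s e. z = complex_of_real s \<and> e \<in> X n \<and> Pn \<epsilon> n e = e \<and> mn n e e = 1 \<and> (\<forall>v\<in>X n. an n v e = of_real s * mn n v e)"
      if z: "z \<in> \<sigma> n \<inter> complex_of_real ` window \<epsilon>" for z
    proof -
      obtain e where e: "e \<in> F" "z = complex_of_real (t e)" using z F(3) by blast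
      then have tJ: "t e \<in> window \<epsilon>" using z by auto
      note Ff = s.n.onb_facts[OF F(1) X_subspace order_refl]
      have eX: "e \<in> X n" using Ff e(1) by blast
      have "Pn \<epsilon> n e = (\<Sum>f\<in>F. smul (of_real (?p f) * mn n e f) f)" by (simp add: PnX[OF eX] s.n.diag_def)
      also have "\<dots> = (\<Sum>f\<in>F. if f = e then e else 0)"
        using Ff(4) e(1) tJ by (intro sum.cong) (auto simp: s.n.orthonormal_def)
      finally have "Pn \<epsilon> n e = e" using Ff(1) e(1) by simp
      moreover have "an n v e = of_real (t e) * mn n v e" if v: "v \<in> X n" for v
        unfolding s.a.b_conj[OF eX v] s.n.b_conj[OF eX v] F(2)[OF e(1) v] by simp
      moreover have "mn n e e = 1" using Ff(4) e(1) by (simp add: s.n.orthonormal_def)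
      ultimately show ?thesis using e(2) eX by blast
    qed
    show ?thesis unfolding good_projector_def using in_X add scale idem bound est eig by blast
  qed
  then show ?thesis
    using that[of B "1 + C2 * C1 + B"] B C2 C1(1) unfolding eventually_sequentially by auto
qed

lemma dim_E: assumes U: "mf.onb E U" shows "dim E = card U"
proof (rule dim_unique)
  note f = mf.onb_facts[OF U E_subspace subset_UNIV]
  show "U \<subseteq> E" by (rule f(2))
  show "independent U" by (rule mf.orthonormal_independent[OF f(4,1) subset_UNIV])
  show "E \<subseteq> span U"
  proof
    fix x assume "x \<in> E"
    then have "x = (\<Sum>e\<in>U. smul (m x e) e)" using mf.onbD(4)[OF U] by simp
    also have "\<dots> \<in> span U" by (intro span_sum span_scale span_base)
    finally show "x \<in> span U" .
  qed
qed simp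

definition "total_err n = r_err n + s_err n"

lemma total_err_nonneg: "0 \<le> total_err n" "r_err n \<le> total_err n" "s_err n \<le> total_err n"
  using err_sup_nonneg'[of n] by (simp_all add: total_err_def)

section \<open>Comparison of the eigenspace with the range of the discrete projector\<close>

context
  fixes \<epsilon> B C n
  assumes good: "good_projector \<epsilon> B C n" and B: "0 \<le> B" and C: "0 \<le> C"
begin

abbreviation "proj \<equiv> Pn \<epsilon> n"

lemma p_in: "proj x \<in> X n" and p_add: "proj (x + y) = proj x + proj y" and p_smul: "proj (smul c x) = smul c (proj x)"
  and p_idem: "proj (proj x) = proj x" and p_bound: "N (proj x) \<le> B * norm x"
  and p_est: "u \<in> E \<Longrightarrow> N (u - proj u) \<le> C * err n u"
  using good unfolding good_projector_def by blast+

lemma p_Q: "proj x \<in> Q" using p_in X_Q by blast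

lemma p_zero: "proj 0 = 0" using p_smul[of 0 0] by simp

lemma p_sum: "proj (\<Sum>i\<in>I. smul (c i) (g i)) = (\<Sum>i\<in>I. smul (c i) (proj (g i)))"
  by (induction I rule: infinite_finite_induct) (simp_all add: p_zero p_add p_smul)

lemma p_near: "u \<in> E \<Longrightarrow> N (u - proj u) \<le> C * total_err n * norm u"
  using p_est[of u] mult_left_mono[OF E_bounds(7)[of u n] C] by (simp add: total_err_def mult.assoc)

lemma projection_estimate:
  "form_op_norm smul m A (\<lambda>x. P (P x) - proj (P x)) \<le> C * total_err n"
  unfolding form_op_norm_def N_def[symmetric]
proof (rule cSUP_least)
  show "{x::'h. norm x \<le> 1} \<noteq> {}" by (rule ex_in_conv[THEN iffD1]) (auto intro: exI[of _ 0])
  fix x :: 'h assume "x \<in> {x. norm x \<le> 1}"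
  then have "norm (P x) \<le> 1" using norm_P_le[of x] by simp
  then have "C * total_err n * norm (P x) \<le> C * total_err n * 1"
    using C total_err_nonneg by (intro mult_left_mono) auto
  then show "N (P (P x) - proj (P x)) \<le> C * total_err n"
    using p_near[OF P_in[of x]] P_id[OF P_in[of x]] by simp
qed

context
  assumes small: "C * total_err n \<le> 1 / 2"
begin

text \<open>Once the error is at most 1/2, the projector is bounded below on \<open>E\<close>. The
  rank inequality and the factors 2 in the later estimates originate here.\<close>

lemma norm_le_p: "u \<in> E \<Longrightarrow> norm u \<le> 2 * norm (proj u)"
proof -
  assume u: "u \<in> E"
  have "norm (u - proj u) \<le> (1 / 2) * norm u"
    using norm_le_N[of "u - proj u"] p_near[OF u] mult_right_mono[OF small, of "norm u"] by simp
  then show ?thesis using norm_triangle_sub[of u "proj u"] by simp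
qed

lemma image_basis:
  assumes U: "mf.onb E U"
  shows "independent (proj ` U)" "card (proj ` U) = dim E"
proof -
  note f = mf.onb_facts[OF U E_subspace subset_UNIV]
  have inj: "inj_on proj E"
  proof (rule inj_onI)
    fix x y assume xy: "x \<in> E" "y \<in> E" "proj x = proj y"
    have "proj (x - y) + proj y = proj x" by (simp add: p_add[symmetric])
    then have "proj (x - y) = 0" using xy(3) by simp
    then show "x = y" using norm_le_p[of "x - y"] subspace_diff[OF E_subspace xy(1,2)] by simp
  qed
  then have injU: "inj_on proj U" using f(2) inj_on_subset by blast
  then show "card (proj ` U) = dim E" by (simp add: card_image dim_E[OF U])
  show "independent (proj ` U)"
  proof
    assume "dependent (proj ` U)"
    then obtain c v where v: "v \<in> proj ` U" "c v \<noteq> 0" and s: "(\<Sum>v\<in>proj ` U. smul (c v) v) = 0"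
      using dependent_finite[of "proj ` U"] f(1) by auto
    let ?x = "\<Sum>e\<in>U. smul (c (proj e)) e"
    have "proj ?x = (\<Sum>v\<in>proj ` U. smul (c v) v)" by (simp add: p_sum sum.reindex[OF injU])
    moreover have xE: "?x \<in> E" using f(2) by (intro subspace_sum[OF E_subspace] subspace_scale[OF E_subspace]) auto
    ultimately have x0: "?x = 0" using norm_le_p[OF xE] s by simp
    obtain e where e: "e \<in> U" "v = proj e" using v(1) by blast
    have "c (proj e) = m ?x e" by (rule mf.orthonormal_coeff[OF f(4,1) subset_UNIV e(1), symmetric])
    then show False using x0 v(2) e(2) by simp
  qed
qed

lemma range_p_span: obtains D where "finite D" "range proj \<subseteq> span D"
proof -
  obtain D where "finite D" "X n = span D" using X_fd[of n] unfolding finite_dim_subspace_def by blast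
  then show ?thesis using that[of D] p_in by auto
qed

lemma rank_lower: "dim E \<le> dim (range proj)"
proof -
  obtain U where U: "mf.onb E U" by (rule onb_E)
  obtain D where D: "finite D" "range proj \<subseteq> span D" by (rule range_p_span)
  show ?thesis
    using independent_card_le_dim_of_finite_span[OF image_basis(1)[OF U] _ D(2,1)] image_basis(2)[OF U] by auto
qed

text \<open>The image of a basis of \<open>E\<close> is independent and has as many elements as the
  rank allows, so adding a vector of the range outside its span would exceed the dimension.\<close>

lemma preimage_in_E:
  assumes rank: "dim (range proj) = dim E" and y: "y \<in> range proj"
  obtains u where "u \<in> E" "proj u = y"
proof -
  obtain U where U: "mf.onb E U" by (rule onb_E)
  note f = mf.onb_facts[OF U E_subspace subset_UNIV]
  obtain D where D: "finite D" "range proj \<subseteq> span D" by (rule range_p_span)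
  have "y \<in> span (proj ` U)"
  proof (rule ccontr)
    assume ny: "y \<notin> span (proj ` U)"
    then have "independent (insert y (proj ` U))" "y \<notin> proj ` U"
      using image_basis(1)[OF U] independent_insert[of y "proj ` U"] span_base by auto
    moreover have "insert y (proj ` U) \<subseteq> range proj" using y by blast
    ultimately have "card (insert y (proj ` U)) \<le> dim (range proj)" "y \<notin> proj ` U"
      using independent_card_le_dim_of_finite_span[OF _ _ D(2,1)] by blast+
    then show False using f(1) image_basis(2)[OF U] rank by simp
  qed
  moreover have "span (proj ` U) \<subseteq> proj ` E"
  proof (rule span_minimal)
    show "proj ` U \<subseteq> proj ` E" using f(2) by blast
    show "subspace (proj ` E)"
    proof (rule subspaceI)
      show "0 \<in> proj ` E" using p_zero subspace_0[OF E_subspace] by (metis imageI)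
      show "x + z \<in> proj ` E" if xz: "x \<in> proj ` E" "z \<in> proj ` E" for x z
      proof -
        obtain x' z' where "x' \<in> E" "x = proj x'" "z' \<in> E" "z = proj z'" using xz by blast
        then have "x + z = proj (x' + z')" "x' + z' \<in> E" using subspace_add[OF E_subspace] by (simp_all add: p_add)
        then show ?thesis by blast
      qed
      show "smul c x \<in> proj ` E" if x: "x \<in> proj ` E" for c x
      proof -
        obtain x' where "x' \<in> E" "x = proj x'" using x by blast
        then have "smul c x = proj (smul c x')" "smul c x' \<in> E" using subspace_scale[OF E_subspace] by (simp_all add: p_smul)
        then show ?thesis by blast
      qed
    qed
  qed
  ultimately show ?thesis using that by blast
qed

lemma approximate_in_E:
  assumes rank: "dim (range proj) = dim E" and y: "proj y = y"
  obtains u where "u \<in> E" "proj u = y" "norm u \<le> 2 * norm y" "N (u - y) \<le> 2 * C * norm y * total_err n"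
proof -
  have "y \<in> range proj" using y by (metis rangeI)
  then obtain u where u: "u \<in> E" "proj u = y" using preimage_in_E[OF rank] by blast
  have le: "norm u \<le> 2 * norm y" using norm_le_p[OF u(1)] u(2) by simp
  have "N (u - y) \<le> C * total_err n * norm u" using p_near[OF u(1)] u(2) by simp
  also have "\<dots> \<le> C * total_err n * (2 * norm y)" using C total_err_nonneg le by (intro mult_left_mono) auto
  finally show ?thesis using that[OF u le] by (simp add: mult.commute mult.left_commute)
qed

text \<open>For \<open>y\<close> in the range, choose \<open>u\<close> in \<open>E\<close> with
  \<open>proj u = y\<close>; then \<open>P y - y\<close> is \<open>1 - P\<close> applied to
  \<open>u - y\<close>. The factor \<open>1 + K\<close> bounds \<open>1 - P\<close> in the form
  norm, \<open>2 * C\<close> comes from the distance of \<open>u\<close> to \<open>y\<close>, and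
  \<open>B\<close> from the size of \<open>y\<close>.\<close>

lemma reverse_projection_estimate:
  assumes rank: "dim (range proj) = dim E" and K: "0 \<le> K" "\<And>u. u \<in> E \<Longrightarrow> N u \<le> K * norm u"
  shows "form_op_norm smul m A (\<lambda>x. P (proj x) - proj (proj x)) \<le> (1 + K) * (2 * C * B) * total_err n"
  unfolding form_op_norm_def N_def[symmetric]
proof (rule cSUP_least)
  show "{x::'h. norm x \<le> 1} \<noteq> {}" by (rule ex_in_conv[THEN iffD1]) (auto intro: exI[of _ 0])
  fix x :: 'h assume "x \<in> {x. norm x \<le> 1}"
  then have x: "norm x \<le> 1" by simp
  let ?y = "proj x"
  have yB: "norm ?y \<le> B" using norm_le_N[of ?y] p_bound[of x] mult_left_mono[OF x B] by simp
  obtain u where u: "u \<in> E" "N (u - ?y) \<le> 2 * C * norm ?y * total_err n"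
    using approximate_in_E[OF rank p_idem[of x]] by blast
  have "2 * C * norm ?y * total_err n \<le> 2 * C * B * total_err n"
    using C yB total_err_nonneg by (intro mult_right_mono mult_left_mono) auto
  then have d: "N (u - ?y) \<le> 2 * C * B * total_err n" using u(2) by simp
  have uQ: "u \<in> Q" by (rule E_Q[OF u(1)])
  have "P ?y - u = - P (u - ?y)" by (simp add: P_diff P_id[OF u(1)])
  then have eq: "P ?y - ?y = (u - ?y) - P (u - ?y)" by (simp add: algebra_simps)
  have "N (P ?y - ?y) \<le> N (u - ?y) + N (P (u - ?y))"
    unfolding eq by (rule N_diff[OF Q_diff[OF uQ p_Q] E_Q[OF P_in]])
  also have "N (P (u - ?y)) \<le> K * N (u - ?y)"
    using K(2)[OF P_in, of "u - ?y"] mult_left_mono[OF norm_P_le[of "u - ?y"] K(1)]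
      mult_left_mono[OF norm_le_N[of "u - ?y"] K(1)] by linarith
  finally have "N (P ?y - ?y) \<le> (1 + K) * N (u - ?y)" by (simp add: distrib_right)
  also have "\<dots> \<le> (1 + K) * (2 * C * B * total_err n)" using d K(1) by (intro mult_left_mono) auto
  finally show "N (P (proj x) - proj (proj x)) \<le> (1 + K) * (2 * C * B) * total_err n"
    by (simp add: p_idem mult.assoc)
qed

text \<open>The factor \<open>r_err\<^sup>2\<close> instead of \<open>r_err\<close> comes from \<open>(a - lam m) (w - u) e = (a - lam m) (w - u) (e - u)\<close>
  with \<open>u\<close> the eigenvector near \<open>e\<close> and \<open>w\<close> its projection onto \<open>X n\<close>.\<close>

lemma eigenvalue_estimate:
  assumes rank: "dim (range proj) = dim E" and z: "z \<in> \<sigma> n \<inter> complex_of_real ` window \<epsilon>"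
    and K: "0 \<le> K" "\<And>u. u \<in> E \<Longrightarrow> N u \<le> K * norm u"
    and Cf: "0 \<le> Cf" "\<And>x y. x \<in> Q \<Longrightarrow> y \<in> Q \<Longrightarrow> norm (a x y - of_real lam * m x y) \<le> Cf * N x * N y"
    and g: "g = 1 / sqrt \<gamma>" and one: "total_err n \<le> 1"
    and small': "sqrt \<Gamma> * (2 * g * (1 + C)) * total_err n \<le> 1 / 2"
  shows "cmod (z - complex_of_real lam)
    \<le> 2 * (4 * g\<^sup>2 * (Cf * C + (1 + \<bar>lam\<bar>) * ((1 + \<kappa>) * (1 + \<kappa> * C))) + 4 * g\<^sup>2 * ((1 + \<bar>lam\<bar>) * (K + C)))
      * ((r_err n)\<^sup>2 + s_err n)"
proof -
  obtain s e where e: "z = complex_of_real s" "e \<in> X n" "proj e = e" "mn n e e = 1"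
    "\<And>v. v \<in> X n \<Longrightarrow> an n v e = of_real s * mn n v e"
    using good z unfolding good_projector_def by blast
  interpret n: pos_form smul "X n" "mn n" by (rule mn_pos_form)
  have g0: "0 < g" using A2(1) by (simp add: g)
  \<comment> \<open>The lower bound of (A2) converts the normalization of \<open>e\<close> for
    \<open>mn\<close> into a bound in the Hilbert norm.\<close>
  have eg: "norm e \<le> g"
  proof -
    have "\<gamma> * (norm e)\<^sup>2 \<le> real_part (mn n e e)" using A2(3) e(2) unfolding uniform_bounds_def by blast
    then have "(norm e)\<^sup>2 \<le> 1 / \<gamma>" using A2(1) by (simp add: e(4) field_simps)
    also have "\<dots> = g\<^sup>2" using A2(1) by (simp add: g power_divide)
    finally show ?thesis using g0 by (intro power2_le_imp_le[of "norm e" g]) auto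
  qed
  obtain u where u: "u \<in> E" "norm u \<le> 2 * norm e" "N (u - e) \<le> 2 * C * norm e * total_err n"
    using approximate_in_E[OF rank e(3)] by blast
  let ?w = "Pr n u" and ?r = "r_err n" and ?s = "s_err n" and ?t = "total_err n"
  note nn = total_err_nonneg[of n] err_sup_nonneg'[of n]
  have uQ: "u \<in> Q" and eQ: "e \<in> Q" using E_Q[OF u(1)] e(2) X_Q by auto
  have wX: "?w \<in> X n" and wQ: "?w \<in> Q" using Pr_in[OF uQ] Pr_Q[OF uQ] by auto
  have ug: "norm u \<le> 2 * g" using u(2) eg by simp
  have scale: "x \<le> f * (2 * g)" if "x \<le> f * norm u" "0 \<le> f" for x f
    using that(1) mult_left_mono[OF ug that(2)] by simp
  have wu: "N (u - ?w) \<le> ?r * (2 * g)" and ra: "ra n u \<le> ?r * (2 * g)" and rm: "rm n u \<le> ?r * (2 * g)"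
    and sa: "sa n u \<le> ?s * (2 * g)" and sm: "sm n u \<le> ?s * (2 * g)" and sas: "sa n u + sm n u \<le> ?s * (2 * g)"
    using E_bounds(1-6)[OF u(1), of n] nn by (auto intro: scale)
  have ue: "N (u - e) \<le> 2 * C * g * ?t"
    using u(3) mult_right_mono[OF mult_left_mono[OF eg, of "2 * C"], of ?t] C nn by simp
  \<comment> \<open>Tested with \<open>e\<close>, the residual of \<open>?w\<close> equals
    \<open>(s - lam) * mn n ?w e\<close>. To extract \<open>s - lam\<close>, the second factor must
    stay away from zero; it does because \<open>?w\<close> is close to \<open>e\<close> and
    \<open>mn n e e = 1\<close>.\<close>
  have low: "1 / 2 \<le> norm (mn n ?w e)"
  proof -
    have d: "?w - e \<in> X n" using wX e(2) subspace_diff[OF X_subspace] by blast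
    have "(norm (mn n (?w - e) e))\<^sup>2 \<le> real_part (mn n (?w - e) (?w - e)) * 1"
      using n.cauchy_schwarz[OF d e(2)] by (simp add: e(4))
    also have "\<dots> \<le> \<Gamma> * (norm (?w - e))\<^sup>2" using A2(3) d unfolding uniform_bounds_def by simp
    also have "\<dots> = (sqrt \<Gamma> * norm (?w - e))\<^sup>2" using \<Gamma>_pos by (simp add: power_mult_distrib)
    finally have "norm (mn n (?w - e) e) \<le> sqrt \<Gamma> * norm (?w - e)"
      using \<Gamma>_pos by (intro power2_le_imp_le[of "norm (mn n (?w - e) e)"]) auto
    also have "norm (?w - e) \<le> N (?w - u) + N (u - e)"
      using norm_le_N[of "?w - e"] N_triangle[OF wQ uQ eQ] by linarith
    also have "\<dots> \<le> 2 * g * (1 + C) * ?t"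
    proof -
      have "?r * (2 * g) \<le> ?t * (2 * g)" using nn g0 by (intro mult_right_mono) auto
      then show ?thesis using wu ue N_minus[OF wQ uQ] by (simp add: algebra_simps)
    qed
    finally have "norm (mn n (?w - e) e) \<le> sqrt \<Gamma> * (2 * g * (1 + C) * ?t)" using \<Gamma>_pos by simp
    then have "norm (mn n (?w - e) e) \<le> 1 / 2" using small' by (simp add: mult.assoc)
    moreover have "mn n (?w - e) e = mn n ?w e - 1" using n.b_diff_left[OF wX e(2) e(2)] e(4) by simp
    ultimately show ?thesis using norm_triangle_ineq2[of 1 "1 - mn n ?w e"] by (simp add: norm_minus_commute)
  qed
  have "an n ?w e - of_real lam * mn n ?w e = of_real (s - lam) * mn n ?w e"
    by (simp add: e(5)[OF wX] left_diff_distrib)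
  then have "\<bar>s - lam\<bar> * norm (mn n ?w e) = norm (an n ?w e - of_real lam * mn n ?w e)"
    by (simp add: norm_mult del: of_real_diff)
  moreover have "\<bar>s - lam\<bar> * (1 / 2) \<le> \<bar>s - lam\<bar> * norm (mn n ?w e)" by (intro mult_left_mono low) simp
  ultimately have "\<bar>s - lam\<bar> \<le> 2 * norm (an n ?w e - of_real lam * mn n ?w e)" by simp
  also have "norm (an n ?w e - of_real lam * mn n ?w e)
      \<le> 4 * g\<^sup>2 * (Cf * C + (1 + \<bar>lam\<bar>) * ((1 + \<kappa>) * (1 + \<kappa> * C))) * (?r * ?t)
        + 4 * g\<^sup>2 * ((1 + \<bar>lam\<bar>) * (K + C)) * ?s"
  proof -
    have "a (?w - u) e - of_real lam * m (?w - u) e = a (?w - u) (e - u) - of_real lam * m (?w - u) (e - u)"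
      using a_eigen_right[OF u(1) Q_diff[OF wQ uQ]] Q_diff[OF wQ uQ] eQ uQ
      by (simp add: af.b_diff_right m_diff_right right_diff_distrib)
    then have "norm (a (?w - u) e - of_real lam * m (?w - u) e) \<le> Cf * N (?w - u) * N (e - u)"
      using Cf(2)[OF Q_diff[OF wQ uQ] Q_diff[OF eQ uQ]] by simp
    also have "\<dots> \<le> Cf * (?r * (2 * g)) * (2 * C * g * ?t)"
      using wu ue N_minus[OF wQ uQ] N_minus[OF eQ uQ] Cf(1) N_nonneg nn g0 C
      by (intro mult_mono mult_left_mono mult_nonneg_nonneg) auto
    finally have 1: "norm (a (?w - u) e - of_real lam * m (?w - u) e) \<le> 4 * g\<^sup>2 * (Cf * C) * (?r * ?t)"
      by (simp add: power2_eq_square algebra_simps)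
    \<comment> \<open>Both arguments are near \<open>u\<close>, so both factors are small: the
      projection contributes a multiple of \<open>r_err\<close>, the discrete eigenvector one of
      \<open>total_err\<close>. Each carries a factor \<open>2 * g\<close>, the bound on
      \<open>norm u\<close>.\<close>
    have prod: "f * h \<le> 4 * g\<^sup>2 * ((1 + \<kappa>) * (1 + \<kappa> * C)) * (?r * ?t)"
      if f: "f \<le> f0 + \<kappa> * N (u - ?w)" and h: "h \<le> f0 + \<kappa> * N (u - e)" "0 \<le> h" and f0: "f0 \<le> ?r * (2 * g)" for f h f0
    proof -
      have "f \<le> (1 + \<kappa>) * (?r * (2 * g))"
        using f f0 mult_left_mono[OF wu A4(1)] by (simp add: distrib_right)
      moreover have "h \<le> (1 + \<kappa> * C) * (2 * g * ?t)"
      proof -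
        have "?r * (2 * g) \<le> 2 * g * ?t" using mult_right_mono[OF nn(2), of "2 * g"] g0 by (simp add: mult.commute)
        moreover have "\<kappa> * N (u - e) \<le> \<kappa> * (2 * C * g * ?t)" by (rule mult_left_mono[OF ue A4(1)])
        ultimately have "h \<le> 2 * g * ?t + \<kappa> * (2 * C * g * ?t)" using h(1) f0 by linarith
        also have "\<dots> = (1 + \<kappa> * C) * (2 * g * ?t)" by (simp add: algebra_simps)
        finally show ?thesis .
      qed
      moreover have "0 \<le> (1 + \<kappa>) * (?r * (2 * g))" using A4(1) nn g0 by simp
      ultimately have "f * h \<le> ((1 + \<kappa>) * (?r * (2 * g))) * ((1 + \<kappa> * C) * (2 * g * ?t))"
        using h(2) by (intro mult_mono) auto
      then show ?thesis by (simp add: power2_eq_square algebra_simps)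
    qed
    have 2: "ra n ?w * ra n e \<le> 4 * g\<^sup>2 * ((1 + \<kappa>) * (1 + \<kappa> * C)) * (?r * ?t)"
      by (rule prod[OF r_triangle(1)[OF wQ uQ] r_triangle(1)[OF eQ uQ] seminorm_nonneg(1)[OF eQ] ra])
    have "rm n ?w * rm n e \<le> 4 * g\<^sup>2 * ((1 + \<kappa>) * (1 + \<kappa> * C)) * (?r * ?t)"
      by (rule prod[OF r_triangle(2)[OF wQ uQ] r_triangle(2)[OF eQ uQ] seminorm_nonneg(2)[OF eQ] rm])
    then have 3: "\<bar>lam\<bar> * (rm n ?w * rm n e) \<le> \<bar>lam\<bar> * (4 * g\<^sup>2 * ((1 + \<kappa>) * (1 + \<kappa> * C)) * (?r * ?t))"
      by (rule mult_left_mono) simp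
    have Ne: "N e \<le> 2 * g * (K + C)"
    proof -
      have "N e \<le> N u + N (e - u)" using N_add[OF uQ Q_diff[OF eQ uQ]] by simp
      moreover have "N u \<le> K * (2 * g)" using K(2)[OF u(1)] mult_left_mono[OF ug K(1)] by simp
      moreover have "N (e - u) \<le> 2 * C * g"
        using ue N_minus[OF eQ uQ] mult_left_mono[OF one, of "2 * C * g"] C g0 by simp
      ultimately show ?thesis by (simp add: algebra_simps)
    qed
    have "sa n u + \<bar>lam\<bar> * sm n u \<le> (1 + \<bar>lam\<bar>) * (?s * (2 * g))"
      using sa sm sas mult_left_mono[OF sm, of "\<bar>lam\<bar>"] by (simp add: distrib_right)
    then have "(sa n u + \<bar>lam\<bar> * sm n u) * N e \<le> ((1 + \<bar>lam\<bar>) * (?s * (2 * g))) * (2 * g * (K + C))"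
      using Ne N_nonneg[of e] nn g0 by (intro mult_mono) auto
    then have 4: "(sa n u + \<bar>lam\<bar> * sm n u) * N e \<le> 4 * g\<^sup>2 * ((1 + \<bar>lam\<bar>) * (K + C)) * ?s"
      by (simp add: power2_eq_square algebra_simps)
    show ?thesis using residual_split[OF u(1) e(2)] 1 2 3 4 by (simp add: algebra_simps)
  qed
  finally have main: "\<bar>s - lam\<bar> \<le> 2 * (4 * g\<^sup>2 * (Cf * C + (1 + \<bar>lam\<bar>) * ((1 + \<kappa>) * (1 + \<kappa> * C))) * (?r * ?t)
        + 4 * g\<^sup>2 * ((1 + \<bar>lam\<bar>) * (K + C)) * ?s)" by simp
  define k1 where "k1 = 4 * g\<^sup>2 * (Cf * C + (1 + \<bar>lam\<bar>) * ((1 + \<kappa>) * (1 + \<kappa> * C)))"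
  define k2 where "k2 = 4 * g\<^sup>2 * ((1 + \<bar>lam\<bar>) * (K + C))"
  have k: "0 \<le> k1" "0 \<le> k2" unfolding k1_def k2_def using Cf(1) C A4(1) K(1) by (auto intro!: mult_nonneg_nonneg add_nonneg_nonneg)
  \<comment> \<open>Since \<open>r_err <= total_err <= 1\<close>, the mixed term in
    \<open>r_err * total_err = r_err^2 + r_err * s_err\<close> is absorbed by the first-order term
    \<open>s_err\<close>.\<close>
  have "?r * ?s \<le> 1 * ?s" using nn one by (intro mult_right_mono) auto
  then have "?r * ?t \<le> ?r\<^sup>2 + ?s" by (simp add: total_err_def distrib_left power2_eq_square)
  then have "k1 * (?r * ?t) \<le> k1 * (?r\<^sup>2 + ?s)" by (rule mult_left_mono[OF _ k(1)])
  moreover have "k2 * ?s \<le> k2 * (?r\<^sup>2 + ?s)" by (rule mult_left_mono[OF _ k(2)]) simp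
  ultimately have "\<bar>s - lam\<bar> \<le> 2 * (k1 + k2) * (?r\<^sup>2 + ?s)"
    using main unfolding k1_def[symmetric] k2_def[symmetric] by (simp add: distrib_right)
  moreover have "cmod (z - complex_of_real lam) = \<bar>s - lam\<bar>"
    unfolding e(1) by (metis norm_of_real of_real_diff)
  ultimately show ?thesis unfolding k1_def k2_def by simp
qed

end

end

section \<open>The estimates of the theorem for all large indices\<close>

lemma total_err_eq: "total_err n =
    proj_err n + sphere_sup P (ra n) + sphere_sup P (rm n) + sphere_sup P (sa n) + sphere_sup P (sm n)"
  by (simp add: total_err_def r_err_def s_err_def)

lemma spectral_projector_estimates:
  assumes \<epsilon>: "0 < \<epsilon>"
    and lim: "limsup_sets \<sigma> \<inter> complex_of_real ` {lam - \<epsilon><..<lam + \<epsilon>} = {complex_of_real lam}"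
  shows "\<forall>\<^sub>F n in sequentially. dim E \<le> dim (range (Pn \<epsilon> n))"
    and "\<exists>C\<ge>0. \<forall>\<^sub>F n in sequentially. form_op_norm smul m A (\<lambda>x. P (P x) - Pn \<epsilon> n (P x)) \<le> C *
      (proj_err n + sphere_sup P (ra n) + sphere_sup P (rm n) + sphere_sup P (sa n) + sphere_sup P (sm n))"
    and "\<forall>\<^sub>F n in sequentially. dim (range (Pn \<epsilon> n)) = dim E \<Longrightarrow>
      \<exists>C\<ge>0. \<forall>\<^sub>F n in sequentially.
        form_op_norm smul m A (\<lambda>x. P (Pn \<epsilon> n x) - Pn \<epsilon> n (Pn \<epsilon> n x)) \<le> C *
          (proj_err n + sphere_sup P (ra n) + sphere_sup P (rm n) + sphere_sup P (sa n) + sphere_sup P (sm n)) \<and>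
        Max ((\<lambda>z. cmod (z - complex_of_real lam)) ` (\<sigma> n \<inter> complex_of_real ` window \<epsilon>)) \<le> C *
          ((proj_err n + sphere_sup P (ra n) + sphere_sup P (rm n))\<^sup>2 + sphere_sup P (sa n) + sphere_sup P (sm n))"
proof -
  obtain B C where B: "0 \<le> B" and C: "0 \<le> C" and good: "\<forall>\<^sub>F n in sequentially. good_projector \<epsilon> B C n"
    by (rule good_projector_eventually[OF assms])
  \<comment> \<open>All thresholds on \<open>n\<close> that come from smallness are of this one
    kind, with different multiples of the total error.\<close>
  have small: "\<forall>\<^sub>F n in sequentially. k * total_err n \<le> d" if "0 < d" for k d
  proof -
    have "(\<lambda>n. k * total_err n) \<longlonglongrightarrow> k * 0"
      using err_sup_tendsto unfolding total_err_def by (rule tendsto_mult_left)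
    then have "\<forall>\<^sub>F n in sequentially. k * total_err n < d" using that by (intro order_tendstoD(2)) simp
    then show ?thesis by (rule eventually_mono) simp
  qed
  have half: "\<forall>\<^sub>F n in sequentially. C * total_err n \<le> 1 / 2" by (rule small) simp
  show "\<forall>\<^sub>F n in sequentially. dim E \<le> dim (range (Pn \<epsilon> n))"
    using good half by eventually_elim (rule rank_lower[OF _ B C])
  have "\<forall>\<^sub>F n in sequentially. form_op_norm smul m A (\<lambda>x. P (P x) - Pn \<epsilon> n (P x)) \<le> C * total_err n"
    using good by (rule eventually_mono) (rule projection_estimate[OF _ B C])
  then show "\<exists>C\<ge>0. \<forall>\<^sub>F n in sequentially. form_op_norm smul m A (\<lambda>x. P (P x) - Pn \<epsilon> n (P x)) \<le> C *
      (proj_err n + sphere_sup P (ra n) + sphere_sup P (rm n) + sphere_sup P (sa n) + sphere_sup P (sm n))"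
    using C unfolding total_err_eq by blast
  assume rank: "\<forall>\<^sub>F n in sequentially. dim (range (Pn \<epsilon> n)) = dim E"
  obtain K where K: "0 \<le> K" "\<And>u. u \<in> E \<Longrightarrow> N u \<le> K * norm u" using N_E_bound by blast
  obtain Cf where Cf: "0 \<le> Cf" "\<And>x y. x \<in> Q \<Longrightarrow> y \<in> Q \<Longrightarrow> norm (a x y - of_real lam * m x y) \<le> Cf * N x * N y"
    using form_difference_bound by blast
  define g where "g = 1 / sqrt \<gamma>"
  define C1 where "C1 = (1 + K) * (2 * C * B)"
  define C2 where "C2 = 2 * (4 * g\<^sup>2 * (Cf * C + (1 + \<bar>lam\<bar>) * ((1 + \<kappa>) * (1 + \<kappa> * C))) + 4 * g\<^sup>2 * ((1 + \<bar>lam\<bar>) * (K + C)))"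
  have C12: "0 \<le> C1" "0 \<le> C2"
    unfolding C1_def C2_def using K(1) C B Cf(1) A4(1) by (auto intro!: mult_nonneg_nonneg add_nonneg_nonneg)
  have one: "\<forall>\<^sub>F n in sequentially. 1 * total_err n \<le> 1" by (rule small) simp
  have sm': "\<forall>\<^sub>F n in sequentially. (sqrt \<Gamma> * (2 * g * (1 + C))) * total_err n \<le> 1 / 2" by (rule small) simp
  \<comment> \<open>The maximum in the conclusion is over the discrete eigenvalues in the window;
    convergence of the spectrum guarantees that there is one.\<close>
  have ne: "\<forall>\<^sub>F n in sequentially. \<exists>z\<in>\<sigma> n. cmod (z - complex_of_real lam) < \<epsilon> / 2"
    using \<epsilon> by (intro spectrum_near) simp
  have "\<forall>\<^sub>F n in sequentially.
      form_op_norm smul m A (\<lambda>x. P (Pn \<epsilon> n x) - Pn \<epsilon> n (Pn \<epsilon> n x)) \<le> (C1 + C2) * total_err n \<and>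
      Max ((\<lambda>z. cmod (z - complex_of_real lam)) ` (\<sigma> n \<inter> complex_of_real ` window \<epsilon>)) \<le> (C1 + C2) * ((r_err n)\<^sup>2 + s_err n)"
    using good half rank one sm' ne
  proof eventually_elim
    case (elim n)
    have "form_op_norm smul m A (\<lambda>x. P (Pn \<epsilon> n x) - Pn \<epsilon> n (Pn \<epsilon> n x)) \<le> C1 * total_err n"
      unfolding C1_def by (rule reverse_projection_estimate[OF elim(1) B C elim(2,3) K])
    also have "\<dots> \<le> (C1 + C2) * total_err n" using C12 total_err_nonneg(1) by (intro mult_right_mono) auto
    finally have 1: "form_op_norm smul m A (\<lambda>x. P (Pn \<epsilon> n x) - Pn \<epsilon> n (Pn \<epsilon> n x)) \<le> (C1 + C2) * total_err n" .
    have le: "cmod (z - complex_of_real lam) \<le> (C1 + C2) * ((r_err n)\<^sup>2 + s_err n)"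
      if z: "z \<in> \<sigma> n \<inter> complex_of_real ` window \<epsilon>" for z
    proof -
      have "cmod (z - complex_of_real lam) \<le> C2 * ((r_err n)\<^sup>2 + s_err n)"
        unfolding C2_def
        by (rule eigenvalue_estimate[OF elim(1) B C elim(2,3) z K Cf g_def]) (use elim(4,5) in simp_all)
      also have "\<dots> \<le> (C1 + C2) * ((r_err n)\<^sup>2 + s_err n)"
        using C12 err_sup_nonneg' by (intro mult_right_mono) auto
      finally show ?thesis .
    qed
    obtain z where z: "z \<in> \<sigma> n" "cmod (z - complex_of_real lam) < \<epsilon> / 2" using elim(6) by blast
    have "\<exists>s. z = complex_of_real s" by (rule pencil[of n]) (use z(1) in auto)
    then obtain s where s: "z = complex_of_real s" by blast
    have "\<bar>s - lam\<bar> < \<epsilon> / 2" using z(2) unfolding s by (metis norm_of_real of_real_diff)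
    then have "lam - \<epsilon> / 2 < s" "s < lam + \<epsilon> / 2" unfolding abs_less_iff by linarith+
    then have "s \<in> window \<epsilon>" by (simp add: window_def)
    then have "\<sigma> n \<inter> complex_of_real ` window \<epsilon> \<noteq> {}" using z(1) s by blast
    then have "Max ((\<lambda>z. cmod (z - complex_of_real lam)) ` (\<sigma> n \<inter> complex_of_real ` window \<epsilon>)) \<le> (C1 + C2) * ((r_err n)\<^sup>2 + s_err n)"
      using le \<sigma>_finite by (subst Max_le_iff) auto
    with 1 show ?case by blast
  qed
  then have "\<forall>\<^sub>F n in sequentially.
      form_op_norm smul m A (\<lambda>x. P (Pn \<epsilon> n x) - Pn \<epsilon> n (Pn \<epsilon> n x)) \<le> (C1 + C2) *
        (proj_err n + sphere_sup P (ra n) + sphere_sup P (rm n) + sphere_sup P (sa n) + sphere_sup P (sm n)) \<and>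
      Max ((\<lambda>z. cmod (z - complex_of_real lam)) ` (\<sigma> n \<inter> complex_of_real ` window \<epsilon>)) \<le> (C1 + C2) *
        ((proj_err n + sphere_sup P (ra n) + sphere_sup P (rm n))\<^sup>2 + sphere_sup P (sa n) + sphere_sup P (sm n))"
    unfolding total_err_eq r_err_def s_err_def by (simp add: add.assoc)
  then show "\<exists>C\<ge>0. \<forall>\<^sub>F n in sequentially.
        form_op_norm smul m A (\<lambda>x. P (Pn \<epsilon> n x) - Pn \<epsilon> n (Pn \<epsilon> n x)) \<le> C *
          (proj_err n + sphere_sup P (ra n) + sphere_sup P (rm n) + sphere_sup P (sa n) + sphere_sup P (sm n)) \<and>
        Max ((\<lambda>z. cmod (z - complex_of_real lam)) ` (\<sigma> n \<inter> complex_of_real ` window \<epsilon>)) \<le> C *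
          ((proj_err n + sphere_sup P (ra n) + sphere_sup P (rm n))\<^sup>2 + sphere_sup P (sa n) + sphere_sup P (sm n))"
    using C12 by (intro exI[of _ "C1 + C2"] conjI) auto
qed

end

theorem theorem3p1:
  fixes smul :: "'k::real_or_complex \<Rightarrow> 'h::{real_inner, polish_space} \<Rightarrow> 'h"
    and m :: "('k, 'h) form"
    and A :: "'h \<rightharpoonup> 'h"
    and lam :: real and q :: nat
    and X :: "nat \<Rightarrow> 'h set"
    and an mn an' mn' :: "nat \<Rightarrow> ('k, 'h) form"
    and \<gamma> \<Gamma> \<kappa> :: real
    and ra rm sa sm :: "nat \<Rightarrow> 'h \<Rightarrow> real"
  assumes "hilbert_space smul m"
    and "self_adjoint smul m A"
    and "complex_of_real lam \<in> discrete_spectrum smul A"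
    and "q = vector_space.dim smul (op_eigenspace smul A (of_real lam))"
    and "approximation smul m A X an mn"
    and A1: "approximability smul m A X"
    and A2: "0 < \<gamma>" "\<gamma> \<le> \<Gamma>" "uniform_bounds smul m A X an mn \<gamma> \<Gamma>"
    and A3: "inf_sup_stability smul m A X an mn"
    and A4: "0 \<le> \<kappa>" "uniform_bounds smul m A X an' mn' \<gamma> \<Gamma>"
      "consistency smul m A X an mn an' mn' \<kappa> ra rm sa sm"
  shows
    "let \<sigma> = (\<lambda>n. approx_spectrum smul m (X n) (an n) (mn n));
         P = orth_proj m (op_eigenspace smul A (of_real lam));
         nrm = form_op_norm smul m A;
         proj_err = (\<lambda>n. nrm (\<lambda>x. P x - form_proj smul m A (X n) (P x)));
         Ra = (\<lambda>n. sphere_sup P (ra n)); Rm = (\<lambda>n. sphere_sup P (rm n));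
         Sa = (\<lambda>n. sphere_sup P (sa n)); Sm = (\<lambda>n. sphere_sup P (sm n))
     in
      (\<exists>N. complex_of_real lam \<in> liminf_sets (\<lambda>n. \<sigma> (n + N))) \<and>
      ((\<forall>n. X n \<noteq> {0}) \<longrightarrow> complex_of_real lam \<in> liminf_sets \<sigma>) \<and>
      (\<forall>\<epsilon>>0.
        complex_of_real ` {lam - \<epsilon><..<lam + \<epsilon>} \<inter> op_spectrum smul A = {complex_of_real lam} \<and>
        limsup_sets \<sigma> \<inter> complex_of_real ` {lam - \<epsilon><..<lam + \<epsilon>} = {complex_of_real lam} \<longrightarrow>
        (let J = {lam - \<epsilon> / 2<..<lam + \<epsilon> / 2};
             Pn = (\<lambda>n. approx_projector smul m (X n) (an n) (mn n) J)
         in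
          (\<forall>\<^sub>F n in sequentially. q \<le> vector_space.dim smul (range (Pn n))) \<and>
          (\<exists>C\<ge>0. \<forall>\<^sub>F n in sequentially.
            nrm (\<lambda>x. P (P x) - Pn n (P x)) \<le> C * (proj_err n + Ra n + Rm n + Sa n + Sm n)) \<and>
          ((\<forall>\<^sub>F n in sequentially. vector_space.dim smul (range (Pn n)) = q) \<longrightarrow>
            (\<exists>C\<ge>0. \<forall>\<^sub>F n in sequentially.
              nrm (\<lambda>x. P (Pn n x) - Pn n (Pn n x)) \<le> C * (proj_err n + Ra n + Rm n + Sa n + Sm n) \<and>
              Max ((\<lambda>z. cmod (z - complex_of_real lam)) ` (\<sigma> n \<inter> complex_of_real ` J))
                \<le> C * ((proj_err n + Ra n + Rm n)\<^sup>2 + Sa n + Sm n)))))"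
proof -
  interpret e: eigenvalue_approximation smul m A lam X an mn an' mn' \<gamma> \<Gamma> \<kappa> ra rm sa sm
    by (rule eigenvalue_approximation.intro[OF assms(1) eigenvalue_approximation_axioms.intro]) fact+
  note defs = e.\<sigma>_def e.P_def e.E_def e.proj_err_def e.Pr_def e.Pn_def e.window_def
  note part1 = e.eigenvalue_liminf[unfolded defs]
    and part2 = e.spectral_projector_estimates[unfolded defs]
  have \<sigma>: "e.\<sigma> = (\<lambda>n. approx_spectrum smul m (X n) (an n) (mn n))" by (rule ext) (rule e.\<sigma>_def)
  show ?thesis
    unfolding Let_def assms(4)
  proof (rule conjI[OF part1(1)], rule conjI, rule impI)
    assume "\<forall>n. X n \<noteq> {0}"
    then show "complex_of_real lam \<in> liminf_sets (\<lambda>n. approx_spectrum smul m (X n) (an n) (mn n))"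
      unfolding \<sigma>[symmetric] by (rule e.eigenvalue_liminf(2))
  qed (intro allI impI, elim conjE, intro conjI impI part2; (assumption | simp only: \<sigma>))
qed

end
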